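(* Let $G$ be a pro-$p$ group and let $T_1$ and $T_2$ be pro-$p$ $G$-trees such that $T_1/G$ is finite. Suppose $T_1$ is elliptic with respect to $T_2$. Then there exists a $G$-tree $\hat T_1$ with a morphism $p:\hat T_1\to T_1$ such that: (1) $p$ is a collapse map; (2) $\hat T_1$ is a refinement of $T_1$ that dominates $T_2$; (3) the stabilizer of any edge of $\hat T_1$ fixes an edge in $T_1$ or in $T_2$; (4) a subgroup of $G$ is elliptic in $\hat T_1$ if and only if it is elliptic in both $T_1$ and $T_2$.
   Context: Conventions: groups are pro-$p$, subgroups closed, homomorphisms continuous. Pro-$p$ trees: a profinite graph is a profinite space $\Gamma$ with closed vertex set $V(\Gamma)$, $E(\Gamma)=\Gamma\setminus V(\Gamma)$, and continuous $d_0,d_1:\Gamma\to V(\Gamma)$ that are the identity on $V(\Gamma)$; it is connected if all its finite quotient graphs are connected. With $E^*(\Gamma)=\Gamma/V(\Gamma)$ pointed by the image of $V(\Gamma)$, and $[[\mathbb{F}_pX]]$, $[[\mathbb{F}_p(X,* )]]$ the free profinite $\mathbb{F}_p$-modules on a profinite (pointed profinite) space, $\Gamma$ is a pro-$p$ tree if $0\to[[\mathbb{F}_p(E^*(\Gamma),* )]]\xrightarrow{\delta}[[\mathbb{F}_pV(\Gamma)]]\xrightarrow{\epsilon}\mathbb{F}_p\to0$ is exact, $\delta(\bar e)=d_1(e)-d_0(e)$, $\epsilon(v)=1$. A $G$-tree is a pro-$p$ tree with continuous $G$-action commuting with $d_0,d_1$. A subgroup is elliptic in a $G$-tree if it fixes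 a vertex of it. A collapse map of $G$-trees is the map collapsing the connected components of some $G$-invariant subgraph to vertices. $T$ refines (is a refinement of) $T_0$ if there is a $G$-collapse $T\to T_0$. $T_1$ dominates $T_2$ if every vertex stabilizer of $T_1$ fixes a vertex in $T_2$. $T_1$ is elliptic with respect to $T_2$ if every edge stabilizer of $T_1$ fixes a vertex in $T_2$. *)

theory Defs
  imports "HOL-Analysis.Analysis" "HOL-Algebra.Group_Action" "HOL-Algebra.Module"
    "HOL-Number_Theory.Residues"
begin

section \<open>Profinite spaces and pro-$p$ groups\<close>

definition profinite_space :: "'a topology \<Rightarrow> bool" where
  "profinite_space X \<longleftrightarrow>
     compact_space X \<and> Hausdorff_space X \<and> (\<forall>S. connectedin X S \<longrightarrow> (\<exists>x. S \<subseteq> {x}))"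

definition quotient_topology :: "'a topology \<Rightarrow> ('a \<Rightarrow> 'b) \<Rightarrow> 'b topology" where
  "quotient_topology X q =
     topology (\<lambda>U. U \<subseteq> q ` topspace X \<and> openin X {x \<in> topspace X. q x \<in> U})"

lemma openin_quotient_topology:
  "openin (quotient_topology X q) U \<longleftrightarrow>
     U \<subseteq> q ` topspace X \<and> openin X {x \<in> topspace X. q x \<in> U}"
proof -
  have "istopology (\<lambda>U. U \<subseteq> q ` topspace X \<and> openin X {x \<in> topspace X. q x \<in> U})"
    unfolding istopology_def
  proof (intro conjI allI impI; (elim conjE)?)
    fix S T
    assume "openin X {x \<in> topspace X. q x \<in> S}" "openin X {x \<in> topspace X. q x \<in> T}"
    then have "openin X ({x \<in> topspace X. q x \<in> S} \<inter> {x \<in> topspace X. q x \<in> T})"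
      by (rule openin_Int)
    also have "{x \<in> topspace X. q x \<in> S} \<inter> {x \<in> topspace X. q x \<in> T} =
        {x \<in> topspace X. q x \<in> S \<inter> T}"
      by auto
    finally show "openin X {x \<in> topspace X. q x \<in> S \<inter> T}" .
  next
    fix \<K>
    assume K: "\<forall>K\<in>\<K>. K \<subseteq> q ` topspace X \<and> openin X {x \<in> topspace X. q x \<in> K}"
    then have "openin X (\<Union>K\<in>\<K>. {x \<in> topspace X. q x \<in> K})"
      by blast
    also have "(\<Union>K\<in>\<K>. {x \<in> topspace X. q x \<in> K}) = {x \<in> topspace X. q x \<in> \<Union>\<K>}"
      by auto
    finally show "openin X {x \<in> topspace X. q x \<in> \<Union>\<K>}" .
  qed blast+
  then show ?thesis
    by (simp add: quotient_topology_def)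
qed

lemma topspace_quotient_topology: "topspace (quotient_topology X q) = q ` topspace X"
proof
  have "openin (quotient_topology X q) (q ` topspace X)"
    by (auto simp: openin_quotient_topology intro: back_subst[of "openin X", OF openin_topspace])
  then show "q ` topspace X \<subseteq> topspace (quotient_topology X q)"
    by (rule openin_subset)
qed (metis openin_quotient_topology openin_topspace)

lemma quotient_map_quotient_topology: "quotient_map X (quotient_topology X q) q"
  by (simp add: quotient_map_def topspace_quotient_topology openin_quotient_topology)

record 'g top_group = "'g monoid" +
  gtop :: "'g topology"

definition topological_group :: "('g, 'm) top_group_scheme \<Rightarrow> bool" where
  "topological_group G \<longleftrightarrow>
     group G \<and> topspace (gtop G) = carrier G \<and>
     continuous_map (prod_topology (gtop G) (gtop G)) (gtop G) (\<lambda>(x, y). x \<otimes>\<^bsub>G\<^esub> y) \<and>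
     continuous_map (gtop G) (gtop G) (\<lambda>x. inv\<^bsub>G\<^esub> x)"

definition pro_p_group :: "nat \<Rightarrow> ('g, 'm) top_group_scheme \<Rightarrow> bool" where
  "pro_p_group p G \<longleftrightarrow>
     topological_group G \<and> profinite_space (gtop G) \<and>
     (\<forall>N. N \<lhd> G \<and> openin (gtop G) N \<longrightarrow> (\<exists>k. card (rcosets\<^bsub>G\<^esub> N) = p ^ k))"

definition closed_subgroup :: "'g set \<Rightarrow> ('g, 'm) top_group_scheme \<Rightarrow> bool" where
  "closed_subgroup H G \<longleftrightarrow> subgroup H G \<and> closedin (gtop G) H"


section \<open>Free profinite $\mathbb{F}_p$-modules\<close>

record ('r, 'm) top_module = "('r, 'm) module" +
  mtop :: "'m topology"

definition continuous_module_hom ::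
    "('r, 'k) ring_scheme \<Rightarrow> ('r, 'm) top_module \<Rightarrow> ('r, 'n) top_module \<Rightarrow> ('m \<Rightarrow> 'n) \<Rightarrow> bool" where
  "continuous_module_hom R M N f \<longleftrightarrow>
     f \<in> carrier M \<rightarrow> carrier N \<and> continuous_map (mtop M) (mtop N) f \<and>
     (\<forall>x\<in>carrier M. \<forall>y\<in>carrier M. f (x \<oplus>\<^bsub>M\<^esub> y) = f x \<oplus>\<^bsub>N\<^esub> f y) \<and>
     (\<forall>r\<in>carrier R. \<forall>x\<in>carrier M. f (r \<odot>\<^bsub>M\<^esub> x) = r \<odot>\<^bsub>N\<^esub> f x)"

abbreviation Fp :: "nat \<Rightarrow> int ring" where
  "Fp p \<equiv> residue_ring (int p)"

text \<open>In the two module records below, the ring fields \<open>mult\<close> and \<open>one\<close>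
  (which the locale \<open>module\<close> does not use) are irrelevant.\<close>

definition Fp_module :: "nat \<Rightarrow> (int, int) top_module" where
  "Fp_module p =
     \<lparr>carrier = carrier (Fp p), monoid.mult = (\<otimes>\<^bsub>Fp p\<^esub>), one = \<one>\<^bsub>Fp p\<^esub>,
      zero = \<zero>\<^bsub>Fp p\<^esub>, add = (\<oplus>\<^bsub>Fp p\<^esub>), smult = (\<otimes>\<^bsub>Fp p\<^esub>),
      mtop = discrete_topology (carrier (Fp p))\<rparr>"

text \<open>The finite discrete quotient spaces of a profinite space are given by its finite partitions
  into clopen blocks (the complement of a block is a union of blocks, so open blocks are clopen).\<close>

definition clopen_partitions :: "'a topology \<Rightarrow> 'a set set set" where
  "clopen_partitions X =
     {P. finite P \<and> partition_on (topspace X) P \<and> (\<forall>B\<in>P. openin X B)}"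

text \<open>\<open>free_profinite_module p X A\<close> is the inverse limit of the free $\mathbb{F}_p$-modules on the
  finite discrete quotients of \<open>X\<close>, in which the classes of the points of \<open>A\<close> are set to zero.
  It is only used for \<open>A = {}\<close>, which gives $[[\mathbb{F}_p X]]$, and for \<open>A = {a}\<close>, which gives
  $[[\mathbb{F}_p (X,a)]]$. An element is a family \<open>c\<close> with \<open>c P B\<close> the coefficient of the block
  \<open>B\<close> in the component at the partition \<open>P\<close>; if \<open>P\<close> refines \<open>Q\<close>, then the transition map sends
  the basis element of a block of \<open>P\<close> to that of the block of \<open>Q\<close> containing it.\<close>

definition free_profinite_carrier ::
    "nat \<Rightarrow> 'a topology \<Rightarrow> 'a set \<Rightarrow> ('a set set \<Rightarrow> 'a set \<Rightarrow> int) set" where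
  "free_profinite_carrier p X A =
     {c \<in> (\<Pi>\<^sub>E P\<in>clopen_partitions X. \<Pi>\<^sub>E B\<in>P. carrier (Fp p)).
        (\<forall>P\<in>clopen_partitions X. \<forall>B\<in>P. B \<inter> A \<noteq> {} \<longrightarrow> c P B = 0) \<and>
        (\<forall>P\<in>clopen_partitions X. \<forall>Q\<in>clopen_partitions X. refines (topspace X) P Q \<longrightarrow>
          (\<forall>B\<in>Q. B \<inter> A = {} \<longrightarrow> c Q B = (\<Sum>C\<in>{C\<in>P. C \<subseteq> B}. c P C) mod int p))}"

definition free_profinite_module ::
    "nat \<Rightarrow> 'a topology \<Rightarrow> 'a set \<Rightarrow> (int, 'a set set \<Rightarrow> 'a set \<Rightarrow> int) top_module" where
  "free_profinite_module p X A =
     \<lparr>carrier = free_profinite_carrier p X A,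
      monoid.mult = undefined,
      one = undefined,
      zero = (\<lambda>P\<in>clopen_partitions X. \<lambda>B\<in>P. 0),
      add = (\<lambda>c d. \<lambda>P\<in>clopen_partitions X. \<lambda>B\<in>P. c P B \<oplus>\<^bsub>Fp p\<^esub> d P B),
      smult = (\<lambda>r c. \<lambda>P\<in>clopen_partitions X. \<lambda>B\<in>P. r \<otimes>\<^bsub>Fp p\<^esub> c P B),
      mtop = subtopology
        (product_topology (\<lambda>P. product_topology (\<lambda>B. discrete_topology (carrier (Fp p))) P)
          (clopen_partitions X))
        (free_profinite_carrier p X A)\<rparr>"

lemma linear_combination_in_free_profinite_carrier:
  assumes "p > 0" and f: "\<And>P B. f P B = (\<Sum>k\<in>K. r k * c k P B) mod int p"
    and c: "\<And>k. k \<in> K \<Longrightarrow> c k \<in> free_profinite_carrier p X A"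
  shows "(\<lambda>P\<in>clopen_partitions X. \<lambda>B\<in>P. f P B) \<in> free_profinite_carrier p X A"
proof -
  have zero: "f P B = 0" if "P \<in> clopen_partitions X" "B \<in> P" "B \<inter> A \<noteq> {}" for P B
  proof -
    have "c k P B = 0" if "k \<in> K" for k
      using c[OF that] \<open>P \<in> _\<close> \<open>B \<in> P\<close> \<open>B \<inter> A \<noteq> {}\<close> unfolding free_profinite_carrier_def by blast
    then show ?thesis by (simp add: f)
  qed
  have compat: "f Q B = (\<Sum>C\<in>{C\<in>P. C \<subseteq> B}. f P C) mod int p"
    if "P \<in> clopen_partitions X" "Q \<in> clopen_partitions X" "refines (topspace X) P Q" "B \<in> Q"
      "B \<inter> A = {}" for P Q B
  proof -
    have "c k Q B = (\<Sum>C\<in>{C\<in>P. C \<subseteq> B}. c k P C) mod int p" if "k \<in> K" for k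
      using c[OF that] that \<open>P \<in> _\<close> \<open>Q \<in> _\<close> \<open>refines _ _ _\<close> \<open>B \<in> Q\<close> \<open>B \<inter> A = {}\<close>
      unfolding free_profinite_carrier_def by blast
    then have "f Q B = (\<Sum>k\<in>K. r k * ((\<Sum>C\<in>{C\<in>P. C \<subseteq> B}. c k P C) mod int p)) mod int p"
      by (simp add: f)
    also have "\<dots> = (\<Sum>k\<in>K. r k * (\<Sum>C\<in>{C\<in>P. C \<subseteq> B}. c k P C)) mod int p"
      by (subst (1 2) mod_sum_eq[symmetric]) (simp only: mod_mult_right_eq)
    also have "\<dots> = (\<Sum>C\<in>{C\<in>P. C \<subseteq> B}. \<Sum>k\<in>K. r k * c k P C) mod int p"
      unfolding sum_distrib_left by (subst sum.swap) (rule refl)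
    also have "\<dots> = (\<Sum>C\<in>{C\<in>P. C \<subseteq> B}. f P C) mod int p"
      by (simp add: f mod_sum_eq)
    finally show ?thesis .
  qed
  have "f P B \<in> carrier (Fp p)" for P B
    using \<open>p > 0\<close> by (simp add: f residue_ring_def)
  moreover have "(\<Sum>C\<in>{C\<in>P. C \<subseteq> B}. (\<lambda>B\<in>P. f P B) C) = (\<Sum>C\<in>{C\<in>P. C \<subseteq> B}. f P C)" for P B
    by (rule sum.cong) auto
  ultimately show ?thesis
    using zero compat unfolding free_profinite_carrier_def by auto
qed

lemma module_free_profinite_module:
  assumes "p > 1"
  shows "module (Fp p) (free_profinite_module p X A)"
proof -
  let ?M = "free_profinite_module p X A"
  interpret residues "int p" "Fp p" by unfold_locales (use assms in auto)
  have p: "p > 0" using assms by simp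
  have ext: "x = y" if "x \<in> carrier ?M" "y \<in> carrier ?M"
    "\<And>P B. P \<in> clopen_partitions X \<Longrightarrow> B \<in> P \<Longrightarrow> x P B = y P B" for x y
  proof -
    have x: "x \<in> (\<Pi>\<^sub>E P\<in>clopen_partitions X. \<Pi>\<^sub>E B\<in>P. carrier (Fp p))"
      and y: "y \<in> (\<Pi>\<^sub>E P\<in>clopen_partitions X. \<Pi>\<^sub>E B\<in>P. carrier (Fp p))"
      using that by (auto simp: free_profinite_module_def free_profinite_carrier_def)
    show ?thesis
      by (intro PiE_ext[OF x y] PiE_ext[OF PiE_mem[OF x] PiE_mem[OF y]]) (auto intro: that)
  qed
  have val: "0 \<le> x P B \<and> x P B < int p"
    if "x \<in> carrier ?M" "P \<in> clopen_partitions X" "B \<in> P" for x P B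
    using that by (force simp: free_profinite_module_def free_profinite_carrier_def residue_ring_def
        PiE_iff)
  have zero: "\<zero>\<^bsub>?M\<^esub> \<in> carrier ?M"
    using linear_combination_in_free_profinite_carrier[OF p, where K = "{} :: nat set" and f = "\<lambda>_ _. 0"]
    by (simp add: free_profinite_module_def)
  have smult: "r \<odot>\<^bsub>?M\<^esub> x \<in> carrier ?M" if "x \<in> carrier ?M" for r x
    using linear_combination_in_free_profinite_carrier[OF p, where K = "{0} :: nat set" and r = "\<lambda>_. r"
      and c = "\<lambda>_. x" and f = "\<lambda>P B. r \<otimes>\<^bsub>Fp p\<^esub> x P B"] that
    by (simp add: free_profinite_module_def residue_ring_def)
  have add: "x \<oplus>\<^bsub>?M\<^esub> y \<in> carrier ?M" if "x \<in> carrier ?M" "y \<in> carrier ?M" for x y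
    using linear_combination_in_free_profinite_carrier[OF p, where K = "{True, False}" and r = "\<lambda>_. 1"
      and c = "\<lambda>b. if b then x else y" and f = "\<lambda>P B. x P B \<oplus>\<^bsub>Fp p\<^esub> y P B"] that
    by (simp add: free_profinite_module_def residue_ring_def)
  have ev [simp]: "\<zero>\<^bsub>?M\<^esub> P B = 0" "(x \<oplus>\<^bsub>?M\<^esub> y) P B = (x P B + y P B) mod int p"
    "(r \<odot>\<^bsub>?M\<^esub> x) P B = (r * x P B) mod int p"
    if "P \<in> clopen_partitions X" "B \<in> P" for x y r P B
    using that by (simp_all add: free_profinite_module_def residue_ring_def)
  have res [simp]: "r \<oplus>\<^bsub>Fp p\<^esub> s = (r + s) mod int p" "r \<otimes>\<^bsub>Fp p\<^esub> s = (r * s) mod int p"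
    "\<one>\<^bsub>Fp p\<^esub> = 1" for r s
    by (simp_all add: residue_ring_def)
  show ?thesis
  proof (rule moduleI[OF cring])
    show "abelian_group ?M"
    proof (rule abelian_groupI)
      fix x assume x: "x \<in> carrier ?M"
      show "\<exists>y\<in>carrier ?M. y \<oplus>\<^bsub>?M\<^esub> x = \<zero>\<^bsub>?M\<^esub>"
        by (intro bexI[of _ "(-1) \<odot>\<^bsub>?M\<^esub> x"] ext add zero smult x) (simp add: mod_simps)
    qed ((rule ext)?; simp add: add zero mod_simps ac_simps val)+
  qed ((rule ext)?; simp add: add smult mod_simps algebra_simps val)+
qed

text \<open>The image of a point of \<open>X\<close> in \<open>free_profinite_module p X A\<close>.\<close>

definition free_profinite_gen :: "'a topology \<Rightarrow> 'a set \<Rightarrow> 'a \<Rightarrow> 'a set set \<Rightarrow> 'a set \<Rightarrow> int" where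
  "free_profinite_gen X A x =
     (\<lambda>P\<in>clopen_partitions X. \<lambda>B\<in>P. if x \<in> B \<and> B \<inter> A = {} then 1 else 0)"

lemma free_profinite_gen_in_carrier:
  assumes "p > 1" "x \<in> topspace X"
  shows "free_profinite_gen X A x \<in> carrier (free_profinite_module p X A)"
proof -
  let ?g = "\<lambda>B. if x \<in> B \<and> B \<inter> A = {} then 1 else 0 :: int"
  have "?g B = (\<Sum>C\<in>{C\<in>P. C \<subseteq> B}. free_profinite_gen X A x P C) mod int p"
    if P: "P \<in> clopen_partitions X" "Q \<in> clopen_partitions X" "refines (topspace X) P Q"
      and B: "B \<in> Q" "B \<inter> A = {}" for P Q B
  proof -
    have part: "partition_on (topspace X) P" "partition_on (topspace X) Q" "finite P"
      using P by (auto simp: clopen_partitions_def)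
    obtain C where C: "C \<in> P" "x \<in> C"
      using part(1) assms(2) by (auto simp: partition_on_def)
    have uniq: "D = C" if "D \<in> P" "x \<in> D" for D
      using part(1) C that by (auto simp: partition_on_def disjoint_def)
    have sub: "C \<subseteq> B" if "x \<in> B"
    proof -
      obtain D where D: "D \<in> Q" "C \<subseteq> D"
        using P(3) C by (auto simp: refines_def)
      then have "D = B"
        using part(2) C that B unfolding partition_on_def disjoint_def by blast
      then show ?thesis using D by simp
    qed
    have "(\<Sum>D\<in>{D\<in>P. D \<subseteq> B}. free_profinite_gen X A x P D) =
        (\<Sum>D\<in>{D\<in>P. D \<subseteq> B}. if D = C then 1 else 0)"
    proof (rule sum.cong)
      fix D assume D: "D \<in> {D\<in>P. D \<subseteq> B}"
      then have "D \<inter> A = {}" using B by auto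
      moreover have "x \<in> D \<longleftrightarrow> D = C" using uniq[of D] C(2) D by blast
      ultimately show "free_profinite_gen X A x P D = (if D = C then 1 else 0)"
        using P(1) D by (simp add: free_profinite_gen_def)
    qed simp
    also have "\<dots> = (if C \<subseteq> B then 1 else 0)"
      using part(3) C by simp
    also have "(C \<subseteq> B) = (x \<in> B)"
      using sub C by auto
    finally show ?thesis
      using B assms(1) by simp
  qed
  then show ?thesis
    using assms(1) unfolding free_profinite_module_def free_profinite_carrier_def
    by (simp add: free_profinite_gen_def residue_ring_def)
qed


section \<open>Profinite graphs\<close>

record 'a pgraph =
  gspace :: "'a topology"
  verts :: "'a set"
  d0 :: "'a \<Rightarrow> 'a"
  d1 :: "'a \<Rightarrow> 'a"

definition edges :: "('a, 'm) pgraph_scheme \<Rightarrow> 'a set" where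
  "edges \<Gamma> = topspace (gspace \<Gamma>) - verts \<Gamma>"

definition profinite_graph :: "('a, 'm) pgraph_scheme \<Rightarrow> bool" where
  "profinite_graph \<Gamma> \<longleftrightarrow>
     profinite_space (gspace \<Gamma>) \<and> closedin (gspace \<Gamma>) (verts \<Gamma>) \<and>
     continuous_map (gspace \<Gamma>) (subtopology (gspace \<Gamma>) (verts \<Gamma>)) (d0 \<Gamma>) \<and>
     continuous_map (gspace \<Gamma>) (subtopology (gspace \<Gamma>) (verts \<Gamma>)) (d1 \<Gamma>) \<and>
     (\<forall>v\<in>verts \<Gamma>. d0 \<Gamma> v = v \<and> d1 \<Gamma> v = v)"

text \<open>Morphisms may send edges to vertices.\<close>

definition graph_morphism ::
    "('a, 'm) pgraph_scheme \<Rightarrow> ('b, 'n) pgraph_scheme \<Rightarrow> ('a \<Rightarrow> 'b) \<Rightarrow> bool" where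
  "graph_morphism \<Gamma> \<Delta> f \<longleftrightarrow>
     continuous_map (gspace \<Gamma>) (gspace \<Delta>) f \<and>
     (\<forall>x\<in>topspace (gspace \<Gamma>). f (d0 \<Gamma> x) = d0 \<Delta> (f x) \<and> f (d1 \<Gamma> x) = d1 \<Delta> (f x))"

text \<open>A finite profinite graph carries the discrete topology, so this is the usual notion of a
  finite graph. Up to isomorphism, each of them lives on a set of natural numbers, and the finite
  quotient graphs of \<open>\<Gamma>\<close> are its images under surjective morphisms onto finite graphs.\<close>

definition finite_graph :: "('a, 'm) pgraph_scheme \<Rightarrow> bool" where
  "finite_graph Q \<longleftrightarrow> profinite_graph Q \<and> finite (topspace (gspace Q))"

definition finite_graph_connected :: "('a, 'm) pgraph_scheme \<Rightarrow> bool" where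
  "finite_graph_connected Q \<longleftrightarrow>
     (\<forall>u\<in>verts Q. \<forall>v\<in>verts Q.
        (u, v) \<in> (\<Union>e\<in>edges Q. {(d0 Q e, d1 Q e), (d1 Q e, d0 Q e)})\<^sup>*)"

definition pgraph_connected :: "('a, 'm) pgraph_scheme \<Rightarrow> bool" where
  "pgraph_connected \<Gamma> \<longleftrightarrow>
     (\<forall>(Q :: nat pgraph) f. finite_graph Q \<and> graph_morphism \<Gamma> Q f \<and>
        f ` topspace (gspace \<Gamma>) = topspace (gspace Q) \<longrightarrow> finite_graph_connected Q)"

definition subgraph :: "'a set \<Rightarrow> ('a, 'm) pgraph_scheme \<Rightarrow> bool" where
  "subgraph S \<Gamma> \<longleftrightarrow> closedin (gspace \<Gamma>) S \<and> d0 \<Gamma> ` S \<subseteq> S \<and> d1 \<Gamma> ` S \<subseteq> S"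

definition restrict_graph :: "('a, 'm) pgraph_scheme \<Rightarrow> 'a set \<Rightarrow> ('a, 'm) pgraph_scheme" where
  "restrict_graph \<Gamma> S = \<Gamma>\<lparr>gspace := subtopology (gspace \<Gamma>) S, verts := verts \<Gamma> \<inter> S\<rparr>"

definition connected_subgraph :: "'a set \<Rightarrow> ('a, 'm) pgraph_scheme \<Rightarrow> bool" where
  "connected_subgraph C \<Gamma> \<longleftrightarrow> subgraph C \<Gamma> \<and> C \<noteq> {} \<and> pgraph_connected (restrict_graph \<Gamma> C)"

definition graph_components :: "('a, 'm) pgraph_scheme \<Rightarrow> 'a set \<Rightarrow> 'a set set" where
  "graph_components \<Gamma> S =
     {C. connected_subgraph C \<Gamma> \<and> C \<subseteq> S \<and>
         (\<forall>D. connected_subgraph D \<Gamma> \<and> D \<subseteq> S \<and> C \<subseteq> D \<longrightarrow> D = C)}"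


section \<open>Pro-$p$ trees\<close>

text \<open>The pointed profinite space $E^*(\Gamma) = \Gamma / V(\Gamma)$ has the underlying set
  \<open>Some ` edges \<Gamma> \<union> {None}\<close> (if there is a vertex), with base point \<open>None\<close>.\<close>

definition edge_class :: "('a, 'm) pgraph_scheme \<Rightarrow> 'a \<Rightarrow> 'a option" where
  "edge_class \<Gamma> x = (if x \<in> verts \<Gamma> then None else Some x)"

definition edge_space :: "('a, 'm) pgraph_scheme \<Rightarrow> 'a option topology" where
  "edge_space \<Gamma> = quotient_topology (gspace \<Gamma>) (edge_class \<Gamma>)"

definition vertex_space :: "('a, 'm) pgraph_scheme \<Rightarrow> 'a topology" where
  "vertex_space \<Gamma> = subtopology (gspace \<Gamma>) (verts \<Gamma>)"

text \<open>A continuous homomorphism on a free profinite module is determined by its values on the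
  generators, so \<open>\<delta>\<close> and \<open>\<epsilon>\<close> below are uniquely determined on the carriers.\<close>

definition pro_p_tree :: "nat \<Rightarrow> ('a, 'm) pgraph_scheme \<Rightarrow> bool" where
  "pro_p_tree p \<Gamma> \<longleftrightarrow> profinite_graph \<Gamma> \<and>
     (let ME = free_profinite_module p (edge_space \<Gamma>) {None};
          MV = free_profinite_module p (vertex_space \<Gamma>) {};
          gE = free_profinite_gen (edge_space \<Gamma>) {None};
          gV = free_profinite_gen (vertex_space \<Gamma>) {}
      in \<exists>\<delta> \<epsilon>.
        continuous_module_hom (Fp p) ME MV \<delta> \<and>
        (\<forall>e\<in>edges \<Gamma>. \<delta> (gE (edge_class \<Gamma> e)) = gV (d1 \<Gamma> e) \<ominus>\<^bsub>MV\<^esub> gV (d0 \<Gamma> e)) \<and>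
        continuous_module_hom (Fp p) MV (Fp_module p) \<epsilon> \<and>
        (\<forall>v\<in>verts \<Gamma>. \<epsilon> (gV v) = \<one>\<^bsub>Fp p\<^esub>) \<and>
        inj_on \<delta> (carrier ME) \<and>
        \<delta> ` carrier ME = {x \<in> carrier MV. \<epsilon> x = \<zero>\<^bsub>Fp p\<^esub>} \<and>
        \<epsilon> ` carrier MV = carrier (Fp p))"


section \<open>Pro-$p$ $G$-trees\<close>

record ('g, 'a) ggraph = "'a pgraph" +
  act :: "'g \<Rightarrow> 'a \<Rightarrow> 'a"

definition graph_action :: "('g, 'm) top_group_scheme \<Rightarrow> ('g, 'a) ggraph \<Rightarrow> bool" where
  "graph_action G T \<longleftrightarrow>
     group_action G (topspace (gspace T)) (act T) \<and>
     continuous_map (prod_topology (gtop G) (gspace T)) (gspace T) (\<lambda>(g, x). act T g x) \<and>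
     (\<forall>g\<in>carrier G. \<forall>x\<in>topspace (gspace T).
        d0 T (act T g x) = act T g (d0 T x) \<and> d1 T (act T g x) = act T g (d1 T x))"

definition G_tree :: "nat \<Rightarrow> ('g, 'm) top_group_scheme \<Rightarrow> ('g, 'a) ggraph \<Rightarrow> bool" where
  "G_tree p G T \<longleftrightarrow> pro_p_tree p T \<and> graph_action G T"

definition G_morphism ::
    "('g, 'm) top_group_scheme \<Rightarrow> ('g, 'a) ggraph \<Rightarrow> ('g, 'b) ggraph \<Rightarrow> ('a \<Rightarrow> 'b) \<Rightarrow> bool" where
  "G_morphism G T T' f \<longleftrightarrow> graph_morphism T T' f \<and>
     (\<forall>g\<in>carrier G. \<forall>x\<in>topspace (gspace T). f (act T g x) = act T' g (f x))"

text \<open>In a collapse map, the image of every component of \<open>\<Delta>\<close> is automatically a vertex, since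
  a component contains a vertex and morphisms send vertices to vertices.\<close>

definition collapse_map ::
    "('g, 'm) top_group_scheme \<Rightarrow> ('g, 'a) ggraph \<Rightarrow> ('g, 'b) ggraph \<Rightarrow> ('a \<Rightarrow> 'b) \<Rightarrow> bool" where
  "collapse_map G T T' f \<longleftrightarrow> G_morphism G T T' f \<and> quotient_map (gspace T) (gspace T') f \<and>
     (\<exists>\<Delta>. subgraph \<Delta> T \<and> (\<forall>g\<in>carrier G. act T g ` \<Delta> \<subseteq> \<Delta>) \<and>
        (\<forall>x\<in>topspace (gspace T). \<forall>y\<in>topspace (gspace T).
           f x = f y \<longleftrightarrow> x = y \<or> (\<exists>C\<in>graph_components T \<Delta>. x \<in> C \<and> y \<in> C)))"

definition refinement ::
    "('g, 'm) top_group_scheme \<Rightarrow> ('g, 'a) ggraph \<Rightarrow> ('g, 'b) ggraph \<Rightarrow> bool" where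
  "refinement G T T0 \<longleftrightarrow> (\<exists>f. collapse_map G T T0 f)"

definition elliptic :: "'g set \<Rightarrow> ('g, 'a) ggraph \<Rightarrow> bool" where
  "elliptic H T \<longleftrightarrow> (\<exists>v\<in>verts T. \<forall>h\<in>H. act T h v = v)"

definition fixes_edge :: "'g set \<Rightarrow> ('g, 'a) ggraph \<Rightarrow> bool" where
  "fixes_edge H T \<longleftrightarrow> (\<exists>e\<in>edges T. \<forall>h\<in>H. act T h e = e)"

definition dominates ::
    "('g, 'm) top_group_scheme \<Rightarrow> ('g, 'a) ggraph \<Rightarrow> ('g, 'b) ggraph \<Rightarrow> bool" where
  "dominates G T1 T2 \<longleftrightarrow> (\<forall>v\<in>verts T1. elliptic (stabilizer G (act T1) v) T2)"

definition elliptic_wrt ::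
    "('g, 'm) top_group_scheme \<Rightarrow> ('g, 'a) ggraph \<Rightarrow> ('g, 'b) ggraph \<Rightarrow> bool" where
  "elliptic_wrt G T1 T2 \<longleftrightarrow> (\<forall>e\<in>edges T1. elliptic (stabilizer G (act T1) e) T2)"

end

theory Submission
  imports Defs
begin

text \<open>
  Let \<open>V\<close> and \<open>E\<close> denote vertices and edges. The tree is obtained by blowing up every vertex of \<open>T1\<close>
  to a copy of \<open>T2\<close>. Since \<open>T1/G\<close> is finite, \<open>E(T1)\<close> is a finite union of orbits, so choosing for one
  edge of each orbit a vertex of \<open>T2\<close> fixed by its stabilizer, and transporting the choice by \<open>G\<close>,
  gives a continuous equivariant map from \<open>E(T1)\<close> to \<open>V(T2)\<close>. It is represented by its graph \<open>F\<close>, a finite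
  union of \<open>G\<close>-orbits and hence closed in \<open>T1 \<times> T2\<close>. The new tree is the closed invariant subset
  \<open>V(T1) \<times> T2 \<union> F\<close> of \<open>T1 \<times> T2\<close>, with everything defined componentwise: an edge \<open>e\<close> of \<open>T1\<close> is attached
  to the two copies of \<open>T2\<close> at its ends in the same vertex \<open>x\<close>, where \<open>(e, x) \<in> F\<close>.

  With this description most claims are immediate. A vertex is a pair of vertices, so its stabilizer
  fixes a vertex of both trees, and a subgroup is elliptic exactly if it is elliptic in both trees; one of
  the two components of an edge is an edge. The first projection collapses the subgraph
  \<open>V(T1) \<times> T2\<close>, whose components are the sets \<open>{v} \<times> T2\<close>: these are connected because a pro-\<open>p\<close> tree
  is connected, and a connected subgraph of \<open>V(T1) \<times> T2\<close> has only one first coordinate because it has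
  no edges in the direction of \<open>T1\<close> and \<open>V(T1)\<close> is profinite.

  What remains is that the blow-up is a pro-\<open>p\<close> tree. This is done by duality: the
  exactness of the sequence of free profinite modules is equivalent to the exactness of
  \<open>0 \<rightarrow> Fp \<rightarrow> C(V, Fp) \<rightarrow> C(\<Gamma>, V; Fp) \<rightarrow> 0\<close>, where \<open>C\<close> stands for locally constant
  functions, relative to \<open>V\<close> if they vanish there, and the map sends \<open>f\<close> to
  \<open>e \<mapsto> f (d1 e) - f (d0 e)\<close>. Both directions
  (\<open>pro_p_tree_if_dual_sequence_exact\<close>, \<open>dual_sequence_exact_if_pro_p_tree\<close>) rest on the pairing
  of free profinite modules with locally constant functions, which treats the elements of the module as
  measures. Every linear functional on the functions comes from a measure
  (\<open>integrate_measure_of_functional\<close>), and every continuous functional on an embedded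
  submodule is integration of a function (\<open>functional_factors_through_injection\<close>).

  For the blow-up the dual sequence is easy. A function on the vertices with zero coboundary is constant on
  every copy of \<open>T2\<close>, hence comes from \<open>V(T1)\<close>, and then is constant because \<open>T1\<close> is a tree. Given
  a function to be written as a coboundary, one first solves the problem on each copy of \<open>T2\<close>; the solution
  can be chosen to depend only on the restriction of the function to that copy, and this restriction is
  locally constant in the vertex of \<open>T1\<close> by the tube lemma. The difference is supported on \<open>F\<close>, hence is a function on the
  edges of \<open>T1\<close>, and is a coboundary there.
\<close>

section \<open>Locally constant functions and clopen partitions\<close>

text \<open>Functions with values in the field with \<open>p\<close> elements are represented by integer-valued functions that
  are compared modulo \<open>p\<close>, so that sums and multiples need no reduction.\<close>

definition locally_constant :: "'a topology \<Rightarrow> ('a \<Rightarrow> int) \<Rightarrow> bool" where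
  "locally_constant X h \<longleftrightarrow> continuous_map X (discrete_topology UNIV) h"

lemma locally_constant_comp:
  "\<lbrakk>continuous_map X Y f; locally_constant Y h\<rbrakk> \<Longrightarrow> locally_constant X (\<lambda>x. h (f x))"
  unfolding locally_constant_def using continuous_map_compose[of X Y f _ h] by (simp add: o_def)

lemma locally_constant_comp2:
  assumes "locally_constant X f" "locally_constant X g"
  shows "locally_constant X (\<lambda>x. F (f x) (g x))"
proof -
  have "continuous_map X (discrete_topology (UNIV \<times> UNIV)) (\<lambda>x. (f x, g x))"
    using assms unfolding prod_topology_discrete_topology continuous_map_pairwise
    by (simp add: locally_constant_def o_def)
  then have "continuous_map X (discrete_topology UNIV) ((\<lambda>(a, b). F a b) \<circ> (\<lambda>x. (f x, g x)))"
    by (rule continuous_map_compose) (simp add: continuous_map_from_discrete_topology)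
  then show ?thesis by (simp add: locally_constant_def o_def)
qed

lemma locally_constant_const: "locally_constant X (\<lambda>_. k)"
  by (simp add: locally_constant_def)

lemma openin_locally_constant_fiber:
  "locally_constant X h \<Longrightarrow> openin X {x \<in> topspace X. h x \<in> K}"
  unfolding locally_constant_def continuous_map_def by auto

definition fibers :: "'a topology \<Rightarrow> ('a \<Rightarrow> int) \<Rightarrow> 'a set set" where
  "fibers X h = (\<lambda>x. {y \<in> topspace X. h y = h x}) ` topspace X"

definition constant_on_blocks :: "'a set set \<Rightarrow> ('a \<Rightarrow> int) \<Rightarrow> bool" where
  "constant_on_blocks P h \<longleftrightarrow> (\<forall>B\<in>P. \<forall>x\<in>B. \<forall>y\<in>B. h x = h y)"

lemma ex_block_of_point:
  assumes P: "P \<in> clopen_partitions X" and x: "x \<in> topspace X"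
  shows "\<exists>B\<in>P. x \<in> B \<and> (\<forall>C\<in>P. x \<in> C \<longleftrightarrow> C = B)"
proof -
  have part: "\<Union>P = topspace X" "disjoint P"
    using P by (auto simp: clopen_partitions_def partition_on_def)
  then obtain B where B: "B \<in> P" "x \<in> B" using x by auto
  have "x \<in> C \<longleftrightarrow> C = B" if C: "C \<in> P" for C
    using disjointD[OF part(2) C B(1)] B(2) by auto
  then show ?thesis using B by (intro bexI[of _ B]) simp_all
qed

lemma block_subset: "\<lbrakk>P \<in> clopen_partitions X; B \<in> P\<rbrakk> \<Longrightarrow> B \<subseteq> topspace X"
  by (auto simp: clopen_partitions_def partition_on_def)

lemma point_of_block:
  assumes "P \<in> clopen_partitions X" "B \<in> P"
  shows "(SOME x. x \<in> B) \<in> B"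
proof -
  have "B \<noteq> {}" using assms by (auto simp: clopen_partitions_def partition_on_def)
  then show ?thesis by (simp add: some_in_eq)
qed

lemma constant_on_blocks_fibers: "constant_on_blocks (fibers X h) h"
  by (auto simp: constant_on_blocks_def fibers_def)

lemma constant_on_blocks_refines:
  "\<lbrakk>constant_on_blocks Q h; refines S P Q\<rbrakk> \<Longrightarrow> constant_on_blocks P h"
  unfolding constant_on_blocks_def refines_def by blast

lemma fibers_in_clopen_partitions:
  assumes "compact_space X" "locally_constant X h"
  shows "fibers X h \<in> clopen_partitions X"
proof -
  have "compactin (discrete_topology UNIV) (h ` topspace X)"
    using assms unfolding compact_space_def locally_constant_def by (blast intro: image_compactin)
  then have "finite (h ` topspace X)"
    by (simp add: compactin_discrete_topology)
  moreover have "fibers X h = (\<lambda>k. {y \<in> topspace X. h y = k}) ` h ` topspace X"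
    by (auto simp: fibers_def)
  ultimately have "finite (fibers X h)" by simp
  moreover have "partition_on (topspace X) (fibers X h)"
    by (rule partition_onI) (auto simp: fibers_def disjnt_def)
  moreover have "openin X {y \<in> topspace X. h y = k}" for k
    using openin_locally_constant_fiber[OF assms(2), of "{k}"] by simp
  ultimately show ?thesis
    by (auto simp: clopen_partitions_def fibers_def)
qed

lemma refines_fibers:
  assumes "P \<in> clopen_partitions X" "fibers X h \<in> clopen_partitions X" "constant_on_blocks P h"
  shows "refines (topspace X) P (fibers X h)"
  unfolding refines_def
proof (intro conjI ballI)
  fix B assume B: "B \<in> P"
  then obtain x where "x \<in> B" "B \<subseteq> topspace X"
    using point_of_block[OF assms(1) B] block_subset[OF assms(1) B] by blast
  then have "B \<subseteq> {y \<in> topspace X. h y = h x}"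
    using assms(3) B unfolding constant_on_blocks_def by blast
  moreover have "x \<in> topspace X" using \<open>x \<in> B\<close> \<open>B \<subseteq> topspace X\<close> by blast
  ultimately show "\<exists>Y\<in>fibers X h. B \<subseteq> Y"
    unfolding fibers_def by (metis (no_types, lifting) imageI)
qed (use assms(1,2) in \<open>simp_all add: clopen_partitions_def\<close>)

text \<open>On a compact space, the locally constant functions are those that factor through a finite clopen
  partition; the partition into fibers is the coarsest one that works.\<close>

lemma locally_constant_if_constant_on_blocks:
  assumes P: "P \<in> clopen_partitions X" and h: "constant_on_blocks P h"
  shows "locally_constant X h"
proof -
  have "openin X {x \<in> topspace X. h x \<in> U}" for U
  proof -
    have "{x \<in> topspace X. h x \<in> U} = \<Union>{B \<in> P. \<exists>x\<in>B. h x \<in> U}"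
    proof (intro equalityI subsetI)
      fix x assume x: "x \<in> {x \<in> topspace X. h x \<in> U}"
      then obtain B where "B \<in> P" "x \<in> B" using ex_block_of_point[OF P] by blast
      then show "x \<in> \<Union>{B \<in> P. \<exists>x\<in>B. h x \<in> U}" using x by blast
    next
      fix x assume "x \<in> \<Union>{B \<in> P. \<exists>x\<in>B. h x \<in> U}"
      then obtain B y where B: "B \<in> P" "x \<in> B" "y \<in> B" "h y \<in> U" by blast
      then have "h x = h y" using h unfolding constant_on_blocks_def by blast
      then show "x \<in> {x \<in> topspace X. h x \<in> U}" using B block_subset[OF P] by auto
    qed
    moreover have "openin X \<dots>"
      using P by (intro openin_Union) (auto simp: clopen_partitions_def)
    ultimately show ?thesis by simp
  qed
  then show ?thesis
    by (simp add: locally_constant_def continuous_map_def)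
qed

text \<open>The trivial partition is added to the family to cover the case that the family is empty.\<close>

lemma ex_common_refinement:
  assumes "compact_space X" "finite F" "F \<subseteq> clopen_partitions X"
  shows "\<exists>P\<in>clopen_partitions X. \<forall>Q\<in>F. refines (topspace X) P Q"
proof -
  define F' where "F' = insert (fibers X (\<lambda>_. 0)) F"
  have F': "finite F'" "F' \<noteq> {}" "F' \<subseteq> clopen_partitions X"
    using assms fibers_in_clopen_partitions[OF assms(1) locally_constant_const]
    by (auto simp: F'_def)
  then have part: "\<And>P. P \<in> F' \<Longrightarrow> partition_on (topspace X) P"
    and fin: "\<And>P. P \<in> F' \<Longrightarrow> finite P"
    and op: "\<And>P B. P \<in> F' \<Longrightarrow> B \<in> P \<Longrightarrow> openin X B"
    by (auto simp: clopen_partitions_def)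
  have "openin X B" if "B \<in> common_refinement F'" for B
    using that F' op unfolding common_refinement_def by (auto intro!: openin_Inter)
  then have "common_refinement F' \<in> clopen_partitions X"
    using partition_on_common_refinement[of F' "topspace X"] part F'(1,2) fin
    by (auto simp: clopen_partitions_def intro: finite_common_refinement)
  moreover have "refines (topspace X) (common_refinement F') Q" if "Q \<in> F" for Q
    using that part by (intro refines_common_refinement) (auto simp: F'_def)
  ultimately show ?thesis by blast
qed

section \<open>Elements of a free profinite module as measures\<close>

text \<open>The functions on which elements of \<open>free_profinite_module p X A\<close> are evaluated: those that vanish
  on \<open>A\<close> modulo \<open>p\<close>.\<close>

definition test_function :: "nat \<Rightarrow> 'a topology \<Rightarrow> 'a set \<Rightarrow> ('a \<Rightarrow> int) \<Rightarrow> bool" where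
  "test_function p X A h \<longleftrightarrow> locally_constant X h \<and> (\<forall>x\<in>A. int p dvd h x)"

text \<open>The choice of the point in each block does not matter for functions that are constant on the blocks,
  the only ones to which this is applied. Reading \<open>c P B\<close> as the measure of \<open>B\<close>, this is the integral
  of the step function \<open>h\<close>.\<close>

definition block_sum :: "('a \<Rightarrow> int) \<Rightarrow> ('a set set \<Rightarrow> 'a set \<Rightarrow> int) \<Rightarrow> 'a set set \<Rightarrow> int" where
  "block_sum h c P = (\<Sum>B\<in>P. h (SOME x. x \<in> B) * c P B)"

definition integrate :: "nat \<Rightarrow> 'a topology \<Rightarrow> ('a \<Rightarrow> int) \<Rightarrow> ('a set set \<Rightarrow> 'a set \<Rightarrow> int) \<Rightarrow> int" where
  "integrate p X h c = block_sum h c (fibers X h) mod int p"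

lemma carrier_free_profinite_module [simp]:
  "carrier (free_profinite_module p X A) = free_profinite_carrier p X A"
  by (simp add: free_profinite_module_def)

lemma free_profinite_carrier_coeff:
  assumes "c \<in> free_profinite_carrier p X A" "P \<in> clopen_partitions X" "B \<in> P"
  shows "0 \<le> c P B" "c P B < int p"
proof -
  have "c P B \<in> carrier (Fp p)"
    using assms unfolding free_profinite_carrier_def by (auto simp: PiE_iff)
  then show "0 \<le> c P B" "c P B < int p" by (auto simp: residue_ring_def)
qed

lemma free_profinite_carrier_zero:
  assumes "c \<in> free_profinite_carrier p X A" "P \<in> clopen_partitions X" "B \<in> P" "B \<inter> A \<noteq> {}"
  shows "c P B = 0"
  using assms unfolding free_profinite_carrier_def by blast

lemma free_profinite_carrier_refines:
  assumes "c \<in> free_profinite_carrier p X A" "P \<in> clopen_partitions X" "Q \<in> clopen_partitions X"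
    "refines (topspace X) P Q" "B \<in> Q" "B \<inter> A = {}"
  shows "c Q B = (\<Sum>C\<in>{C\<in>P. C \<subseteq> B}. c P C) mod int p"
  using assms unfolding free_profinite_carrier_def by blast

lemma sum_over_refinement:
  assumes PQ: "P \<in> clopen_partitions X" "Q \<in> clopen_partitions X" "refines (topspace X) P Q"
  shows "(\<Sum>C\<in>P. F C) = (\<Sum>B\<in>Q. \<Sum>C\<in>{C\<in>P. C \<subseteq> B}. F C)"
proof -
  have P: "finite P" "\<And>B. B \<in> P \<Longrightarrow> B \<noteq> {}" and Q: "finite Q" "disjoint Q"
    using PQ by (auto simp: clopen_partitions_def partition_on_def)
  have "P = (\<Union>B\<in>Q. {C\<in>P. C \<subseteq> B})"
    using PQ(3) by (auto simp: refines_def)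
  then have "(\<Sum>C\<in>P. F C) = (\<Sum>C\<in>(\<Union>B\<in>Q. {C\<in>P. C \<subseteq> B}). F C)"
    by simp
  also have "\<dots> = (\<Sum>B\<in>Q. \<Sum>C\<in>{C\<in>P. C \<subseteq> B}. F C)"
  proof (rule sum.UNION_disjoint)
    show "\<forall>i\<in>Q. \<forall>j\<in>Q. i \<noteq> j \<longrightarrow> {C \<in> P. C \<subseteq> i} \<inter> {C \<in> P. C \<subseteq> j} = {}"
    proof (intro ballI impI)
      fix i j assume "i \<in> Q" "j \<in> Q" "i \<noteq> j"
      then have "i \<inter> j = {}" using Q(2) by (auto simp: disjoint_def)
      then show "{C \<in> P. C \<subseteq> i} \<inter> {C \<in> P. C \<subseteq> j} = {}" using P(2) by blast
    qed
  qed (use P Q in auto)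
  finally show ?thesis .
qed

text \<open>The compatibility of the coefficients only concerns blocks that do not meet \<open>A\<close>. On the other
  blocks \<open>h\<close> is divisible by \<open>p\<close>, so they contribute nothing to either sum.\<close>

lemma block_sum_refinement:
  assumes c: "c \<in> free_profinite_carrier p X A"
    and PQ: "P \<in> clopen_partitions X" "Q \<in> clopen_partitions X" "refines (topspace X) P Q"
    and h: "constant_on_blocks Q h" "\<forall>x\<in>A. int p dvd h x"
  shows "[block_sum h c Q = block_sum h c P] (mod int p)"
proof -
  have "block_sum h c P = (\<Sum>B\<in>Q. \<Sum>C\<in>{C\<in>P. C \<subseteq> B}. h (SOME x. x \<in> C) * c P C)"
    unfolding block_sum_def by (rule sum_over_refinement[OF PQ])
  also have "\<dots> = (\<Sum>B\<in>Q. h (SOME x. x \<in> B) * (\<Sum>C\<in>{C\<in>P. C \<subseteq> B}. c P C))"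
    unfolding sum_distrib_left
  proof (intro sum.cong refl)
    fix B C assume "B \<in> Q" "C \<in> {C\<in>P. C \<subseteq> B}"
    then have "(SOME x. x \<in> C) \<in> B" "(SOME x. x \<in> B) \<in> B"
      using point_of_block[OF PQ(1)] point_of_block[OF PQ(2)] by auto
    then have "h (SOME x. x \<in> C) = h (SOME x. x \<in> B)"
      using h(1) \<open>B \<in> Q\<close> unfolding constant_on_blocks_def by blast
    then show "h (SOME x. x \<in> C) * c P C = h (SOME x. x \<in> B) * c P C" by simp
  qed
  finally have *: "block_sum h c P = (\<Sum>B\<in>Q. h (SOME x. x \<in> B) * (\<Sum>C\<in>{C\<in>P. C \<subseteq> B}. c P C))" .
  show ?thesis
    unfolding * unfolding block_sum_def
  proof (rule cong_sum)
    fix B assume B: "B \<in> Q"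
    show "[h (SOME x. x \<in> B) * c Q B = h (SOME x. x \<in> B) * (\<Sum>C\<in>{C\<in>P. C \<subseteq> B}. c P C)] (mod int p)"
    proof (cases "B \<inter> A = {}")
      case True
      then show ?thesis
        using free_profinite_carrier_refines[OF c PQ B] by (intro cong_scalar_left) (simp add: cong_def)
    next
      case False
      then obtain a where "a \<in> B" "a \<in> A" by auto
      then have "h (SOME x. x \<in> B) = h a"
        using h(1) B point_of_block[OF PQ(2) B] unfolding constant_on_blocks_def by blast
      then have "int p dvd h (SOME x. x \<in> B)" using h(2) \<open>a \<in> A\<close> by simp
      then show ?thesis by (simp add: cong_iff_dvd_diff flip: right_diff_distrib)
    qed
  qed
qed

lemma integrate_cong_block_sum:
  assumes X: "compact_space X" and h: "test_function p X A h"
    and c: "c \<in> free_profinite_carrier p X A"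
    and P: "P \<in> clopen_partitions X" "constant_on_blocks P h"
  shows "[integrate p X h c = block_sum h c P] (mod int p)"
proof -
  have f: "fibers X h \<in> clopen_partitions X"
    using X h by (intro fibers_in_clopen_partitions) (auto simp: test_function_def)
  have "[block_sum h c (fibers X h) = block_sum h c P] (mod int p)"
    using h by (intro block_sum_refinement[OF c P(1) f refines_fibers[OF P(1) f P(2)]])
      (auto simp: constant_on_blocks_fibers test_function_def)
  then show ?thesis by (simp add: integrate_def cong_def)
qed

lemma ex_partition_for_functions:
  assumes "compact_space X" "finite K" "\<And>k. k \<in> K \<Longrightarrow> locally_constant X (h k)"
  shows "\<exists>P\<in>clopen_partitions X. \<forall>k\<in>K. constant_on_blocks P (h k)"
proof -
  obtain P where "P \<in> clopen_partitions X" "\<forall>Q\<in>(\<lambda>k. fibers X (h k)) ` K. refines (topspace X) P Q"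
    using ex_common_refinement[of X "(\<lambda>k. fibers X (h k)) ` K"] assms fibers_in_clopen_partitions
    by (metis finite_imageI image_subsetI)
  then show ?thesis
    using constant_on_blocks_refines[OF constant_on_blocks_fibers] by blast
qed

text \<open>Linearity is demanded for all finite linear combinations at once and only up to congruence on the
  space. This makes the value depend on the function modulo \<open>p\<close> only. Index sets consisting of blocks
  suffice, since the functional is only decomposed along partitions.\<close>

definition linear_functional :: "nat \<Rightarrow> 'a topology \<Rightarrow> 'a set \<Rightarrow> (('a \<Rightarrow> int) \<Rightarrow> int) \<Rightarrow> bool" where
  "linear_functional p X A L \<longleftrightarrow>
     (\<forall>(K :: 'a set set) r h g. finite K \<longrightarrow> (\<forall>k\<in>K. test_function p X A (h k)) \<longrightarrow>
        test_function p X A g \<longrightarrow> (\<forall>x\<in>topspace X. [g x = (\<Sum>k\<in>K. r k * h k x)] (mod int p)) \<longrightarrow>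
        [L g = (\<Sum>k\<in>K. r k * L (h k))] (mod int p))"

lemma integrate_linear:
  assumes X: "compact_space X" and c: "c \<in> free_profinite_carrier p X A"
    and K: "finite K" "\<And>k. k \<in> K \<Longrightarrow> test_function p X A (h k)"
    and g: "test_function p X A g"
    and eq: "\<And>x. x \<in> topspace X \<Longrightarrow> [g x = (\<Sum>k\<in>K. r k * h k x)] (mod int p)"
  shows "[integrate p X g c = (\<Sum>k\<in>K. r k * integrate p X (h k) c)] (mod int p)"
proof -
  obtain P where P: "P \<in> clopen_partitions X"
    and const: "\<forall>k\<in>insert g (h ` K). constant_on_blocks P k"
    using ex_partition_for_functions[OF X, of "insert g (h ` K)" "\<lambda>k. k"] K g
    by (auto simp: test_function_def)
  have "[integrate p X g c = block_sum g c P] (mod int p)"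
    using integrate_cong_block_sum[OF X g c P] const by simp
  also have "[block_sum g c P = (\<Sum>B\<in>P. (\<Sum>k\<in>K. r k * h k (SOME x. x \<in> B)) * c P B)] (mod int p)"
    unfolding block_sum_def
  proof (intro cong_sum cong_scalar_right eq)
    fix B assume "B \<in> P"
    then have "(SOME x. x \<in> B) \<in> B" "B \<subseteq> topspace X"
      using point_of_block[OF P] P by (auto simp: clopen_partitions_def partition_on_def)
    then show "(SOME x. x \<in> B) \<in> topspace X" by blast
  qed
  also have "(\<Sum>B\<in>P. (\<Sum>k\<in>K. r k * h k (SOME x. x \<in> B)) * c P B) = (\<Sum>k\<in>K. r k * block_sum (h k) c P)"
    unfolding block_sum_def sum_distrib_left sum_distrib_right
    by (subst sum.swap) (simp add: mult.assoc)
  also have "[(\<Sum>k\<in>K. r k * block_sum (h k) c P) = (\<Sum>k\<in>K. r k * integrate p X (h k) c)] (mod int p)"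
    using const
    by (intro cong_sum cong_scalar_left cong_sym[OF integrate_cong_block_sum[OF X K(2) c P]]) auto
  finally show ?thesis .
qed

lemma integrate_range: "p > 0 \<Longrightarrow> 0 \<le> integrate p X h c \<and> integrate p X h c < int p"
  by (simp add: integrate_def)

lemma integrate_cong:
  assumes "compact_space X" "c \<in> free_profinite_carrier p X A"
    "test_function p X A h" "test_function p X A g"
    "\<And>x. x \<in> topspace X \<Longrightarrow> [g x = h x] (mod int p)"
  shows "integrate p X g c = integrate p X h c"
proof -
  have "[integrate p X g c = (\<Sum>k\<in>{()}. 1 * integrate p X h c)] (mod int p)"
    by (rule integrate_linear[OF assms(1,2)]) (use assms(3-5) in simp_all)
  then show ?thesis by (simp add: cong_def integrate_def)
qed

lemma constant_on_blocks_indicator: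
  assumes "P \<in> clopen_partitions X" "B \<in> P"
  shows "constant_on_blocks P (\<lambda>x. of_bool (x \<in> B))"
  unfolding constant_on_blocks_def
proof (intro ballI)
  fix C x y assume C: "C \<in> P" "x \<in> C" "y \<in> C"
  have d: "disjoint P" using assms by (simp add: clopen_partitions_def partition_on_def)
  have "x \<in> B \<longleftrightarrow> y \<in> B"
    using disjointD[OF d C(1) assms(2)] C(2,3) by auto
  then show "of_bool (x \<in> B) = (of_bool (y \<in> B) :: int)" by simp
qed

lemma test_function_indicator:
  assumes "P \<in> clopen_partitions X" "B \<in> P" "B \<inter> A = {}"
  shows "test_function p X A (\<lambda>x. of_bool (x \<in> B))"
  using assms(3) locally_constant_if_constant_on_blocks[OF assms(1) constant_on_blocks_indicator[OF assms(1,2)]]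
  by (auto simp: test_function_def)

lemma integrate_indicator:
  assumes X: "compact_space X" and c: "c \<in> free_profinite_carrier p X A" and p: "p > 0"
    and P: "P \<in> clopen_partitions X" "B \<in> P" "B \<inter> A = {}"
  shows "integrate p X (\<lambda>x. of_bool (x \<in> B)) c = c P B"
proof -
  have "[integrate p X (\<lambda>x. of_bool (x \<in> B)) c = block_sum (\<lambda>x. of_bool (x \<in> B)) c P] (mod int p)"
    by (rule integrate_cong_block_sum[OF X test_function_indicator[OF P] c P(1) constant_on_blocks_indicator[OF P(1,2)]])
  also have "block_sum (\<lambda>x. of_bool (x \<in> B)) c P = (\<Sum>C\<in>P. if C = B then c P B else 0)"
    unfolding block_sum_def
  proof (rule sum.cong)
    fix C assume C: "C \<in> P"
    have "disjoint P" using P by (simp add: clopen_partitions_def partition_on_def)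
    then have "C = B \<or> C \<inter> B = {}" using disjointD C P(2) by blast
    then have "(SOME x. x \<in> C) \<in> B \<longleftrightarrow> C = B"
      using point_of_block[OF P(1) C] by blast
    then show "of_bool ((SOME x. x \<in> C) \<in> B) * c P C = (if C = B then c P B else 0)" by simp
  qed simp
  also have "\<dots> = c P B"
    using P by (simp add: clopen_partitions_def)
  finally show ?thesis
    using free_profinite_carrier_coeff[OF c P(1,2)] integrate_range[OF p] by (metis cong_less_imp_eq_int)
qed

lemma free_profinite_carrier_ext:
  assumes "c \<in> free_profinite_carrier p X A" "d \<in> free_profinite_carrier p X A"
    "\<And>P B. P \<in> clopen_partitions X \<Longrightarrow> B \<in> P \<Longrightarrow> c P B = d P B"
  shows "c = d"
proof -
  have c: "c \<in> (\<Pi>\<^sub>E P\<in>clopen_partitions X. \<Pi>\<^sub>E B\<in>P. carrier (Fp p))"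
    and d: "d \<in> (\<Pi>\<^sub>E P\<in>clopen_partitions X. \<Pi>\<^sub>E B\<in>P. carrier (Fp p))"
    using assms by (auto simp: free_profinite_carrier_def)
  show ?thesis
    by (intro PiE_ext[OF c d] PiE_ext[OF PiE_mem[OF c] PiE_mem[OF d]]) (auto intro: assms(3))
qed

text \<open>Indicator functions of blocks recover the coefficients.\<close>

lemma integrate_separates:
  assumes X: "compact_space X" and p: "p > 0"
    and c: "c \<in> free_profinite_carrier p X A" and d: "d \<in> free_profinite_carrier p X A"
    and eq: "\<And>h. test_function p X A h \<Longrightarrow> integrate p X h c = integrate p X h d"
  shows "c = d"
proof (rule free_profinite_carrier_ext[OF c d])
  fix P B assume P: "P \<in> clopen_partitions X" "B \<in> P"
  show "c P B = d P B"
  proof (cases "B \<inter> A = {}")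
    case True
    then show ?thesis
      using integrate_indicator[OF X c p P True] integrate_indicator[OF X d p P True]
        eq[OF test_function_indicator[OF P True]] by simp
  next
    case False
    then show ?thesis
      using free_profinite_carrier_zero[OF c P] free_profinite_carrier_zero[OF d P] by simp
  qed
qed

text \<open>The inverse of the passage from measures to functionals on locally constant functions: the measure of a
  block is the value at its indicator function.\<close>

definition measure_of_functional ::
    "nat \<Rightarrow> 'a topology \<Rightarrow> 'a set \<Rightarrow> (('a \<Rightarrow> int) \<Rightarrow> int) \<Rightarrow> 'a set set \<Rightarrow> 'a set \<Rightarrow> int" where
  "measure_of_functional p X A L = (\<lambda>P\<in>clopen_partitions X. \<lambda>B\<in>P.
     if B \<inter> A = {} then L (\<lambda>x. of_bool (x \<in> B)) mod int p else 0)"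

text \<open>Compatibility of the coefficients is additivity of the functional, applied to the
  decomposition of the indicator function of a block along a finer partition.\<close>

lemma measure_of_functional_in_carrier:
  assumes p: "p > 0" and L: "linear_functional p X A L"
  shows "measure_of_functional p X A L \<in> free_profinite_carrier p X A"
proof -
  let ?m = "measure_of_functional p X A L"
  have compat: "?m Q B = (\<Sum>C\<in>{C\<in>P. C \<subseteq> B}. ?m P C) mod int p"
    if P: "P \<in> clopen_partitions X" and Q: "Q \<in> clopen_partitions X" and r: "refines (topspace X) P Q"
      and B: "B \<in> Q" "B \<inter> A = {}" for P Q B
  proof -
    have "[L (\<lambda>x. of_bool (x \<in> B)) = (\<Sum>C\<in>{C\<in>P. C \<subseteq> B}. 1 * L (\<lambda>x. of_bool (x \<in> C)))] (mod int p)"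
    proof (rule L[unfolded linear_functional_def, rule_format])
      show "finite {C\<in>P. C \<subseteq> B}" using P by (simp add: clopen_partitions_def)
      show "test_function p X A (\<lambda>x. of_bool (x \<in> B))" by (rule test_function_indicator[OF Q B])
      show "test_function p X A (\<lambda>x. of_bool (x \<in> C))" if "C \<in> {C\<in>P. C \<subseteq> B}" for C
        using that B by (intro test_function_indicator[OF P]) auto
      fix x assume x: "x \<in> topspace X"
      obtain C0 where C0: "C0 \<in> P" "x \<in> C0" "\<And>C. C \<in> P \<Longrightarrow> x \<in> C \<longleftrightarrow> C = C0"
        using ex_block_of_point[OF P x] by blast
      have "x \<in> B \<longleftrightarrow> C0 \<subseteq> B"
      proof
        assume "x \<in> B"
        obtain D where "D \<in> Q" "C0 \<subseteq> D" using r C0(1) by (auto simp: refines_def)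
        then show "C0 \<subseteq> B"
          using \<open>x \<in> B\<close> ex_block_of_point[OF Q x] B(1) C0(2) by (metis subsetD)
      qed (use C0 in blast)
      moreover have "(\<Sum>C\<in>{C\<in>P. C \<subseteq> B}. of_bool (x \<in> C)) = (\<Sum>C\<in>{C\<in>P. C \<subseteq> B}. if C = C0 then 1 else 0 :: int)"
        using C0(3) by (intro sum.cong) auto
      ultimately have "(\<Sum>C\<in>{C\<in>P. C \<subseteq> B}. of_bool (x \<in> C)) = (of_bool (x \<in> B) :: int)"
        using P C0(1) by (simp add: clopen_partitions_def)
      then show "[of_bool (x \<in> B) = (\<Sum>C\<in>{C\<in>P. C \<subseteq> B}. 1 * of_bool (x \<in> C))] (mod int p)"
        by simp
    qed
    then have "?m Q B = (\<Sum>C\<in>{C\<in>P. C \<subseteq> B}. L (\<lambda>x. of_bool (x \<in> C))) mod int p"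
      using Q B by (simp add: measure_of_functional_def cong_def)
    also have "\<dots> = (\<Sum>C\<in>{C\<in>P. C \<subseteq> B}. L (\<lambda>x. of_bool (x \<in> C)) mod int p) mod int p"
      by (simp add: mod_sum_eq)
    also have "(\<Sum>C\<in>{C\<in>P. C \<subseteq> B}. L (\<lambda>x. of_bool (x \<in> C)) mod int p) = (\<Sum>C\<in>{C\<in>P. C \<subseteq> B}. ?m P C)"
      using P B(2) by (intro sum.cong) (auto simp: measure_of_functional_def)
    finally show ?thesis .
  qed
  have PiE: "?m \<in> (\<Pi>\<^sub>E P\<in>clopen_partitions X. \<Pi>\<^sub>E B\<in>P. carrier (Fp p))"
    using p by (auto simp: measure_of_functional_def residue_ring_def)
  have zero: "?m P B = 0" if "P \<in> clopen_partitions X" "B \<in> P" "B \<inter> A \<noteq> {}" for P B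
    using that by (simp add: measure_of_functional_def)
  show ?thesis
    unfolding free_profinite_carrier_def
    by (intro CollectI conjI PiE ballI impI zero compat)
qed

text \<open>A test function is the linear combination of the indicator functions of its fibers. The fibers that
  meet \<open>A\<close> can be omitted, as the function vanishes modulo \<open>p\<close> on them.\<close>

lemma integrate_measure_of_functional:
  assumes X: "compact_space X" and p: "p > 0" and L: "linear_functional p X A L"
    and h: "test_function p X A h"
  shows "[integrate p X h (measure_of_functional p X A L) = L h] (mod int p)"
proof -
  let ?P = "fibers X h"
  have P: "?P \<in> clopen_partitions X"
    using X h by (intro fibers_in_clopen_partitions) (auto simp: test_function_def)
  let ?K = "{B\<in>?P. B \<inter> A = {}}" let ?r = "\<lambda>B. h (SOME x. x \<in> B)"
  have fin: "finite ?P" using P by (simp add: clopen_partitions_def)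
  have "[L h = (\<Sum>B\<in>?K. ?r B * L (\<lambda>x. of_bool (x \<in> B)))] (mod int p)"
  proof (rule L[unfolded linear_functional_def, rule_format, OF _ _ h])
    show "finite ?K" using fin by simp
    show "test_function p X A (\<lambda>x. of_bool (x \<in> B))" if "B \<in> ?K" for B
      using that by (intro test_function_indicator[OF P]) auto
    fix x assume x: "x \<in> topspace X"
    obtain B where B: "B \<in> ?P" "x \<in> B" "\<And>C. C \<in> ?P \<Longrightarrow> x \<in> C \<longleftrightarrow> C = B"
      using ex_block_of_point[OF P x] by blast
    have hB: "h y = h x" if "y \<in> B" for y
      using B that constant_on_blocks_fibers[of X h] unfolding constant_on_blocks_def by blast
    have "(\<Sum>C\<in>?K. ?r C * of_bool (x \<in> C)) = (\<Sum>C\<in>?K. if C = B then h x else 0)"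
    proof (rule sum.cong)
      fix C assume "C \<in> ?K"
      then show "?r C * of_bool (x \<in> C) = (if C = B then h x else 0)"
        using B(3) hB[OF point_of_block[OF P B(1)]] by auto
    qed simp
    also have "\<dots> = (if B \<inter> A = {} then h x else 0)"
      using fin B(1) by simp
    also have "[\<dots> = h x] (mod int p)"
    proof (cases "B \<inter> A = {}")
      case False
      then obtain a where "a \<in> A" "a \<in> B" by blast
      then have "int p dvd h x" using h hB by (metis test_function_def)
      then show ?thesis using False by (simp add: cong_def)
    qed simp
    finally show "[h x = (\<Sum>B\<in>?K. ?r B * of_bool (x \<in> B))] (mod int p)" by (rule cong_sym)
  qed
  also have "[(\<Sum>B\<in>?K. ?r B * L (\<lambda>x. of_bool (x \<in> B))) =
      (\<Sum>B\<in>?K. ?r B * measure_of_functional p X A L ?P B)] (mod int p)"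
    using P by (intro cong_sum cong_scalar_left) (auto simp: measure_of_functional_def cong_def)
  also have "(\<Sum>B\<in>?K. ?r B * measure_of_functional p X A L ?P B) = block_sum h (measure_of_functional p X A L) ?P"
    unfolding block_sum_def using P fin
    by (intro sum.mono_neutral_left) (auto simp: measure_of_functional_def)
  also have "[\<dots> = integrate p X h (measure_of_functional p X A L)] (mod int p)"
    by (simp add: integrate_def cong_def)
  finally show ?thesis by (rule cong_sym)
qed

section \<open>Continuous functionals on free profinite modules\<close>

lemma locally_constant_sum:
  "\<lbrakk>finite K; \<And>k. k \<in> K \<Longrightarrow> locally_constant X (f k)\<rbrakk> \<Longrightarrow> locally_constant X (\<lambda>x. \<Sum>k\<in>K. f k x)"
proof (induction K rule: finite_induct)
  case empty
  then show ?case by (simp add: locally_constant_const)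
next
  case (insert k K)
  then have "locally_constant X (\<lambda>x. f k x + (\<Sum>k\<in>K. f k x))"
    by (intro locally_constant_comp2[where F = "(+)"]) auto
  then show ?case using insert.hyps by simp
qed

lemma locally_constant_comp1: "locally_constant X f \<Longrightarrow> locally_constant X (\<lambda>x. F (f x))"
  using locally_constant_comp2[of X f f "\<lambda>a b. F a"] .

lemma locally_constant_cmult: "locally_constant X f \<Longrightarrow> locally_constant X (\<lambda>x. a * f x)"
  by (rule locally_constant_comp1)

lemma closedin_locally_constant_fiber:
  assumes "locally_constant X h"
  shows "closedin X {x \<in> topspace X. h x \<in> K}"
proof -
  have "topspace X - {x \<in> topspace X. h x \<in> K} = {x \<in> topspace X. h x \<in> - K}" by auto
  then show ?thesis
    using openin_locally_constant_fiber[OF assms, of "- K"] by (simp add: closedin_def)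
qed

lemma closedin_Collect_ball:
  assumes "\<And>k. k \<in> K \<Longrightarrow> closedin X {x \<in> topspace X. Q k x}"
  shows "closedin X {x \<in> topspace X. \<forall>k\<in>K. Q k x}"
proof -
  have "{x \<in> topspace X. \<forall>k\<in>K. Q k x} = \<Inter>(insert (topspace X) ((\<lambda>k. {x \<in> topspace X. Q k x}) ` K))"
    by auto
  moreover have "closedin X \<dots>"
    using assms by (intro closedin_Inter) auto
  ultimately show ?thesis by simp
qed

lemma closedin_Collect_imp:
  assumes "a \<Longrightarrow> closedin X {x \<in> topspace X. Q x}"
  shows "closedin X {x \<in> topspace X. a \<longrightarrow> Q x}"
  using assms by (cases a) simp_all

lemma closedin_Collect_conj:
  assumes "closedin X {x \<in> topspace X. Q x}" "closedin X {x \<in> topspace X. R x}"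
  shows "closedin X {x \<in> topspace X. Q x \<and> R x}"
proof -
  have "{x \<in> topspace X. Q x \<and> R x} = {x \<in> topspace X. Q x} \<inter> {x \<in> topspace X. R x}" by auto
  then show ?thesis using closedin_Int[OF assms] by simp
qed

lemma continuous_map_discrete_iff:
  "continuous_map X (discrete_topology S) f \<longleftrightarrow> locally_constant X f \<and> f \<in> topspace X \<rightarrow> S"
  using continuous_map_in_subtopology[of X "discrete_topology UNIV" S f]
  by (auto simp: locally_constant_def image_subset_iff_funcset)

abbreviation coeff_space :: "nat \<Rightarrow> 'a topology \<Rightarrow> ('a set set \<Rightarrow> 'a set \<Rightarrow> int) topology" where
  "coeff_space p X \<equiv>
     product_topology (\<lambda>P. product_topology (\<lambda>B. discrete_topology (carrier (Fp p))) P) (clopen_partitions X)"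

lemma topspace_coeff_space:
  "topspace (coeff_space p X) = (\<Pi>\<^sub>E P\<in>clopen_partitions X. \<Pi>\<^sub>E B\<in>P. carrier (Fp p))"
  by simp

lemma locally_constant_coeff:
  assumes "P \<in> clopen_partitions X" "B \<in> P"
  shows "locally_constant (coeff_space p X) (\<lambda>c. c P B)"
proof -
  have "continuous_map (coeff_space p X) (discrete_topology (carrier (Fp p))) ((\<lambda>d. d B) \<circ> (\<lambda>c. c P))"
    using continuous_map_product_projection[OF assms(1), of "\<lambda>P. product_topology (\<lambda>B. discrete_topology (carrier (Fp p))) P"]
      continuous_map_product_projection[OF assms(2), of "\<lambda>B. discrete_topology (carrier (Fp p))"]
    by (rule continuous_map_compose)
  then show ?thesis by (simp add: continuous_map_discrete_iff o_def)
qed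

lemma compact_space_coeff_space: "compact_space (coeff_space p X)"
proof -
  have "finite (carrier (Fp p))" by (simp add: residue_ring_def)
  then show ?thesis
    by (simp add: compact_space_product_topology compact_space_discrete_topology)
qed

text \<open>Each defining condition of the inverse limit involves finitely many coefficients, and these depend
  continuously on the family. So the module is a closed subspace of a product of finite spaces, hence compact.\<close>

lemma closedin_free_profinite_carrier:
  "closedin (coeff_space p X) (free_profinite_carrier p X A)"
proof -
  let ?Y = "coeff_space p X" and ?cp = "clopen_partitions X"
  have zero: "closedin ?Y {c \<in> topspace ?Y. c P B = 0}" if "P \<in> ?cp" "B \<in> P" for P B
    using closedin_locally_constant_fiber[OF locally_constant_coeff[OF that], of p "{0}"] by simp
  have compat: "closedin ?Y {c \<in> topspace ?Y. c Q B = (\<Sum>C\<in>{C\<in>P. C \<subseteq> B}. c P C) mod int p}"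
    if P: "P \<in> ?cp" and Q: "Q \<in> ?cp" "B \<in> Q" for P Q B
  proof -
    have "locally_constant ?Y (\<lambda>c. \<Sum>C\<in>{C\<in>P. C \<subseteq> B}. c P C)"
      using P by (intro locally_constant_sum locally_constant_coeff) (auto simp: clopen_partitions_def)
    then have "locally_constant ?Y (\<lambda>c. c Q B - (\<Sum>C\<in>{C\<in>P. C \<subseteq> B}. c P C) mod int p)"
      using locally_constant_comp2[OF locally_constant_coeff[OF Q], of p _ "\<lambda>a b. a - b mod int p"] by simp
    from closedin_locally_constant_fiber[OF this, of "{0}"] show ?thesis by simp
  qed
  show ?thesis
    unfolding free_profinite_carrier_def topspace_coeff_space[symmetric]
    by (intro closedin_Collect_conj closedin_Collect_ball closedin_Collect_imp zero compat)
qed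

lemma mtop_free_profinite_module:
  "mtop (free_profinite_module p X A) = subtopology (coeff_space p X) (free_profinite_carrier p X A)"
  by (simp add: free_profinite_module_def)

lemma topspace_free_profinite_module:
  "topspace (mtop (free_profinite_module p X A)) = free_profinite_carrier p X A"
  using closedin_subset[OF closedin_free_profinite_carrier[of p X A]]
  by (simp only: mtop_free_profinite_module topspace_subtopology) blast

lemma compact_space_free_profinite_module: "compact_space (mtop (free_profinite_module p X A))"
  unfolding mtop_free_profinite_module
  by (intro compact_space_subtopology closedin_compact_space compact_space_coeff_space
      closedin_free_profinite_carrier)

lemma locally_constant_module_coeff:
  assumes "P \<in> clopen_partitions X" "B \<in> P"
  shows "locally_constant (mtop (free_profinite_module p X A)) (\<lambda>c. c P B)"
  using locally_constant_coeff[OF assms]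
  unfolding mtop_free_profinite_module locally_constant_def by (rule continuous_map_from_subtopology)

lemma carrier_Fp_module [simp]: "carrier (Fp_module p) = {0..<int p}"
  by (auto simp: Fp_module_def residue_ring_def)

lemma add_free_profinite_module:
  assumes "P \<in> clopen_partitions X" "B \<in> P"
  shows "(c \<oplus>\<^bsub>free_profinite_module p X A\<^esub> d) P B = (c P B + d P B) mod int p"
  using assms by (simp add: free_profinite_module_def residue_ring_def)

lemma smult_free_profinite_module:
  assumes "P \<in> clopen_partitions X" "B \<in> P"
  shows "(r \<odot>\<^bsub>free_profinite_module p X A\<^esub> c) P B = (r * c P B) mod int p"
  using assms by (simp add: free_profinite_module_def residue_ring_def)

lemma block_sum_add:
  assumes "P \<in> clopen_partitions X"
  shows "[block_sum h (c \<oplus>\<^bsub>free_profinite_module p X A\<^esub> d) P = block_sum h c P + block_sum h d P] (mod int p)"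
  unfolding block_sum_def sum.distrib[symmetric] distrib_left[symmetric]
  by (intro cong_sum cong_scalar_left) (simp add: add_free_profinite_module[OF assms] cong_def)

lemma block_sum_smult:
  assumes "P \<in> clopen_partitions X"
  shows "[block_sum h (r \<odot>\<^bsub>free_profinite_module p X A\<^esub> c) P = r * block_sum h c P] (mod int p)"
proof -
  have "[block_sum h (r \<odot>\<^bsub>free_profinite_module p X A\<^esub> c) P =
      (\<Sum>B\<in>P. h (SOME x. x \<in> B) * (r * c P B))] (mod int p)"
    unfolding block_sum_def
    by (intro cong_sum cong_scalar_left) (simp add: smult_free_profinite_module[OF assms] cong_def)
  also have "(\<Sum>B\<in>P. h (SOME x. x \<in> B) * (r * c P B)) = r * block_sum h c P"
    by (simp add: block_sum_def sum_distrib_left mult.left_commute)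
  finally show ?thesis .
qed

text \<open>Only the finitely many coefficients at the fibers of \<open>h\<close> enter the integral.\<close>

lemma continuous_module_hom_integrate:
  assumes "compact_space X" "locally_constant X h" "p > 0"
  shows "continuous_module_hom (Fp p) (free_profinite_module p X A) (Fp_module p) (integrate p X h)"
proof -
  let ?M = "free_profinite_module p X A" and ?P = "fibers X h"
  have P: "?P \<in> clopen_partitions X" by (rule fibers_in_clopen_partitions[OF assms(1,2)])
  then have "locally_constant (mtop ?M) (\<lambda>c. block_sum h c ?P)"
    unfolding block_sum_def
    by (intro locally_constant_sum locally_constant_cmult locally_constant_module_coeff)
      (auto simp: clopen_partitions_def)
  then have "locally_constant (mtop ?M) (integrate p X h)"
    unfolding integrate_def[abs_def] by (rule locally_constant_comp1)
  moreover have "mtop (Fp_module p) = discrete_topology {0..<int p}"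
    using carrier_Fp_module[of p] by (simp add: Fp_module_def)
  moreover have range: "integrate p X h \<in> S \<rightarrow> {0..<int p}" for S
    using integrate_range[OF assms(3), of X h] by simp
  ultimately have "continuous_map (mtop ?M) (mtop (Fp_module p)) (integrate p X h)"
    by (simp add: continuous_map_discrete_iff)
  moreover have "integrate p X h (c \<oplus>\<^bsub>?M\<^esub> d) = integrate p X h c \<oplus>\<^bsub>Fp_module p\<^esub> integrate p X h d" for c d
    using block_sum_add[OF P, where h = h and c = c and d = d and p = p and A = A]
    by (simp add: integrate_def Fp_module_def residue_ring_def cong_def mod_add_eq)
  moreover have "integrate p X h (r \<odot>\<^bsub>?M\<^esub> c) = r \<odot>\<^bsub>Fp_module p\<^esub> integrate p X h c" for r c
    using block_sum_smult[OF P, where h = h and c = c and r = r and p = p and A = A]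
    by (simp add: integrate_def Fp_module_def residue_ring_def cong_def mod_mult_right_eq)
  ultimately show ?thesis
    using range by (simp add: continuous_module_hom_def)
qed

lemma continuous_module_hom_compose:
  assumes "continuous_module_hom R M N f" "continuous_module_hom R N K g"
  shows "continuous_module_hom R M K (\<lambda>x. g (f x))"
  using assms continuous_map_compose[of "mtop M" "mtop N" f "mtop K" g]
  unfolding continuous_module_hom_def o_def by (auto simp: Pi_iff)

lemma continuous_module_hom_id: "continuous_module_hom R M M (\<lambda>x. x)"
  by (auto simp: continuous_module_hom_def)

lemma integrate_gen:
  assumes X: "compact_space X" and p: "p > 1" and h: "test_function p X A h" and x: "x \<in> topspace X"
  shows "[integrate p X h (free_profinite_gen X A x) = h x] (mod int p)"
proof -
  let ?P = "fibers X h"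
  have P: "?P \<in> clopen_partitions X"
    using X h by (intro fibers_in_clopen_partitions) (auto simp: test_function_def)
  obtain B where B: "B \<in> ?P" "x \<in> B" "\<And>C. C \<in> ?P \<Longrightarrow> x \<in> C \<longleftrightarrow> C = B"
    using ex_block_of_point[OF P x] by blast
  have hB: "h (SOME y. y \<in> B) = h x"
    using constant_on_blocks_fibers[of X h] point_of_block[OF P B(1)] B(1,2)
    unfolding constant_on_blocks_def by blast
  have "block_sum h (free_profinite_gen X A x) ?P = (\<Sum>C\<in>?P. if C = B then (if B \<inter> A = {} then h x else 0) else 0)"
    unfolding block_sum_def
  proof (rule sum.cong)
    fix C assume C: "C \<in> ?P"
    show "h (SOME y. y \<in> C) * free_profinite_gen X A x ?P C = (if C = B then (if B \<inter> A = {} then h x else 0) else 0)"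
      using B(3)[OF C] hB P C by (auto simp: free_profinite_gen_def)
  qed simp
  also have "\<dots> = (if B \<inter> A = {} then h x else 0)"
    using P B(1) by (simp add: clopen_partitions_def)
  also have "[\<dots> = h x] (mod int p)"
  proof (cases "B \<inter> A = {}")
    case False
    then obtain a where a: "a \<in> A" "a \<in> B" by blast
    then have "h a = h x"
      using constant_on_blocks_fibers[of X h] B(1,2) unfolding constant_on_blocks_def by blast
    then have "int p dvd h x" using h a(1) by (metis test_function_def)
    then show ?thesis using False by (simp add: cong_def)
  qed simp
  finally show ?thesis by (simp add: integrate_def)
qed

text \<open>Linear algebra over the field with \<open>p\<close> elements: a functional \<open>t\<close> on a subspace of a finite-dimensional
  coordinate space extends to the whole space. The subspace is given through a family \<open>C\<close> with
  coordinates \<open>w\<close>, closed under linear combinations up to congruence, so that neither the vectors nor the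
  scalars have to be reduced modulo \<open>p\<close>. The induction adds one coordinate at a time, as in the
  Hahn-Banach theorem.\<close>

lemma extend_functional_mod_prime:
  fixes w :: "'c \<Rightarrow> 'i \<Rightarrow> int" and t :: "'c \<Rightarrow> int"
  assumes p: "prime p" and I: "finite I"
    and closed: "\<And>c d r. c \<in> C \<Longrightarrow> d \<in> C \<Longrightarrow>
      \<exists>e\<in>C. (\<forall>i\<in>I. [w e i = w c i + r * w d i] (mod int p)) \<and> [t e = t c + r * t d] (mod int p)"
    and ker: "\<And>c. c \<in> C \<Longrightarrow> (\<forall>i\<in>I. int p dvd w c i) \<Longrightarrow> int p dvd t c"
  shows "\<exists>u. \<forall>c\<in>C. [t c = (\<Sum>i\<in>I. u i * w c i)] (mod int p)"
  using I closed ker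
proof (induction I arbitrary: C rule: finite_induct)
  case empty
  then show ?case by (auto simp: cong_0_iff)
next
  case (insert j J)
  define C0 where "C0 = {c\<in>C. int p dvd w c j}"
  have "\<exists>u. \<forall>c\<in>C0. [t c = (\<Sum>i\<in>J. u i * w c i)] (mod int p)"
  proof (rule insert.IH)
    fix c d r assume c: "c \<in> C0" "d \<in> C0"
    then obtain e where e: "e \<in> C" "\<forall>i\<in>insert j J. [w e i = w c i + r * w d i] (mod int p)"
      "[t e = t c + r * t d] (mod int p)"
      using insert.prems(1)[of c d r] by (auto simp: C0_def)
    have "int p dvd w c j + r * w d j" using c by (simp add: C0_def)
    then have "e \<in> C0" using e cong_dvd_iff[of "w e j" "w c j + r * w d j" "int p"] by (simp add: C0_def)
    then show "\<exists>e\<in>C0. (\<forall>i\<in>J. [w e i = w c i + r * w d i] (mod int p)) \<and> [t e = t c + r * t d] (mod int p)"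
      using e by blast
  next
    fix c assume "c \<in> C0" "\<forall>i\<in>J. int p dvd w c i"
    then show "int p dvd t c" using insert.prems(2)[of c] by (auto simp: C0_def)
  qed
  then obtain u where u: "\<And>c. c \<in> C0 \<Longrightarrow> [t c = (\<Sum>i\<in>J. u i * w c i)] (mod int p)"
    by blast
  show ?case
  proof (cases "C0 = C")
    case True
    have "[t c = (\<Sum>i\<in>insert j J. (u(j := 0)) i * w c i)] (mod int p)" if c: "c \<in> C" for c
    proof -
      have "(\<Sum>i\<in>insert j J. (u(j := 0)) i * w c i) = (\<Sum>i\<in>J. (u(j := 0)) i * w c i)"
        using insert.hyps by simp
      also have "\<dots> = (\<Sum>i\<in>J. u i * w c i)"
        using insert.hyps by (intro sum.cong) auto
      finally show ?thesis using u c True by simp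
    qed
    then show ?thesis by blast
  next
    case False
    then obtain d where d: "d \<in> C" "\<not> int p dvd w d j" by (auto simp: C0_def)
    have "prime (int p)" using p by simp
    then have "coprime (w d j) (int p)"
      using prime_imp_coprime[of "int p" "w d j"] d(2) by (simp add: coprime_commute)
    then obtain s where s: "[w d j * s = 1] (mod int p)"
      using cong_solve_coprime_int by blast
    define S where "S c = (\<Sum>i\<in>J. u i * w c i)" for c
    \<comment> \<open>the coefficient at \<open>j\<close> is determined by the value at \<open>d\<close>\<close>
    define uj where "uj = s * (t d - S d)"
    have "[t c = (\<Sum>i\<in>insert j J. (u(j := uj)) i * w c i)] (mod int p)" if c: "c \<in> C" for c
    proof -
      \<comment> \<open>subtracting a multiple of \<open>d\<close> kills the coordinate \<open>j\<close> of \<open>c\<close>\<close>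
      define r where "r = - s * w c j"
      obtain e where e: "e \<in> C" "\<And>i. i \<in> insert j J \<Longrightarrow> [w e i = w c i + r * w d i] (mod int p)"
        "[t e = t c + r * t d] (mod int p)"
        using insert.prems(1)[OF c d(1), of r] by blast
      have "[w c j + r * w d j = w c j - w c j * (w d j * s)] (mod int p)"
        by (simp add: r_def algebra_simps)
      also have "[w c j - w c j * (w d j * s) = w c j - w c j * 1] (mod int p)"
        by (intro cong_diff cong_scalar_left s) simp
      finally have "[w e j = 0] (mod int p)"
        using e(2)[of j] by (auto intro: cong_trans)
      then have "e \<in> C0" using e(1) by (simp add: C0_def cong_0_iff)
      then have "[t e = S e] (mod int p)" unfolding S_def by (rule u)
      also have "[S e = (\<Sum>i\<in>J. u i * (w c i + r * w d i))] (mod int p)"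
        unfolding S_def using e(2) by (intro cong_sum cong_scalar_left) auto
      also have "(\<Sum>i\<in>J. u i * (w c i + r * w d i)) = S c + r * S d"
        by (simp add: S_def sum.distrib sum_distrib_left algebra_simps)
      finally have "[t c + r * t d = S c + r * S d] (mod int p)"
        using e(3) by (meson cong_sym cong_trans)
      then have "[(t c + r * t d) - r * t d = (S c + r * S d) - r * t d] (mod int p)"
        by (rule cong_diff) simp
      also have "(S c + r * S d) - r * t d = uj * w c j + S c"
        by (simp add: r_def uj_def algebra_simps)
      also have "uj * w c j + S c = (\<Sum>i\<in>insert j J. (u(j := uj)) i * w c i)"
      proof -
        have "S c = (\<Sum>i\<in>J. (u(j := uj)) i * w c i)"
          unfolding S_def using insert.hyps by (intro sum.cong) auto
        then show ?thesis using insert.hyps by simp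
      qed
      finally show ?thesis by simp
    qed
    then show ?thesis by blast
  qed
qed

lemma residues_eq_if_cong: "\<lbrakk>a \<in> {0..<int p}; b \<in> {0..<int p}; [a = b] (mod int p)\<rbrakk> \<Longrightarrow> a = b"
  by (simp add: cong_def)

text \<open>Compactness reduces the infinitely many coordinates of \<open>\<psi> c\<close> to those at one partition: the sets
  \<open>K P\<close> of counterexamples are closed and decrease along refinement, and their intersection
  consists of \<open>c\<close> with \<open>\<psi> c = 0\<close> and \<open>\<phi> c \<noteq> 0\<close>, which contradicts injectivity.\<close>

lemma ex_partition_detecting_functional:
  assumes X: "compact_space X" and p: "p > 0"
    and \<psi>: "continuous_module_hom (Fp p) (free_profinite_module p Y A) (free_profinite_module p X B) \<psi>"
    and inj: "inj_on \<psi> (free_profinite_carrier p Y A)"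
    and \<phi>: "continuous_module_hom (Fp p) (free_profinite_module p Y A) (Fp_module p) \<phi>"
  shows "\<exists>P\<in>clopen_partitions X. \<forall>c\<in>free_profinite_carrier p Y A. (\<forall>C\<in>P. \<psi> c P C = 0) \<longrightarrow> \<phi> c = 0"
proof (rule ccontr)
  let ?M = "free_profinite_module p Y A" and ?N = "free_profinite_module p X B"
  let ?cp = "clopen_partitions X" and ?car = "free_profinite_carrier p Y A"
  assume contra: "\<not> ?thesis"
  define K where "K P = {c \<in> ?car. \<phi> c \<noteq> 0 \<and> (\<forall>C\<in>P. \<psi> c P C = 0)}" for P
  have \<psi>_car: "\<psi> c \<in> free_profinite_carrier p X B" if "c \<in> ?car" for c
    using \<psi> that by (auto simp: continuous_module_hom_def)
  have \<psi>_cont: "continuous_map (mtop ?M) (mtop ?N) \<psi>"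
    using \<psi> by (simp add: continuous_module_hom_def)
  have "continuous_map (mtop ?M) (discrete_topology (carrier (Fp p))) \<phi>"
    using \<phi> by (simp add: continuous_module_hom_def Fp_module_def)
  then have \<phi>_lc: "locally_constant (mtop ?M) \<phi>"
    by (simp add: continuous_map_discrete_iff)
  have closed: "closedin (mtop ?M) (K P)" if P: "P \<in> ?cp" for P
  proof -
    have lc: "locally_constant (mtop ?M) (\<lambda>c. \<psi> c P C)" if "C \<in> P" for C
      using locally_constant_comp[OF \<psi>_cont locally_constant_module_coeff[OF P that]] .
    have "K P = {c \<in> topspace (mtop ?M). \<phi> c \<in> -{0}} \<inter> {c \<in> topspace (mtop ?M). \<forall>C\<in>P. \<psi> c P C \<in> {0}}"
      unfolding K_def topspace_free_profinite_module by auto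
    moreover have "closedin (mtop ?M) \<dots>"
      by (intro closedin_Int closedin_Collect_ball closedin_locally_constant_fiber lc \<phi>_lc)
    ultimately show ?thesis by simp
  qed
  have fip: "\<Inter>F \<noteq> {}" if F: "finite F" "F \<subseteq> K ` ?cp" for F
  proof -
    obtain \<P> where \<P>: "finite \<P>" "\<P> \<subseteq> ?cp" "F = K ` \<P>"
      using finite_subset_image[OF F] by blast
    obtain P where P: "P \<in> ?cp" "\<And>Q. Q \<in> \<P> \<Longrightarrow> refines (topspace X) P Q"
      using ex_common_refinement[OF X \<P>(1,2)] by blast
    obtain c where c: "c \<in> ?car" "\<phi> c \<noteq> 0" "\<And>C. C \<in> P \<Longrightarrow> \<psi> c P C = 0"
      using contra P(1) by blast
    have "\<psi> c Q D = 0" if Q: "Q \<in> \<P>" and D: "D \<in> Q" for Q D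
    proof (cases "D \<inter> B = {}")
      case True
      have "\<psi> c Q D = (\<Sum>C\<in>{C\<in>P. C \<subseteq> D}. \<psi> c P C) mod int p"
        using Q \<P>(2) by (intro free_profinite_carrier_refines[OF \<psi>_car[OF c(1)] P(1) _ P(2)[OF Q] D True]) auto
      then show ?thesis using c(3) by simp
    next
      case False
      then show ?thesis
        using free_profinite_carrier_zero[OF \<psi>_car[OF c(1)] _ D] Q \<P>(2) by auto
    qed
    then have "c \<in> \<Inter>F" using c(1,2) \<P>(3) by (auto simp: K_def)
    then show ?thesis by blast
  qed
  have "\<Inter>(K ` ?cp) \<noteq> {}"
    using compact_space_free_profinite_module[of p Y A] closed fip unfolding compact_space_fip
    by (metis (no_types, lifting) imageE)
  then obtain c where c: "\<And>P. P \<in> ?cp \<Longrightarrow> c \<in> K P" by blast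
  obtain P0 where "P0 \<in> ?cp" using ex_common_refinement[OF X, of "{}"] by blast
  then have c0: "c \<in> ?car" "\<phi> c \<noteq> 0" using c by (auto simp: K_def)
  \<comment> \<open>the zero vector, in a form to which homomorphisms apply directly\<close>
  let ?z = "0 \<odot>\<^bsub>?M\<^esub> c"
  have p0: "0 \<in> carrier (Fp p)" using p by (simp add: residue_ring_def)
  have z: "?z \<in> ?car"
    using linear_combination_in_free_profinite_carrier[OF p, where K = "{} :: nat set" and f = "\<lambda>_ _. 0"]
    by (simp add: free_profinite_module_def residue_ring_def)
  have "\<psi> ?z = 0 \<odot>\<^bsub>?N\<^esub> \<psi> c"
    using \<psi> c0(1) p0 by (simp add: continuous_module_hom_def)
  moreover have "0 \<odot>\<^bsub>?N\<^esub> \<psi> c = \<psi> c"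
  proof (rule free_profinite_carrier_ext[of _ p X B])
    show "0 \<odot>\<^bsub>?N\<^esub> \<psi> c \<in> free_profinite_carrier p X B" using calculation \<psi>_car[OF z] by simp
    show "\<psi> c \<in> free_profinite_carrier p X B" by (rule \<psi>_car[OF c0(1)])
    fix P C assume P: "P \<in> ?cp" "C \<in> P"
    then show "(0 \<odot>\<^bsub>?N\<^esub> \<psi> c) P C = \<psi> c P C"
      using c[OF P(1)] by (simp add: smult_free_profinite_module[OF P] K_def)
  qed
  ultimately have "?z = c" using inj z c0(1) by (simp add: inj_on_def)
  moreover have "\<phi> ?z = 0"
    using \<phi> c0(1) p0 by (simp add: continuous_module_hom_def Fp_module_def residue_ring_def)
  ultimately show False using c0(2) by simp
qed

text \<open>The dual of an injective continuous homomorphism is surjective. After the reduction to one partition \<open>P\<close>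
  this is extension of a functional in finite dimension, and the extension is integration of
  the step function with values \<open>u\<close>.\<close>

lemma functional_factors_through_injection:
  assumes X: "compact_space X" and p: "prime p"
    and \<psi>: "continuous_module_hom (Fp p) (free_profinite_module p Y A) (free_profinite_module p X B) \<psi>"
    and inj: "inj_on \<psi> (free_profinite_carrier p Y A)"
    and \<phi>: "continuous_module_hom (Fp p) (free_profinite_module p Y A) (Fp_module p) \<phi>"
  shows "\<exists>h. test_function p X B h \<and> (\<forall>c\<in>free_profinite_carrier p Y A. \<phi> c = integrate p X h (\<psi> c))"
proof -
  let ?M = "free_profinite_module p Y A" and ?N = "free_profinite_module p X B"
  let ?cp = "clopen_partitions X" and ?car = "free_profinite_carrier p Y A"
  have p1: "p > 1" using p by (rule prime_gt_1_nat)
  then have p0: "p > 0" by simp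
  interpret M: module "Fp p" ?M by (rule module_free_profinite_module[OF p1])
  obtain P where P: "P \<in> ?cp"
    and det: "\<And>c. c \<in> ?car \<Longrightarrow> \<forall>C\<in>P. \<psi> c P C = 0 \<Longrightarrow> \<phi> c = 0"
    using ex_partition_detecting_functional[OF X p0 \<psi> inj \<phi>] by blast
  have \<psi>_car: "\<psi> c \<in> free_profinite_carrier p X B" if "c \<in> ?car" for c
    using \<psi> that by (auto simp: continuous_module_hom_def)
  have \<phi>_range: "\<phi> c \<in> {0..<int p}" if "c \<in> ?car" for c
    using \<phi> that by (auto simp: continuous_module_hom_def Pi_iff)
  have "\<exists>u. \<forall>c\<in>?car. [\<phi> c = (\<Sum>C\<in>P. u C * \<psi> c P C)] (mod int p)"
  proof (rule extend_functional_mod_prime[OF p])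
    show "finite P" using P by (simp add: clopen_partitions_def)
    fix c d r assume c: "c \<in> ?car" and d: "d \<in> ?car"
    let ?r = "r mod int p"
    let ?e = "c \<oplus>\<^bsub>?M\<^esub> (?r \<odot>\<^bsub>?M\<^esub> d)"
    have r: "?r \<in> carrier (Fp p)" using p0 by (simp add: residue_ring_def)
    have rd: "?r \<odot>\<^bsub>?M\<^esub> d \<in> ?car" using M.smult_closed[OF r] d by simp
    have e: "?e \<in> ?car" using M.a_closed[of c "?r \<odot>\<^bsub>?M\<^esub> d"] c rd by simp
    have "\<psi> ?e = \<psi> c \<oplus>\<^bsub>?N\<^esub> (?r \<odot>\<^bsub>?N\<^esub> \<psi> d)"
      using \<psi> c d rd r by (simp add: continuous_module_hom_def)
    then have "[\<psi> ?e P C = \<psi> c P C + r * \<psi> d P C] (mod int p)" if "C \<in> P" for C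
      using add_free_profinite_module[OF P that] smult_free_profinite_module[OF P that]
      by (simp add: cong_def mod_simps)
    moreover have "\<phi> ?e = \<phi> c \<oplus>\<^bsub>Fp_module p\<^esub> (?r \<odot>\<^bsub>Fp_module p\<^esub> \<phi> d)"
      using \<phi> c d rd r by (simp add: continuous_module_hom_def)
    then have "[\<phi> ?e = \<phi> c + r * \<phi> d] (mod int p)"
      by (simp add: Fp_module_def residue_ring_def cong_def mod_simps)
    ultimately show "\<exists>e\<in>?car. (\<forall>C\<in>P. [\<psi> e P C = \<psi> c P C + r * \<psi> d P C] (mod int p)) \<and>
        [\<phi> e = \<phi> c + r * \<phi> d] (mod int p)"
      using e by blast
  next
    fix c assume c: "c \<in> ?car" and dvd: "\<forall>C\<in>P. int p dvd \<psi> c P C"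
    have "\<psi> c P C = 0" if "C \<in> P" for C
      using dvd that free_profinite_carrier_coeff[OF \<psi>_car[OF c] P that]
      by (meson dvd_imp_le_int not_less zdvd_not_zless order_le_less)
    then show "int p dvd \<phi> c" using det[OF c] by simp
  qed
  then obtain u where u: "\<And>c. c \<in> ?car \<Longrightarrow> [\<phi> c = (\<Sum>C\<in>P. u C * \<psi> c P C)] (mod int p)"
    by blast
  define h where "h x = (\<Sum>C\<in>P. if x \<in> C \<and> C \<inter> B = {} then u C else 0)" for x
  have h_eq: "h x = (if C \<inter> B = {} then u C else 0)" if C: "C \<in> P" "x \<in> C" for x C
  proof -
    have x: "x \<in> topspace X" using block_subset[OF P] C by blast
    obtain C' where C': "C' \<in> P" "x \<in> C'" "\<And>D. D \<in> P \<Longrightarrow> x \<in> D \<longleftrightarrow> D = C'"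
      using ex_block_of_point[OF P x] by blast
    have "C' = C" using C'(3)[OF C(1)] C(2) by simp
    then have "h x = (\<Sum>D\<in>P. if D = C then (if C \<inter> B = {} then u C else 0) else 0)"
      unfolding h_def using C'(3) by (intro sum.cong) auto
    then show ?thesis using P C by (simp add: clopen_partitions_def)
  qed
  have const: "constant_on_blocks P h"
    unfolding constant_on_blocks_def by (intro ballI) (simp only: h_eq)
  have zero: "h b = 0" if "b \<in> B" for b
    unfolding h_def using that by (intro sum.neutral) auto
  have test: "test_function p X B h"
    using locally_constant_if_constant_on_blocks[OF P const] zero by (simp add: test_function_def)
  have "\<phi> c = integrate p X h (\<psi> c)" if c: "c \<in> ?car" for c
  proof -
    have "(\<Sum>C\<in>P. u C * \<psi> c P C) = block_sum h (\<psi> c) P"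
      unfolding block_sum_def
    proof (rule sum.cong)
      fix C assume C: "C \<in> P"
      show "u C * \<psi> c P C = h (SOME x. x \<in> C) * \<psi> c P C"
        using h_eq[OF C point_of_block[OF P C]] free_profinite_carrier_zero[OF \<psi>_car[OF c] P C] by auto
    qed simp
    then have "[\<phi> c = integrate p X h (\<psi> c)] (mod int p)"
      using u[OF c] integrate_cong_block_sum[OF X test \<psi>_car[OF c] P const]
      by (metis cong_sym cong_trans)
    then show ?thesis
      using \<phi>_range[OF c] integrate_range[OF p0, of X h "\<psi> c"] by (intro residues_eq_if_cong) auto
  qed
  then show ?thesis using test by blast
qed

text \<open>A density statement for the span of the generators. The previous lemma for the identity map shows that
  \<open>\<phi>\<close> is integration of a function, and its values are those of \<open>\<phi>\<close> at the generators.\<close>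

lemma functional_zero_if_zero_on_generators:
  assumes X: "compact_space X" and p: "prime p"
    and \<phi>: "continuous_module_hom (Fp p) (free_profinite_module p X A) (Fp_module p) \<phi>"
    and gen: "\<And>x. x \<in> topspace X - A \<Longrightarrow> \<phi> (free_profinite_gen X A x) = 0"
    and c: "c \<in> free_profinite_carrier p X A"
  shows "\<phi> c = 0"
proof -
  have p1: "p > 1" using p by (rule prime_gt_1_nat)
  obtain h where h: "test_function p X A h" "\<And>c. c \<in> free_profinite_carrier p X A \<Longrightarrow> \<phi> c = integrate p X h c"
    using functional_factors_through_injection[OF X p continuous_module_hom_id _ \<phi>] by auto
  have "[h x = 0] (mod int p)" if x: "x \<in> topspace X" for x
  proof (cases "x \<in> A")
    case True
    then show ?thesis using h(1) by (simp add: test_function_def cong_0_iff)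
  next
    case False
    have "free_profinite_gen X A x \<in> free_profinite_carrier p X A"
      using free_profinite_gen_in_carrier[OF p1 x] by simp
    then show ?thesis
      using integrate_gen[OF X p1 h(1) x] gen[of x] h(2) x False by (simp add: cong_sym_eq)
  qed
  then have "[integrate p X h c = (\<Sum>k\<in>({} :: nat set). 1 * integrate p X h c)] (mod int p)"
    by (intro integrate_linear[OF X c _ _ h(1)]) auto
  then show ?thesis using h(2)[OF c] by (simp add: integrate_def cong_def)
qed

section \<open>Pro-$p$ trees by duality\<close>

lemma continuous_map_into_free_profinite_module:
  assumes carrier: "\<And>z. z \<in> topspace Z \<Longrightarrow> F z \<in> free_profinite_carrier p X A"
    and coeff: "\<And>P B. P \<in> clopen_partitions X \<Longrightarrow> B \<in> P \<Longrightarrow> locally_constant Z (\<lambda>z. F z P B)"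
  shows "continuous_map Z (mtop (free_profinite_module p X A)) F"
proof -
  have PiE: "F z \<in> (\<Pi>\<^sub>E P\<in>clopen_partitions X. \<Pi>\<^sub>E B\<in>P. carrier (Fp p))" if "z \<in> topspace Z" for z
    using carrier[OF that] by (simp add: free_profinite_carrier_def)
  have "continuous_map Z (discrete_topology (carrier (Fp p))) (\<lambda>z. F z P B)"
    if P: "P \<in> clopen_partitions X" "B \<in> P" for P B
    using coeff[OF P] PiE_mem[OF PiE_mem[OF PiE P(1)] P(2)] by (simp add: continuous_map_discrete_iff)
  then have "continuous_map Z (product_topology (\<lambda>B. discrete_topology (carrier (Fp p))) P) (\<lambda>z. F z P)"
    if P: "P \<in> clopen_partitions X" for P
    using PiE_mem[OF PiE P] P by (auto simp: continuous_map_componentwise PiE_iff)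
  then have "continuous_map Z (coeff_space p X) F"
    using PiE by (auto simp: continuous_map_componentwise PiE_iff)
  then show ?thesis
    using carrier unfolding mtop_free_profinite_module continuous_map_in_subtopology by auto
qed

lemma module_hom_minus_cong:
  assumes p: "p > 1" and \<phi>: "continuous_module_hom (Fp p) (free_profinite_module p X A) (Fp_module p) \<phi>"
    and x: "x \<in> free_profinite_carrier p X A" and y: "y \<in> free_profinite_carrier p X A"
  shows "[\<phi> (x \<ominus>\<^bsub>free_profinite_module p X A\<^esub> y) = \<phi> x - \<phi> y] (mod int p)"
proof -
  let ?M = "free_profinite_module p X A"
  interpret M: module "Fp p" ?M by (rule module_free_profinite_module[OF p])
  have xy: "x \<in> carrier ?M" "y \<in> carrier ?M" using x y by simp_all
  have "x = (x \<ominus>\<^bsub>?M\<^esub> y) \<oplus>\<^bsub>?M\<^esub> y"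
    using xy by (simp add: M.minus_eq M.a_assoc M.l_neg del: carrier_free_profinite_module)
  then have "\<phi> x = \<phi> (x \<ominus>\<^bsub>?M\<^esub> y) \<oplus>\<^bsub>Fp_module p\<^esub> \<phi> y"
    using \<phi> xy M.minus_closed[OF xy] unfolding continuous_module_hom_def by metis
  then have "\<phi> x = (\<phi> (x \<ominus>\<^bsub>?M\<^esub> y) + \<phi> y) mod int p"
    by (simp add: Fp_module_def residue_ring_def)
  then have "\<phi> x - \<phi> y = (\<phi> (x \<ominus>\<^bsub>?M\<^esub> y) + \<phi> y) mod int p - \<phi> y" by (rule arg_cong)
  then show ?thesis by (simp add: cong_def mod_simps)
qed

lemma topspace_vertex_space:
  "profinite_graph \<Gamma> \<Longrightarrow> topspace (vertex_space \<Gamma>) = verts \<Gamma>"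
  using closedin_subset[of "gspace \<Gamma>" "verts \<Gamma>"]
  by (auto simp: profinite_graph_def vertex_space_def)

lemma compact_space_vertex_space: "profinite_graph \<Gamma> \<Longrightarrow> compact_space (vertex_space \<Gamma>)"
  unfolding profinite_graph_def profinite_space_def vertex_space_def
  by (intro compact_space_subtopology closedin_compact_space) auto

lemma quotient_map_edge_class: "quotient_map (gspace \<Gamma>) (edge_space \<Gamma>) (edge_class \<Gamma>)"
  unfolding edge_space_def by (rule quotient_map_quotient_topology)

lemma topspace_edge_space: "topspace (edge_space \<Gamma>) = edge_class \<Gamma> ` topspace (gspace \<Gamma>)"
  unfolding edge_space_def by (rule topspace_quotient_topology)

lemma compact_space_edge_space: "profinite_graph \<Gamma> \<Longrightarrow> compact_space (edge_space \<Gamma>)"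
  using image_compactin[of "gspace \<Gamma>" "topspace (gspace \<Gamma>)" "edge_space \<Gamma>" "edge_class \<Gamma>"]
    quotient_imp_continuous_map[OF quotient_map_edge_class[of \<Gamma>]]
  by (simp add: compact_space_def topspace_edge_space profinite_graph_def profinite_space_def)

lemma edge_class_edge: "e \<in> edges \<Gamma> \<Longrightarrow> edge_class \<Gamma> e = Some e"
  by (simp add: edges_def edge_class_def)

lemma edges_in_edge_space: "e \<in> edges \<Gamma> \<Longrightarrow> Some e \<in> topspace (edge_space \<Gamma>)"
  using edge_class_edge[of e \<Gamma>] by (auto simp: topspace_edge_space edges_def intro: rev_image_eqI)

lemma topspace_edge_space_cases:
  assumes "z \<in> topspace (edge_space \<Gamma>)"
  obtains "z = None" | e where "e \<in> edges \<Gamma>" "z = Some e"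
  using assms by (auto simp: topspace_edge_space edge_class_def edges_def split: if_splits)

lemma d_in_verts:
  assumes "profinite_graph \<Gamma>" "x \<in> topspace (gspace \<Gamma>)"
  shows "d0 \<Gamma> x \<in> verts \<Gamma>" "d1 \<Gamma> x \<in> verts \<Gamma>"
proof -
  have "continuous_map (gspace \<Gamma>) (vertex_space \<Gamma>) (d0 \<Gamma>)" "continuous_map (gspace \<Gamma>) (vertex_space \<Gamma>) (d1 \<Gamma>)"
    using assms(1) by (simp_all add: profinite_graph_def vertex_space_def)
  from this[THEN continuous_map_image_subset_topspace]
  show "d0 \<Gamma> x \<in> verts \<Gamma>" "d1 \<Gamma> x \<in> verts \<Gamma>"
    using assms(2) topspace_vertex_space[OF assms(1)] by auto
qed

text \<open>Functions on the quotient \<open>edge_space \<Gamma>\<close> that vanish at the base point correspond to functions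
  on \<open>\<Gamma>\<close> that vanish on the vertices; this lemma and the next one pass between them.\<close>

lemma test_function_edge_space:
  assumes h: "locally_constant (gspace \<Gamma>) h" and zero: "\<And>v. v \<in> verts \<Gamma> \<Longrightarrow> h v = 0"
  shows "test_function p (edge_space \<Gamma>) {None} (case_option 0 h)"
proof -
  have "(case_option 0 h \<circ> edge_class \<Gamma>) = h"
    using zero by (auto simp: edge_class_def fun_eq_iff)
  then have "continuous_map (edge_space \<Gamma>) (discrete_topology UNIV) (case_option 0 h)"
    using h continuous_compose_quotient_map_eq[OF quotient_map_edge_class[of \<Gamma>], of "discrete_topology UNIV" "case_option 0 h"]
    by (simp add: locally_constant_def)
  then show ?thesis by (simp add: test_function_def locally_constant_def)
qed

lemma test_function_comp_edge_class:
  assumes "test_function p (edge_space \<Gamma>) {None} g"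
  shows "test_function p (gspace \<Gamma>) (verts \<Gamma>) (\<lambda>x. g (edge_class \<Gamma> x))"
  using assms locally_constant_comp[OF quotient_imp_continuous_map[OF quotient_map_edge_class[of \<Gamma>]], of g]
  by (simp add: test_function_def edge_class_def)

definition coboundary :: "('a, 'm) pgraph_scheme \<Rightarrow> ('a \<Rightarrow> int) \<Rightarrow> 'a option \<Rightarrow> int" where
  "coboundary \<Gamma> f = case_option 0 (\<lambda>e. f (d1 \<Gamma> e) - f (d0 \<Gamma> e))"

lemma coboundary_simps [simp]:
  "coboundary \<Gamma> f None = 0" "coboundary \<Gamma> f (Some e) = f (d1 \<Gamma> e) - f (d0 \<Gamma> e)"
  by (simp_all add: coboundary_def)

lemma test_function_coboundary:
  assumes \<Gamma>: "profinite_graph \<Gamma>" and f: "locally_constant (vertex_space \<Gamma>) f"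
  shows "test_function p (edge_space \<Gamma>) {None} (coboundary \<Gamma> f)"
  unfolding coboundary_def
proof (rule test_function_edge_space)
  have "continuous_map (gspace \<Gamma>) (vertex_space \<Gamma>) (d0 \<Gamma>)" "continuous_map (gspace \<Gamma>) (vertex_space \<Gamma>) (d1 \<Gamma>)"
    using \<Gamma> by (simp_all add: profinite_graph_def vertex_space_def)
  then show "locally_constant (gspace \<Gamma>) (\<lambda>e. f (d1 \<Gamma> e) - f (d0 \<Gamma> e))"
    by (intro locally_constant_comp2[where F = "(-)"]) (rule locally_constant_comp[OF _ f], assumption)+
  show "f (d1 \<Gamma> v) - f (d0 \<Gamma> v) = 0" if "v \<in> verts \<Gamma>" for v
    using \<Gamma> that by (simp add: profinite_graph_def)
qed

lemma test_function_empty: "test_function p X {} f \<longleftrightarrow> locally_constant X f"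
  by (simp add: test_function_def)

text \<open>Exactness of the sequence dual to the one that defines pro-\<open>p\<close> trees. The three conditions
  are injectivity of the map from the constants, exactness at the functions on the vertices, and surjectivity
  of the coboundary.\<close>

definition dual_sequence_exact :: "nat \<Rightarrow> ('a, 'm) pgraph_scheme \<Rightarrow> bool" where
  "dual_sequence_exact p \<Gamma> \<longleftrightarrow> verts \<Gamma> \<noteq> {} \<and>
     (\<forall>f. locally_constant (vertex_space \<Gamma>) f \<longrightarrow>
        (\<forall>e\<in>edges \<Gamma>. [f (d1 \<Gamma> e) = f (d0 \<Gamma> e)] (mod int p)) \<longrightarrow>
        (\<forall>v\<in>verts \<Gamma>. \<forall>w\<in>verts \<Gamma>. [f v = f w] (mod int p))) \<and>
     (\<forall>h. test_function p (gspace \<Gamma>) (verts \<Gamma>) h \<longrightarrow>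
        (\<exists>f. locally_constant (vertex_space \<Gamma>) f \<and>
           (\<forall>e\<in>edges \<Gamma>. [h e = f (d1 \<Gamma> e) - f (d0 \<Gamma> e)] (mod int p))))"

text \<open>The homomorphism \<open>\<delta>\<close>, defined as the transpose of the coboundary.\<close>

definition boundary :: "nat \<Rightarrow> ('a, 'm) pgraph_scheme \<Rightarrow> ('a option set set \<Rightarrow> 'a option set \<Rightarrow> int) \<Rightarrow> 'a set set \<Rightarrow> 'a set \<Rightarrow> int" where
  "boundary p \<Gamma> c = measure_of_functional p (vertex_space \<Gamma>) {}
     (\<lambda>f. integrate p (edge_space \<Gamma>) (coboundary \<Gamma> f) c)"

lemma coboundary_linear:
  assumes \<Gamma>: "profinite_graph \<Gamma>"
    and eq: "\<And>v. v \<in> verts \<Gamma> \<Longrightarrow> [g v = (\<Sum>k\<in>K. r k * h k v)] (mod int p)"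
    and z: "z \<in> topspace (edge_space \<Gamma>)"
  shows "[coboundary \<Gamma> g z = (\<Sum>k\<in>K. r k * coboundary \<Gamma> (h k) z)] (mod int p)"
  using z
proof (cases rule: topspace_edge_space_cases)
  case (2 e)
  then have "d0 \<Gamma> e \<in> verts \<Gamma>" "d1 \<Gamma> e \<in> verts \<Gamma>"
    using d_in_verts[OF \<Gamma>] by (auto simp: edges_def)
  then have "[g (d1 \<Gamma> e) - g (d0 \<Gamma> e) = (\<Sum>k\<in>K. r k * h k (d1 \<Gamma> e)) - (\<Sum>k\<in>K. r k * h k (d0 \<Gamma> e))] (mod int p)"
    by (intro cong_diff eq)
  then show ?thesis using 2(2) by (simp add: sum_subtractf right_diff_distrib)
qed simp

lemma linear_functional_coboundary:
  assumes \<Gamma>: "profinite_graph \<Gamma>" and c: "c \<in> free_profinite_carrier p (edge_space \<Gamma>) {None}"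
  shows "linear_functional p (vertex_space \<Gamma>) {} (\<lambda>f. integrate p (edge_space \<Gamma>) (coboundary \<Gamma> f) c)"
  unfolding linear_functional_def test_function_empty topspace_vertex_space[OF \<Gamma>]
proof (intro allI impI)
  fix K :: "'a set set" and r h g
  assume K: "finite K" "\<forall>k\<in>K. locally_constant (vertex_space \<Gamma>) (h k)" "locally_constant (vertex_space \<Gamma>) g"
    and eq: "\<forall>x\<in>verts \<Gamma>. [g x = (\<Sum>k\<in>K. r k * h k x)] (mod int p)"
  show "[integrate p (edge_space \<Gamma>) (coboundary \<Gamma> g) c =
      (\<Sum>k\<in>K. r k * integrate p (edge_space \<Gamma>) (coboundary \<Gamma> (h k)) c)] (mod int p)"
  proof (rule integrate_linear[OF compact_space_edge_space[OF \<Gamma>] c K(1)])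
    show "test_function p (edge_space \<Gamma>) {None} (coboundary \<Gamma> (h k))" if "k \<in> K" for k
      using K(2) that by (intro test_function_coboundary[OF \<Gamma>]) simp
    show "test_function p (edge_space \<Gamma>) {None} (coboundary \<Gamma> g)"
      by (rule test_function_coboundary[OF \<Gamma> K(3)])
    show "[coboundary \<Gamma> g z = (\<Sum>k\<in>K. r k * coboundary \<Gamma> (h k) z)] (mod int p)"
      if "z \<in> topspace (edge_space \<Gamma>)" for z
      using eq that by (intro coboundary_linear[OF \<Gamma>]) simp_all
  qed
qed

lemma boundary_in_carrier:
  assumes "profinite_graph \<Gamma>" "p > 0" "c \<in> free_profinite_carrier p (edge_space \<Gamma>) {None}"
  shows "boundary p \<Gamma> c \<in> free_profinite_carrier p (vertex_space \<Gamma>) {}"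
  unfolding boundary_def
  by (rule measure_of_functional_in_carrier[OF assms(2) linear_functional_coboundary[OF assms(1,3)]])

lemma integrate_in_range: "p > 0 \<Longrightarrow> integrate p X h c \<in> {0..<int p}"
  using integrate_range[of p X h c] by simp

lemma integrate_boundary:
  assumes \<Gamma>: "profinite_graph \<Gamma>" and p: "p > 0" and c: "c \<in> free_profinite_carrier p (edge_space \<Gamma>) {None}"
    and f: "locally_constant (vertex_space \<Gamma>) f"
  shows "integrate p (vertex_space \<Gamma>) f (boundary p \<Gamma> c) = integrate p (edge_space \<Gamma>) (coboundary \<Gamma> f) c"
proof -
  have "test_function p (vertex_space \<Gamma>) {} f" using f by (simp add: test_function_empty)
  from integrate_measure_of_functional[OF compact_space_vertex_space[OF \<Gamma>] p linear_functional_coboundary[OF \<Gamma> c] this]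
  show ?thesis
    unfolding boundary_def by (intro residues_eq_if_cong[OF integrate_in_range[OF p] integrate_in_range[OF p]])
qed

lemma boundary_coeff:
  assumes "P \<in> clopen_partitions (vertex_space \<Gamma>)" "B \<in> P"
  shows "boundary p \<Gamma> c P B = integrate p (edge_space \<Gamma>) (coboundary \<Gamma> (\<lambda>x. of_bool (x \<in> B))) c"
  using assms by (simp add: boundary_def measure_of_functional_def integrate_def)

lemma continuous_module_hom_boundary:
  assumes \<Gamma>: "profinite_graph \<Gamma>" and p: "p > 1"
  shows "continuous_module_hom (Fp p) (free_profinite_module p (edge_space \<Gamma>) {None})
     (free_profinite_module p (vertex_space \<Gamma>) {}) (boundary p \<Gamma>)"
proof -
  let ?M = "free_profinite_module p (edge_space \<Gamma>) {None}"
  let ?N = "free_profinite_module p (vertex_space \<Gamma>) {}"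
  let ?I = "\<lambda>B. integrate p (edge_space \<Gamma>) (coboundary \<Gamma> (\<lambda>x. of_bool (x \<in> B)))"
  have p0: "p > 0" using p by simp
  interpret M: module "Fp p" ?M by (rule module_free_profinite_module[OF p])
  interpret N: module "Fp p" ?N by (rule module_free_profinite_module[OF p])
  have carrier: "boundary p \<Gamma> c \<in> carrier ?N" if "c \<in> carrier ?M" for c
    using boundary_in_carrier[OF \<Gamma> p0] that by simp
  have hom: "continuous_module_hom (Fp p) ?M (Fp_module p) (?I B)"
    if P: "P \<in> clopen_partitions (vertex_space \<Gamma>)" "B \<in> P" for P B
  proof -
    have "locally_constant (vertex_space \<Gamma>) (\<lambda>x. of_bool (x \<in> B))"
      using test_function_indicator[OF P, of "{}"] by (simp add: test_function_empty)
    then have "locally_constant (edge_space \<Gamma>) (coboundary \<Gamma> (\<lambda>x. of_bool (x \<in> B)))"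
      using test_function_coboundary[OF \<Gamma>] by (simp add: test_function_def)
    then show ?thesis by (rule continuous_module_hom_integrate[OF compact_space_edge_space[OF \<Gamma>] _ p0])
  qed
  have "continuous_map (mtop ?M) (mtop ?N) (boundary p \<Gamma>)"
  proof (rule continuous_map_into_free_profinite_module)
    show "boundary p \<Gamma> c \<in> free_profinite_carrier p (vertex_space \<Gamma>) {}" if "c \<in> topspace (mtop ?M)" for c
      using carrier[of c] that by (simp add: topspace_free_profinite_module)
    fix P B assume P: "P \<in> clopen_partitions (vertex_space \<Gamma>)" "B \<in> P"
    have "continuous_map (mtop ?M) (discrete_topology (carrier (Fp p))) (?I B)"
      using hom[OF P] by (simp add: continuous_module_hom_def Fp_module_def)
    then show "locally_constant (mtop ?M) (\<lambda>c. boundary p \<Gamma> c P B)"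
      by (simp add: boundary_coeff[OF P] continuous_map_discrete_iff)
  qed
  moreover have "boundary p \<Gamma> (c \<oplus>\<^bsub>?M\<^esub> d) = boundary p \<Gamma> c \<oplus>\<^bsub>?N\<^esub> boundary p \<Gamma> d"
    if cd: "c \<in> carrier ?M" "d \<in> carrier ?M" for c d
  proof (rule free_profinite_carrier_ext[of _ p "vertex_space \<Gamma>" "{}"])
    show "boundary p \<Gamma> (c \<oplus>\<^bsub>?M\<^esub> d) \<in> free_profinite_carrier p (vertex_space \<Gamma>) {}"
      using carrier[OF M.a_closed[OF cd]] by simp
    show "boundary p \<Gamma> c \<oplus>\<^bsub>?N\<^esub> boundary p \<Gamma> d \<in> free_profinite_carrier p (vertex_space \<Gamma>) {}"
      using N.a_closed[OF carrier[OF cd(1)] carrier[OF cd(2)]] by simp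
    fix P B assume P: "P \<in> clopen_partitions (vertex_space \<Gamma>)" "B \<in> P"
    have "?I B (c \<oplus>\<^bsub>?M\<^esub> d) = (?I B c + ?I B d) mod int p"
      using hom[OF P] cd by (simp add: continuous_module_hom_def Fp_module_def residue_ring_def)
    then show "boundary p \<Gamma> (c \<oplus>\<^bsub>?M\<^esub> d) P B = (boundary p \<Gamma> c \<oplus>\<^bsub>?N\<^esub> boundary p \<Gamma> d) P B"
      by (simp add: boundary_coeff[OF P] add_free_profinite_module[OF P])
  qed
  moreover have "boundary p \<Gamma> (r \<odot>\<^bsub>?M\<^esub> c) = r \<odot>\<^bsub>?N\<^esub> boundary p \<Gamma> c"
    if r: "r \<in> carrier (Fp p)" and c: "c \<in> carrier ?M" for r c
  proof (rule free_profinite_carrier_ext[of _ p "vertex_space \<Gamma>" "{}"])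
    show "boundary p \<Gamma> (r \<odot>\<^bsub>?M\<^esub> c) \<in> free_profinite_carrier p (vertex_space \<Gamma>) {}"
      using carrier[OF M.smult_closed[OF r c]] by simp
    show "r \<odot>\<^bsub>?N\<^esub> boundary p \<Gamma> c \<in> free_profinite_carrier p (vertex_space \<Gamma>) {}"
      using N.smult_closed[OF r carrier[OF c]] by simp
    fix P B assume P: "P \<in> clopen_partitions (vertex_space \<Gamma>)" "B \<in> P"
    have "?I B (r \<odot>\<^bsub>?M\<^esub> c) = (r * ?I B c) mod int p"
      using hom[OF P] r c by (simp add: continuous_module_hom_def Fp_module_def residue_ring_def)
    then show "boundary p \<Gamma> (r \<odot>\<^bsub>?M\<^esub> c) P B = (r \<odot>\<^bsub>?N\<^esub> boundary p \<Gamma> c) P B"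
      by (simp add: boundary_coeff[OF P] smult_free_profinite_module[OF P])
  qed
  ultimately show ?thesis
    using carrier unfolding continuous_module_hom_def by (intro conjI funcsetI ballI)
qed

text \<open>Here the maps are \<open>boundary\<close> and integration of the constant 1. Injectivity holds because every test
  function on the edges is a coboundary, and measures are determined by their integrals. If
  \<open>x\<close> integrates 1 to 0, a preimage of \<open>x\<close> is the measure that integrates \<open>g\<close> to the integral against
  \<open>x\<close> of any function with coboundary \<open>g\<close>. This is well defined because such functions are unique up to constants.\<close>

lemma pro_p_tree_if_dual_sequence_exact:
  assumes p: "prime p" and \<Gamma>: "profinite_graph \<Gamma>" and dual: "dual_sequence_exact p \<Gamma>"
  shows "pro_p_tree p \<Gamma>"
proof -
  define ME where "ME = free_profinite_module p (edge_space \<Gamma>) {None}"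
  define MV where "MV = free_profinite_module p (vertex_space \<Gamma>) {}"
  define gE where "gE = free_profinite_gen (edge_space \<Gamma>) {None}"
  define gV where "gV = free_profinite_gen (vertex_space \<Gamma>) {}"
  define \<epsilon> where "\<epsilon> = integrate p (vertex_space \<Gamma>) (\<lambda>_. 1)"
  let ?\<delta> = "boundary p \<Gamma>"
  have p1: "p > 1" using p by (rule prime_gt_1_nat)
  then have p0: "p > 0" by simp
  interpret MV: module "Fp p" MV unfolding MV_def by (rule module_free_profinite_module[OF p1])
  have XE: "compact_space (edge_space \<Gamma>)" by (rule compact_space_edge_space[OF \<Gamma>])
  have XV: "compact_space (vertex_space \<Gamma>)" by (rule compact_space_vertex_space[OF \<Gamma>])
  have cME: "carrier ME = free_profinite_carrier p (edge_space \<Gamma>) {None}" by (simp add: ME_def)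
  have cMV: "carrier MV = free_profinite_carrier p (vertex_space \<Gamma>) {}" by (simp add: MV_def)
  have gV: "gV v \<in> carrier MV" if "v \<in> verts \<Gamma>" for v
    using that free_profinite_gen_in_carrier[OF p1, of v "vertex_space \<Gamma>"]
    by (simp add: gV_def MV_def topspace_vertex_space[OF \<Gamma>])
  have gE: "gE (Some e) \<in> carrier ME" if "e \<in> edges \<Gamma>" for e
    using free_profinite_gen_in_carrier[OF p1 edges_in_edge_space[OF that]]
    by (simp add: gE_def ME_def)
  have int_gV: "[integrate p (vertex_space \<Gamma>) f (gV v) = f v] (mod int p)"
    if "v \<in> verts \<Gamma>" "locally_constant (vertex_space \<Gamma>) f" for f v
    using that integrate_gen[OF XV p1, of "{}" f v]
    by (simp add: gV_def topspace_vertex_space[OF \<Gamma>] test_function_empty)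
  have one: "locally_constant (vertex_space \<Gamma>) (\<lambda>_. 1)" by (rule locally_constant_const)
  have hom\<delta>: "continuous_module_hom (Fp p) ME MV ?\<delta>"
    unfolding ME_def MV_def by (rule continuous_module_hom_boundary[OF \<Gamma> p1])
  have hom\<epsilon>: "continuous_module_hom (Fp p) MV (Fp_module p) \<epsilon>"
    unfolding MV_def \<epsilon>_def by (rule continuous_module_hom_integrate[OF XV one p0])
  have \<delta>_gen: "?\<delta> (gE (edge_class \<Gamma> e)) = gV (d1 \<Gamma> e) \<ominus>\<^bsub>MV\<^esub> gV (d0 \<Gamma> e)" if e: "e \<in> edges \<Gamma>" for e
  proof -
    have d: "d0 \<Gamma> e \<in> verts \<Gamma>" "d1 \<Gamma> e \<in> verts \<Gamma>"
      using d_in_verts[OF \<Gamma>] e by (auto simp: edges_def)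
    have g: "gE (Some e) \<in> free_profinite_carrier p (edge_space \<Gamma>) {None}" using gE[OF e] cME by simp
    have "?\<delta> (gE (Some e)) = gV (d1 \<Gamma> e) \<ominus>\<^bsub>MV\<^esub> gV (d0 \<Gamma> e)"
    proof (rule integrate_separates[OF XV p0, of _ "{}"])
      show "?\<delta> (gE (Some e)) \<in> free_profinite_carrier p (vertex_space \<Gamma>) {}"
        by (rule boundary_in_carrier[OF \<Gamma> p0 g])
      show "gV (d1 \<Gamma> e) \<ominus>\<^bsub>MV\<^esub> gV (d0 \<Gamma> e) \<in> free_profinite_carrier p (vertex_space \<Gamma>) {}"
        using MV.minus_closed[OF gV[OF d(2)] gV[OF d(1)]] cMV by simp
      fix f assume f: "test_function p (vertex_space \<Gamma>) {} f"
      then have f': "locally_constant (vertex_space \<Gamma>) f" by (simp add: test_function_empty)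
      have "integrate p (vertex_space \<Gamma>) f (?\<delta> (gE (Some e))) = integrate p (edge_space \<Gamma>) (coboundary \<Gamma> f) (gE (Some e))"
        by (rule integrate_boundary[OF \<Gamma> p0 g f'])
      also have "[\<dots> = f (d1 \<Gamma> e) - f (d0 \<Gamma> e)] (mod int p)"
        using integrate_gen[OF XE p1 test_function_coboundary[OF \<Gamma> f'] edges_in_edge_space[OF e]]
        by (simp add: gE_def)
      also have "[f (d1 \<Gamma> e) - f (d0 \<Gamma> e) = integrate p (vertex_space \<Gamma>) f (gV (d1 \<Gamma> e)) - integrate p (vertex_space \<Gamma>) f (gV (d0 \<Gamma> e))] (mod int p)"
        by (intro cong_diff cong_sym[OF int_gV] d f')
      also have "[integrate p (vertex_space \<Gamma>) f (gV (d1 \<Gamma> e)) - integrate p (vertex_space \<Gamma>) f (gV (d0 \<Gamma> e)) =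
          integrate p (vertex_space \<Gamma>) f (gV (d1 \<Gamma> e) \<ominus>\<^bsub>MV\<^esub> gV (d0 \<Gamma> e))] (mod int p)"
        unfolding MV_def
        by (rule cong_sym[OF module_hom_minus_cong[OF p1 continuous_module_hom_integrate[OF XV f' p0]]])
          (use gV[OF d(1)] gV[OF d(2)] cMV in simp_all)
      finally have "[integrate p (vertex_space \<Gamma>) f (?\<delta> (gE (Some e))) =
          integrate p (vertex_space \<Gamma>) f (gV (d1 \<Gamma> e) \<ominus>\<^bsub>MV\<^esub> gV (d0 \<Gamma> e))] (mod int p)" .
      then show "integrate p (vertex_space \<Gamma>) f (?\<delta> (gE (Some e))) =
          integrate p (vertex_space \<Gamma>) f (gV (d1 \<Gamma> e) \<ominus>\<^bsub>MV\<^esub> gV (d0 \<Gamma> e))"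
        by (intro residues_eq_if_cong[OF integrate_in_range[OF p0] integrate_in_range[OF p0]])
    qed
    then show ?thesis by (simp add: edge_class_edge[OF e])
  qed
  have \<epsilon>_gen: "\<epsilon> (gV v) = 1" if "v \<in> verts \<Gamma>" for v
    using int_gV[OF that one] p1 by (simp add: \<epsilon>_def integrate_def cong_def)
  have primitive: "\<exists>f. locally_constant (vertex_space \<Gamma>) f \<and>
      (\<forall>z\<in>topspace (edge_space \<Gamma>). [g z = coboundary \<Gamma> f z] (mod int p))"
    if g: "test_function p (edge_space \<Gamma>) {None} g" for g
  proof -
    obtain f where f: "locally_constant (vertex_space \<Gamma>) f"
      "\<And>e. e \<in> edges \<Gamma> \<Longrightarrow> [g (edge_class \<Gamma> e) = f (d1 \<Gamma> e) - f (d0 \<Gamma> e)] (mod int p)"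
      using dual test_function_comp_edge_class[OF g] unfolding dual_sequence_exact_def by blast
    have "[g z = coboundary \<Gamma> f z] (mod int p)" if "z \<in> topspace (edge_space \<Gamma>)" for z
      using that
    proof (cases rule: topspace_edge_space_cases)
      case 1
      then show ?thesis using g by (simp add: test_function_def cong_0_iff)
    next
      case (2 e)
      then show ?thesis using f(2)[OF 2(1)] by (simp add: edge_class_edge)
    qed
    then show ?thesis using f(1) by blast
  qed
  have inj: "inj_on ?\<delta> (carrier ME)"
  proof (rule inj_onI)
    fix c d assume c: "c \<in> carrier ME" and d: "d \<in> carrier ME" and eq: "?\<delta> c = ?\<delta> d"
    show "c = d"
    proof (rule integrate_separates[OF XE p0 c[unfolded cME] d[unfolded cME]])
      fix g assume g: "test_function p (edge_space \<Gamma>) {None} g"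
      then obtain f where f: "locally_constant (vertex_space \<Gamma>) f"
        "\<forall>z\<in>topspace (edge_space \<Gamma>). [g z = coboundary \<Gamma> f z] (mod int p)"
        using primitive by blast
      have "integrate p (edge_space \<Gamma>) g c' = integrate p (vertex_space \<Gamma>) f (?\<delta> c')" if c': "c' \<in> carrier ME" for c'
      proof -
        have "integrate p (edge_space \<Gamma>) g c' = integrate p (edge_space \<Gamma>) (coboundary \<Gamma> f) c'"
          using f(2) by (intro integrate_cong[OF XE c'[unfolded cME] test_function_coboundary[OF \<Gamma> f(1)] g]) simp
        then show ?thesis using integrate_boundary[OF \<Gamma> p0 c'[unfolded cME] f(1)] by simp
      qed
      from this[OF c] this[OF d] show "integrate p (edge_space \<Gamma>) g c = integrate p (edge_space \<Gamma>) g d"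
        using eq by simp
    qed
  qed
  have im1: "\<epsilon> (?\<delta> c) = 0" if c: "c \<in> carrier ME" for c
  proof -
    have "\<epsilon> (?\<delta> c) = integrate p (edge_space \<Gamma>) (coboundary \<Gamma> (\<lambda>_. 1)) c"
      unfolding \<epsilon>_def by (rule integrate_boundary[OF \<Gamma> p0 c[unfolded cME] one])
    also have "coboundary \<Gamma> (\<lambda>_. 1) = (\<lambda>_. 0)"
      by (auto simp: coboundary_def fun_eq_iff split: option.splits)
    finally show ?thesis by (simp add: integrate_def block_sum_def)
  qed
  have im2: "\<exists>c\<in>carrier ME. ?\<delta> c = x" if x: "x \<in> carrier MV" and \<epsilon>x: "\<epsilon> x = 0" for x
  proof -
    \<comment> \<open>functions with the same coboundary differ by a constant, which \<open>x\<close> integrates to 0\<close>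
    have same: "[integrate p (vertex_space \<Gamma>) f x = integrate p (vertex_space \<Gamma>) f' x] (mod int p)"
      if f: "locally_constant (vertex_space \<Gamma>) f" "locally_constant (vertex_space \<Gamma>) f'"
        and eq: "\<And>z. z \<in> topspace (edge_space \<Gamma>) \<Longrightarrow> [coboundary \<Gamma> f z = coboundary \<Gamma> f' z] (mod int p)" for f f'
    proof -
      define u where "u v = f v - f' v" for v
      have u: "locally_constant (vertex_space \<Gamma>) u"
        unfolding u_def[abs_def] by (rule locally_constant_comp2[where F = "(-)", OF f])
      have "[u (d1 \<Gamma> e) = u (d0 \<Gamma> e)] (mod int p)" if e: "e \<in> edges \<Gamma>" for e
        using eq[OF edges_in_edge_space[OF e]]
        by (simp add: u_def cong_iff_dvd_diff algebra_simps)
      then have const: "[u v = u w] (mod int p)" if "v \<in> verts \<Gamma>" "w \<in> verts \<Gamma>" for v w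
        using dual u that unfolding dual_sequence_exact_def by blast
      obtain w where w: "w \<in> verts \<Gamma>" using dual by (auto simp: dual_sequence_exact_def)
      have "[integrate p (vertex_space \<Gamma>) f x =
          (\<Sum>b\<in>{True, False}. (if b then 1 else u w) * integrate p (vertex_space \<Gamma>) (if b then f' else (\<lambda>_. 1)) x)] (mod int p)"
      proof (rule integrate_linear[OF XV x[unfolded cMV]])
        fix v assume "v \<in> topspace (vertex_space \<Gamma>)"
        then have "[u v = u w] (mod int p)" using const w by (simp add: topspace_vertex_space[OF \<Gamma>])
        then have "[f' v + u v = f' v + u w] (mod int p)" by (intro cong_add) simp_all
        then show "[f v = (\<Sum>b\<in>{True, False}. (if b then 1 else u w) * (if b then f' else (\<lambda>_. 1)) v)] (mod int p)"
          by (simp add: u_def)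
      qed (use f one in \<open>auto simp: test_function_empty\<close>)
      then show ?thesis using \<epsilon>x by (simp add: \<epsilon>_def)
    qed
    define prim where "prim g = (SOME f. locally_constant (vertex_space \<Gamma>) f \<and>
      (\<forall>z\<in>topspace (edge_space \<Gamma>). [g z = coboundary \<Gamma> f z] (mod int p)))" for g
    have prim: "locally_constant (vertex_space \<Gamma>) (prim g)"
      "\<And>z. z \<in> topspace (edge_space \<Gamma>) \<Longrightarrow> [g z = coboundary \<Gamma> (prim g) z] (mod int p)"
      if "test_function p (edge_space \<Gamma>) {None} g" for g
      using someI_ex[OF primitive[OF that]] unfolding prim_def by simp_all
    define L where "L g = integrate p (vertex_space \<Gamma>) (prim g) x" for g
    have L: "linear_functional p (edge_space \<Gamma>) {None} L"
      unfolding linear_functional_def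
    proof (intro allI impI)
      fix K :: "'a option set set" and r h g
      assume K: "finite K" "\<forall>k\<in>K. test_function p (edge_space \<Gamma>) {None} (h k)"
        and g: "test_function p (edge_space \<Gamma>) {None} g"
        and eq: "\<forall>z\<in>topspace (edge_space \<Gamma>). [g z = (\<Sum>k\<in>K. r k * h k z)] (mod int p)"
      define s where "s v = (\<Sum>k\<in>K. r k * prim (h k) v)" for v
      have s: "locally_constant (vertex_space \<Gamma>) s"
        unfolding s_def[abs_def] using K by (intro locally_constant_sum locally_constant_cmult prim) simp_all
      have "[L g = integrate p (vertex_space \<Gamma>) s x] (mod int p)"
        unfolding L_def
      proof (rule same[OF prim(1)[OF g] s])
        fix z assume z: "z \<in> topspace (edge_space \<Gamma>)"
        have "[coboundary \<Gamma> (prim g) z = (\<Sum>k\<in>K. r k * h k z)] (mod int p)"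
          using prim(2)[OF g z] eq z by (metis cong_sym cong_trans)
        also have "[(\<Sum>k\<in>K. r k * h k z) = (\<Sum>k\<in>K. r k * coboundary \<Gamma> (prim (h k)) z)] (mod int p)"
          using K(2) z by (intro cong_sum cong_scalar_left prim(2)) simp_all
        also have "[(\<Sum>k\<in>K. r k * coboundary \<Gamma> (prim (h k)) z) = coboundary \<Gamma> s z] (mod int p)"
          by (rule cong_sym, rule coboundary_linear[OF \<Gamma> _ z]) (simp add: s_def)
        finally show "[coboundary \<Gamma> (prim g) z = coboundary \<Gamma> s z] (mod int p)" .
      qed
      also have "[integrate p (vertex_space \<Gamma>) s x = (\<Sum>k\<in>K. r k * integrate p (vertex_space \<Gamma>) (prim (h k)) x)] (mod int p)"
      proof (rule integrate_linear[OF XV x[unfolded cMV] K(1)])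
        show "test_function p (vertex_space \<Gamma>) {} (prim (h k))" if "k \<in> K" for k
          using K(2) that prim(1) by (simp add: test_function_empty)
        show "test_function p (vertex_space \<Gamma>) {} s" using s by (simp add: test_function_empty)
      qed (simp add: s_def)
      finally show "[L g = (\<Sum>k\<in>K. r k * L (h k))] (mod int p)" by (simp add: L_def)
    qed
    define c where "c = measure_of_functional p (edge_space \<Gamma>) {None} L"
    have c: "c \<in> free_profinite_carrier p (edge_space \<Gamma>) {None}"
      unfolding c_def by (rule measure_of_functional_in_carrier[OF p0 L])
    have "?\<delta> c = x"
    proof (rule integrate_separates[OF XV p0 boundary_in_carrier[OF \<Gamma> p0 c] x[unfolded cMV]])
      fix f assume "test_function p (vertex_space \<Gamma>) {} f"
      then have f: "locally_constant (vertex_space \<Gamma>) f" by (simp add: test_function_empty)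
      have cf: "test_function p (edge_space \<Gamma>) {None} (coboundary \<Gamma> f)" by (rule test_function_coboundary[OF \<Gamma> f])
      have "integrate p (vertex_space \<Gamma>) f (?\<delta> c) = integrate p (edge_space \<Gamma>) (coboundary \<Gamma> f) c"
        by (rule integrate_boundary[OF \<Gamma> p0 c f])
      also have "[\<dots> = L (coboundary \<Gamma> f)] (mod int p)"
        unfolding c_def by (rule integrate_measure_of_functional[OF XE p0 L cf])
      also have "[L (coboundary \<Gamma> f) = integrate p (vertex_space \<Gamma>) f x] (mod int p)"
        unfolding L_def by (rule same[OF prim(1)[OF cf] f cong_sym[OF prim(2)[OF cf]]])
      finally show "integrate p (vertex_space \<Gamma>) f (?\<delta> c) = integrate p (vertex_space \<Gamma>) f x"
        by (intro residues_eq_if_cong[OF integrate_in_range[OF p0] integrate_in_range[OF p0]])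
    qed
    then show ?thesis using c cME by blast
  qed
  have im: "?\<delta> ` carrier ME = {x \<in> carrier MV. \<epsilon> x = 0}"
  proof (intro equalityI subsetI)
    fix x assume "x \<in> ?\<delta> ` carrier ME"
    then obtain c where c: "c \<in> carrier ME" "x = ?\<delta> c" by (rule imageE)
    then show "x \<in> {x \<in> carrier MV. \<epsilon> x = 0}"
      using im1[OF c(1)] boundary_in_carrier[OF \<Gamma> p0 c(1)[unfolded cME]] cMV by simp
  next
    fix x assume "x \<in> {x \<in> carrier MV. \<epsilon> x = 0}"
    then have "\<exists>c\<in>carrier ME. ?\<delta> c = x" using im2[of x] by simp
    then show "x \<in> ?\<delta> ` carrier ME" by (elim bexE) (erule subst, erule imageI)
  qed
  have surj: "\<epsilon> ` carrier MV = carrier (Fp p)"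
  proof (intro equalityI subsetI)
    fix r assume "r \<in> \<epsilon> ` carrier MV"
    then obtain x where "r = \<epsilon> x" by (rule imageE)
    then show "r \<in> carrier (Fp p)"
      using integrate_range[OF p0, of "vertex_space \<Gamma>" "\<lambda>_. 1" x] by (simp add: \<epsilon>_def residue_ring_def)
  next
    fix r assume r: "r \<in> carrier (Fp p)"
    obtain v where v: "v \<in> verts \<Gamma>" using dual by (auto simp: dual_sequence_exact_def)
    have "\<epsilon> (r \<odot>\<^bsub>MV\<^esub> gV v) = r \<odot>\<^bsub>Fp_module p\<^esub> \<epsilon> (gV v)"
      using hom\<epsilon> r gV[OF v] by (simp add: continuous_module_hom_def)
    also have "\<dots> = r"
      using r by (simp add: \<epsilon>_gen[OF v] Fp_module_def residue_ring_def)
    finally show "r \<in> \<epsilon> ` carrier MV"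
      using MV.smult_closed[OF r gV[OF v]] by (metis imageI)
  qed
  have res: "\<zero>\<^bsub>Fp p\<^esub> = 0" "\<one>\<^bsub>Fp p\<^esub> = 1" by (simp_all add: residue_ring_def)
  show ?thesis
    unfolding pro_p_tree_def Let_def res ME_def[symmetric] MV_def[symmetric] gE_def[symmetric] gV_def[symmetric]
    using \<Gamma> hom\<delta> \<delta>_gen hom\<epsilon> \<epsilon>_gen inj im surj
    by (intro conjI exI[of _ ?\<delta>] exI[of _ \<epsilon>] ballI)
qed

text \<open>If \<open>f\<close> has zero coboundary, then integration of \<open>f\<close> composed with \<open>\<delta>\<close> vanishes on the generators,
  hence everywhere; but the difference of two vertices is in the image of \<open>\<delta>\<close>, so \<open>f\<close> takes
  the same value at both. Surjectivity of the coboundary is the dual of the injectivity of \<open>\<delta>\<close>.\<close>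

lemma dual_sequence_exact_if_pro_p_tree:
  assumes p: "prime p" and tree: "pro_p_tree p \<Gamma>"
  shows "dual_sequence_exact p \<Gamma>"
proof -
  define ME where "ME = free_profinite_module p (edge_space \<Gamma>) {None}"
  define MV where "MV = free_profinite_module p (vertex_space \<Gamma>) {}"
  define gE where "gE = free_profinite_gen (edge_space \<Gamma>) {None}"
  define gV where "gV = free_profinite_gen (vertex_space \<Gamma>) {}"
  have \<Gamma>: "profinite_graph \<Gamma>" using tree by (simp add: pro_p_tree_def)
  have p1: "p > 1" using p by (rule prime_gt_1_nat)
  then have p0: "p > 0" by simp
  interpret MV: module "Fp p" MV unfolding MV_def by (rule module_free_profinite_module[OF p1])
  have XE: "compact_space (edge_space \<Gamma>)" by (rule compact_space_edge_space[OF \<Gamma>])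
  have XV: "compact_space (vertex_space \<Gamma>)" by (rule compact_space_vertex_space[OF \<Gamma>])
  have cME: "carrier ME = free_profinite_carrier p (edge_space \<Gamma>) {None}" by (simp add: ME_def)
  have cMV: "carrier MV = free_profinite_carrier p (vertex_space \<Gamma>) {}" by (simp add: MV_def)
  have res: "\<zero>\<^bsub>Fp p\<^esub> = 0" "\<one>\<^bsub>Fp p\<^esub> = 1" by (simp_all add: residue_ring_def)
  obtain \<delta> \<epsilon> where
    hom\<delta>: "continuous_module_hom (Fp p) ME MV \<delta>" and
    \<delta>_gen: "\<And>e. e \<in> edges \<Gamma> \<Longrightarrow> \<delta> (gE (edge_class \<Gamma> e)) = gV (d1 \<Gamma> e) \<ominus>\<^bsub>MV\<^esub> gV (d0 \<Gamma> e)" and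
    hom\<epsilon>: "continuous_module_hom (Fp p) MV (Fp_module p) \<epsilon>" and
    \<epsilon>_gen: "\<And>v. v \<in> verts \<Gamma> \<Longrightarrow> \<epsilon> (gV v) = 1" and
    inj: "inj_on \<delta> (carrier ME)" and
    im: "\<delta> ` carrier ME = {x \<in> carrier MV. \<epsilon> x = 0}" and
    surj: "\<epsilon> ` carrier MV = carrier (Fp p)"
    using tree
    unfolding pro_p_tree_def Let_def res ME_def[symmetric] MV_def[symmetric] gE_def[symmetric] gV_def[symmetric]
    by (elim conjE exE) (rule that, simp_all)
  have gV: "gV v \<in> carrier MV" if "v \<in> verts \<Gamma>" for v
    using that free_profinite_gen_in_carrier[OF p1, of v "vertex_space \<Gamma>"]
    by (simp add: gV_def MV_def topspace_vertex_space[OF \<Gamma>])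
  have gE: "gE (Some e) \<in> carrier ME" if "e \<in> edges \<Gamma>" for e
    using free_profinite_gen_in_carrier[OF p1 edges_in_edge_space[OF that]]
    by (simp add: gE_def ME_def)
  have int_gV: "[integrate p (vertex_space \<Gamma>) f (gV v) = f v] (mod int p)"
    if "v \<in> verts \<Gamma>" "locally_constant (vertex_space \<Gamma>) f" for f v
    using that integrate_gen[OF XV p1, of "{}" f v]
    by (simp add: gV_def topspace_vertex_space[OF \<Gamma>] test_function_empty)
  have homf: "continuous_module_hom (Fp p) MV (Fp_module p) (integrate p (vertex_space \<Gamma>) f)"
    if "locally_constant (vertex_space \<Gamma>) f" for f
    unfolding MV_def by (rule continuous_module_hom_integrate[OF XV that p0])
  have int_diff: "[integrate p (vertex_space \<Gamma>) f (gV v \<ominus>\<^bsub>MV\<^esub> gV w) = f v - f w] (mod int p)"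
    if vw: "v \<in> verts \<Gamma>" "w \<in> verts \<Gamma>" and f: "locally_constant (vertex_space \<Gamma>) f" for f v w
  proof -
    have "[integrate p (vertex_space \<Gamma>) f (gV v \<ominus>\<^bsub>MV\<^esub> gV w) =
        integrate p (vertex_space \<Gamma>) f (gV v) - integrate p (vertex_space \<Gamma>) f (gV w)] (mod int p)"
      unfolding MV_def
      by (rule module_hom_minus_cong[OF p1 homf[OF f, unfolded MV_def]]) (use gV vw cMV in simp_all)
    also have "[integrate p (vertex_space \<Gamma>) f (gV v) - integrate p (vertex_space \<Gamma>) f (gV w) = f v - f w] (mod int p)"
      by (intro cong_diff int_gV vw f)
    finally show ?thesis .
  qed
  have d: "d0 \<Gamma> e \<in> verts \<Gamma>" "d1 \<Gamma> e \<in> verts \<Gamma>" if "e \<in> edges \<Gamma>" for e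
    using d_in_verts[OF \<Gamma>] that by (auto simp: edges_def)
  have nonempty: "verts \<Gamma> \<noteq> {}"
  proof
    assume empty: "verts \<Gamma> = {}"
    have "0 \<in> \<epsilon> ` carrier MV" "1 \<in> \<epsilon> ` carrier MV"
      using p1 unfolding surj by (simp_all add: residue_ring_def)
    then obtain a b where ab: "a \<in> carrier MV" "b \<in> carrier MV" and eps: "0 = \<epsilon> a" "1 = \<epsilon> b"
      by (elim imageE)
    have "a = b"
    proof (rule free_profinite_carrier_ext[OF ab[unfolded cMV]])
      fix P B assume P: "P \<in> clopen_partitions (vertex_space \<Gamma>)" "B \<in> P"
      then have "(SOME x. x \<in> B) \<in> topspace (vertex_space \<Gamma>)"
        using point_of_block[OF P] block_subset[OF P] by blast
      then show "a P B = b P B" by (simp add: topspace_vertex_space[OF \<Gamma>] empty)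
    qed
    then show False using eps by simp
  qed
  have H0: "[f v = f w] (mod int p)"
    if f: "locally_constant (vertex_space \<Gamma>) f"
      and eq: "\<forall>e\<in>edges \<Gamma>. [f (d1 \<Gamma> e) = f (d0 \<Gamma> e)] (mod int p)"
      and vw: "v \<in> verts \<Gamma>" "w \<in> verts \<Gamma>" for f v w
  proof -
    let ?x = "gV v \<ominus>\<^bsub>MV\<^esub> gV w"
    have x: "?x \<in> carrier MV" using gV vw by (intro MV.minus_closed)
    have "[\<epsilon> ?x = \<epsilon> (gV v) - \<epsilon> (gV w)] (mod int p)"
      unfolding MV_def
      by (rule module_hom_minus_cong[OF p1 hom\<epsilon>[unfolded MV_def]]) (use gV vw cMV in simp_all)
    moreover have "\<epsilon> ?x \<in> {0..<int p}"
      using funcset_mem[of \<epsilon> "carrier MV" "carrier (Fp_module p)", OF _ x] hom\<epsilon>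
      unfolding continuous_module_hom_def by simp
    ultimately have "\<epsilon> ?x = 0"
      unfolding \<epsilon>_gen[OF vw(1)] \<epsilon>_gen[OF vw(2)] by (simp add: cong_def)
    then have "?x \<in> \<delta> ` carrier ME" unfolding im using x by (intro CollectI conjI)
    then obtain c where c: "c \<in> carrier ME" "?x = \<delta> c" by (rule imageE)
    have "integrate p (vertex_space \<Gamma>) f (\<delta> c) = 0"
    proof (rule functional_zero_if_zero_on_generators[OF XE p _ _ c(1)[unfolded cME]])
      show "continuous_module_hom (Fp p) (free_profinite_module p (edge_space \<Gamma>) {None}) (Fp_module p)
          (\<lambda>c. integrate p (vertex_space \<Gamma>) f (\<delta> c))"
        using continuous_module_hom_compose[OF hom\<delta> homf[OF f]] by (simp add: ME_def)
      fix z assume z: "z \<in> topspace (edge_space \<Gamma>) - {None}"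
      then obtain e where e: "e \<in> edges \<Gamma>" "z = Some e"
        by (auto elim: topspace_edge_space_cases)
      have "[integrate p (vertex_space \<Gamma>) f (\<delta> (gE z)) = f (d1 \<Gamma> e) - f (d0 \<Gamma> e)] (mod int p)"
        using int_diff[OF d(2)[OF e(1)] d(1)[OF e(1)] f] \<delta>_gen[OF e(1)] e(2)
        by (simp add: edge_class_edge[OF e(1)])
      moreover have "[f (d1 \<Gamma> e) - f (d0 \<Gamma> e) = 0] (mod int p)"
        using eq e(1) by (simp add: cong_iff_dvd_diff)
      ultimately have "[integrate p (vertex_space \<Gamma>) f (\<delta> (gE z)) = 0] (mod int p)"
        by (rule cong_trans)
      then show "integrate p (vertex_space \<Gamma>) f (\<delta> (free_profinite_gen (edge_space \<Gamma>) {None} z)) = 0"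
        by (simp add: gE_def integrate_def cong_def)
    qed
    then have "[f v - f w = 0] (mod int p)"
      using cong_sym[OF int_diff[OF vw f]] unfolding c(2) by simp
    then have "int p dvd f v - f w" by (simp only: cong_0_iff)
    then show ?thesis unfolding cong_iff_dvd_diff .
  qed
  have H1: "\<exists>f. locally_constant (vertex_space \<Gamma>) f \<and>
      (\<forall>e\<in>edges \<Gamma>. [h e = f (d1 \<Gamma> e) - f (d0 \<Gamma> e)] (mod int p))"
    if h: "test_function p (gspace \<Gamma>) (verts \<Gamma>) h" for h
  proof -
    let ?h = "\<lambda>x. h x mod int p" let ?g = "case_option 0 ?h"
    have lc: "locally_constant (gspace \<Gamma>) ?h"
      using h by (intro locally_constant_comp1[where F = "\<lambda>a. a mod int p"]) (simp add: test_function_def)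
    have g: "test_function p (edge_space \<Gamma>) {None} ?g"
      using h by (intro test_function_edge_space[OF lc]) (simp add: test_function_def)
    then have "locally_constant (edge_space \<Gamma>) ?g" by (simp add: test_function_def)
    note homg = continuous_module_hom_integrate[OF XE this p0, where A = "{None}"]
    obtain f where f: "test_function p (vertex_space \<Gamma>) {} f"
      "\<forall>c\<in>carrier ME. integrate p (edge_space \<Gamma>) ?g c = integrate p (vertex_space \<Gamma>) f (\<delta> c)"
      using functional_factors_through_injection[OF XV p hom\<delta>[unfolded ME_def MV_def] inj[unfolded cME] homg]
      unfolding cME by (elim exE conjE)
    have lf: "locally_constant (vertex_space \<Gamma>) f" using f(1) by (simp add: test_function_empty)
    have "[h e = f (d1 \<Gamma> e) - f (d0 \<Gamma> e)] (mod int p)" if e: "e \<in> edges \<Gamma>" for e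
    proof -
      have "[h e = ?g (Some e)] (mod int p)" by (simp add: cong_def)
      also have "[?g (Some e) = integrate p (edge_space \<Gamma>) ?g (gE (Some e))] (mod int p)"
        unfolding gE_def by (rule cong_sym[OF integrate_gen[OF XE p1 g edges_in_edge_space[OF e]]])
      also have "integrate p (edge_space \<Gamma>) ?g (gE (Some e)) = integrate p (vertex_space \<Gamma>) f (gV (d1 \<Gamma> e) \<ominus>\<^bsub>MV\<^esub> gV (d0 \<Gamma> e))"
        using bspec[OF f(2) gE[OF e]] \<delta>_gen[OF e] by (simp add: edge_class_edge[OF e])
      also have "[\<dots> = f (d1 \<Gamma> e) - f (d0 \<Gamma> e)] (mod int p)"
        by (rule int_diff[OF d(2)[OF e] d(1)[OF e] lf])
      finally show ?thesis .
    qed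
    then show ?thesis using lf by blast
  qed
  show ?thesis
    unfolding dual_sequence_exact_def
  proof (intro conjI nonempty allI impI ballI)
    fix f v w
    assume "locally_constant (vertex_space \<Gamma>) f" "\<forall>e\<in>edges \<Gamma>. [f (d1 \<Gamma> e) = f (d0 \<Gamma> e)] (mod int p)"
      "v \<in> verts \<Gamma>" "w \<in> verts \<Gamma>"
    then show "[f v = f w] (mod int p)" by (rule H0)
  qed (rule H1)
qed

section \<open>Functions on products and connected graphs\<close>

lemma locally_constant_if_fibers_closed:
  assumes "\<And>K. closedin X {x \<in> topspace X. h x \<in> K}"
  shows "locally_constant X h"
proof -
  have "openin X {x \<in> topspace X. h x \<in> K}" for K
  proof -
    have "topspace X - {x \<in> topspace X. h x \<in> - K} = {x \<in> topspace X. h x \<in> K}" by auto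
    then show ?thesis using assms[of "- K"] by (metis closedin_def)
  qed
  then show ?thesis by (simp add: locally_constant_def continuous_map_def)
qed

lemma locally_constant_prod:
  assumes "\<And>x. x \<in> topspace X \<Longrightarrow> \<exists>U g. openin X U \<and> x \<in> U \<and> locally_constant Y g \<and>
      (\<forall>x'\<in>U. \<forall>y\<in>topspace Y. f (x', y) = g y)"
  shows "locally_constant (prod_topology X Y) f"
proof -
  have "openin (prod_topology X Y) {z \<in> topspace (prod_topology X Y). f z \<in> K}" for K
    unfolding openin_prod_topology_alt
  proof (intro allI impI)
    fix x y assume "(x, y) \<in> {z \<in> topspace (prod_topology X Y). f z \<in> K}"
    then have xy: "x \<in> topspace X" "y \<in> topspace Y" "f (x, y) \<in> K" by simp_all
    obtain U g where U: "openin X U" "x \<in> U" and g: "locally_constant Y g"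
      and eq: "\<And>x' y. x' \<in> U \<Longrightarrow> y \<in> topspace Y \<Longrightarrow> f (x', y) = g y"
      using assms[OF xy(1)] by (elim exE conjE) simp
    let ?V = "{y \<in> topspace Y. g y \<in> K}"
    have "U \<times> ?V \<subseteq> {z \<in> topspace (prod_topology X Y). f z \<in> K}"
      using openin_subset[OF U(1)] eq by auto
    moreover have "y \<in> ?V" using xy eq[OF U(2) xy(2)] by simp
    ultimately show "\<exists>U V. openin X U \<and> openin Y V \<and> x \<in> U \<and> y \<in> V \<and>
        U \<times> V \<subseteq> {z \<in> topspace (prod_topology X Y). f z \<in> K}"
      using U openin_locally_constant_fiber[OF g, of K] by (intro exI conjI)
  qed
  then show ?thesis by (simp add: locally_constant_def continuous_map_def)
qed

text \<open>The tube lemma, in the form that projection along a compact space is a closed map.\<close>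

lemma openin_same_section:
  assumes Y: "compact_space Y" and h: "locally_constant (prod_topology X Y) h" and x: "x \<in> topspace X"
  shows "openin X {x' \<in> topspace X. \<forall>y\<in>topspace Y. h (x', y) = h (x, y)}"
proof -
  have "continuous_map (prod_topology X Y) (prod_topology X Y) (\<lambda>z. (x, snd z))"
    using x by (simp add: continuous_map_pairwise o_def continuous_map_snd)
  from locally_constant_comp[OF this h]
  have "locally_constant (prod_topology X Y) (\<lambda>z. h z - h (x, snd z))"
    by (rule locally_constant_comp2[where F = "(-)", OF h])
  then have "closedin (prod_topology X Y) {z \<in> topspace (prod_topology X Y). h z - h (x, snd z) \<in> - {0}}"
    by (rule closedin_locally_constant_fiber)
  then have "closedin X (fst ` {z \<in> topspace (prod_topology X Y). h z - h (x, snd z) \<in> - {0}})"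
    using Abstract_Topological_Spaces.closed_map_fst[OF Y, of X] unfolding closed_map_def by blast
  moreover have "{x' \<in> topspace X. \<forall>y\<in>topspace Y. h (x', y) = h (x, y)} =
      topspace X - fst ` {z \<in> topspace (prod_topology X Y). h z - h (x, snd z) \<in> - {0}}"
    by (force simp: image_iff)
  ultimately show ?thesis by (simp only: openin_diff[OF openin_topspace])
qed

text \<open>In a finite quotient, the indicator function of the vertices reachable from \<open>u\<close> pulls back to a
  function with zero coboundary, which is therefore constant.\<close>

lemma connected_if_dual_sequence_exact:
  assumes p: "p > 1" and \<Gamma>: "profinite_graph \<Gamma>" and dual: "dual_sequence_exact p \<Gamma>"
  shows "pgraph_connected \<Gamma>"
  unfolding pgraph_connected_def finite_graph_connected_def
proof (intro allI impI ballI, elim conjE)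
  fix Q :: "nat pgraph" and q u v
  assume Q: "finite_graph Q" and q: "graph_morphism \<Gamma> Q q" "q ` topspace (gspace \<Gamma>) = topspace (gspace Q)"
    and uv: "u \<in> verts Q" "v \<in> verts Q"
  let ?R = "\<Union>e\<in>edges Q. {(d0 Q e, d1 Q e), (d1 Q e, d0 Q e)}"
  have Qg: "profinite_graph Q" "finite (topspace (gspace Q))" using Q by (simp_all add: finite_graph_def)
  have disc: "gspace Q = discrete_topology (topspace (gspace Q))"
    using Qg finite_t1_space_imp_discrete_topology[of "gspace Q" "topspace (gspace Q)"]
    by (auto simp: profinite_graph_def profinite_space_def intro: Hausdorff_imp_t1_space)
  have qd: "q (d0 \<Gamma> x) = d0 Q (q x)" "q (d1 \<Gamma> x) = d1 Q (q x)" if "x \<in> topspace (gspace \<Gamma>)" for x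
    using q(1) that by (simp_all add: graph_morphism_def)
  have VQ: "verts Q \<subseteq> topspace (gspace Q)"
    using Qg(1) by (auto simp: profinite_graph_def dest: closedin_subset)
  have lift: "\<exists>a\<in>verts \<Gamma>. q a = w" if w: "w \<in> verts Q" for w
  proof -
    have "w \<in> q ` topspace (gspace \<Gamma>)" using w VQ q(2) by blast
    then obtain a where a: "a \<in> topspace (gspace \<Gamma>)" "w = q a" by (elim imageE)
    have "q (d0 \<Gamma> a) = w" using qd(1)[OF a(1)] a(2) w Qg(1) by (simp add: profinite_graph_def)
    then show ?thesis using d_in_verts(1)[OF \<Gamma> a(1)] by (intro bexI)
  qed
  define f where "f x = (of_bool ((u, q x) \<in> ?R\<^sup>*) :: int)" for x
  have "continuous_map (vertex_space \<Gamma>) (gspace Q) q"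
    using q(1) by (auto simp: graph_morphism_def vertex_space_def intro: continuous_map_from_subtopology)
  moreover have "locally_constant (gspace Q) (\<lambda>w. of_bool ((u, w) \<in> ?R\<^sup>*))"
    unfolding locally_constant_def by (subst disc) (simp add: continuous_map_from_discrete_topology)
  ultimately have lf: "locally_constant (vertex_space \<Gamma>) f"
    unfolding f_def[abs_def] by (rule locally_constant_comp)
  have "f (d1 \<Gamma> e) = f (d0 \<Gamma> e)" if e: "e \<in> edges \<Gamma>" for e
  proof -
    have e': "e \<in> topspace (gspace \<Gamma>)" using e by (simp add: edges_def)
    have "q e \<in> topspace (gspace Q)" using q(2) e' by blast
    then consider "q e \<in> verts Q" | "q e \<in> edges Q" by (auto simp: edges_def)
    then show ?thesis
    proof cases
      case 1
      then have "d1 Q (q e) = d0 Q (q e)" using Qg(1) by (simp add: profinite_graph_def)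
      then show ?thesis unfolding f_def by (simp only: qd[OF e'])
    next
      case 2
      then have "(d0 Q (q e), d1 Q (q e)) \<in> ?R" "(d1 Q (q e), d0 Q (q e)) \<in> ?R" by auto
      then have "(u, d0 Q (q e)) \<in> ?R\<^sup>* \<longleftrightarrow> (u, d1 Q (q e)) \<in> ?R\<^sup>*"
        by (meson rtrancl.rtrancl_into_rtrancl)
      then show ?thesis unfolding f_def by (simp only: qd[OF e'])
    qed
  qed
  then have const: "[f a = f b] (mod int p)" if "a \<in> verts \<Gamma>" "b \<in> verts \<Gamma>" for a b
    using dual lf that unfolding dual_sequence_exact_def by (metis cong_refl)
  obtain a where a: "a \<in> verts \<Gamma>" "q a = u" using lift[OF uv(1)] by (elim bexE)
  obtain b where b: "b \<in> verts \<Gamma>" "q b = v" using lift[OF uv(2)] by (elim bexE)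
  have "f a = 1" using a(2) by (simp add: f_def)
  then have "f b = 1"
    using const[OF a(1) b(1)] p by (auto simp: f_def cong_def split: if_splits)
  then show "(u, v) \<in> ?R\<^sup>*" using b(2) by (simp add: f_def split: if_splits)
qed

text \<open>A map that identifies the ends of each edge with the edge is a morphism to a graph without edges. A separation
  of its image would give a quotient graph consisting of two isolated vertices, so the image is connected, and
  connected subsets of a profinite space are points.\<close>

lemma edgeless_image_of_connected_graph:
  assumes X: "profinite_space X" and conn: "pgraph_connected \<Gamma>"
    and f: "continuous_map (gspace \<Gamma>) X f"
    and fd: "\<And>x. x \<in> topspace (gspace \<Gamma>) \<Longrightarrow> f (d0 \<Gamma> x) = f x \<and> f (d1 \<Gamma> x) = f x"
    and xy: "x \<in> topspace (gspace \<Gamma>)" "y \<in> topspace (gspace \<Gamma>)"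
  shows "f x = f y"
proof -
  have "connectedin X (f ` topspace (gspace \<Gamma>))"
    unfolding connectedin_closedin
  proof (rule conjI, goal_cases image separation)
    case image
    show "f ` topspace (gspace \<Gamma>) \<subseteq> topspace X"
      by (rule continuous_map_image_subset_topspace[OF f])
  next
    case separation
    have False if E: "closedin X E1" "closedin X E2" "f ` topspace (gspace \<Gamma>) \<subseteq> E1 \<union> E2"
      "E1 \<inter> E2 \<inter> f ` topspace (gspace \<Gamma>) = {}"
      "E1 \<inter> f ` topspace (gspace \<Gamma>) \<noteq> {}" "E2 \<inter> f ` topspace (gspace \<Gamma>) \<noteq> {}" for E1 E2
    proof -
    obtain a where a: "a \<in> topspace (gspace \<Gamma>)" "f a \<in> E1" using E(5) by auto
    obtain b where b: "b \<in> topspace (gspace \<Gamma>)" "f b \<in> E2" using E(6) by auto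
    define Q :: "nat pgraph" where
      "Q = \<lparr>gspace = discrete_topology {0, 1}, verts = {0, 1}, d0 = (\<lambda>x. x), d1 = (\<lambda>x. x)\<rparr>"
    define q where "q x = (if f x \<in> E1 then 0 else 1 :: nat)" for x
    have conn_disc: "\<exists>x. S \<subseteq> {x}" if "connectedin (discrete_topology {0, 1 :: nat}) S" for S
      using that by (auto simp: connectedin_discrete_topology)
    have "profinite_graph Q"
      using conn_disc
      by (auto simp: profinite_graph_def profinite_space_def Q_def compact_space_discrete_topology)
    then have Q: "finite_graph Q" by (simp add: finite_graph_def Q_def)
    have closed: "closedin (gspace \<Gamma>) {x \<in> topspace (gspace \<Gamma>). f x \<in> E1}"
      "closedin (gspace \<Gamma>) {x \<in> topspace (gspace \<Gamma>). f x \<in> E2}"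
      by (rule closedin_continuous_map_preimage[OF f E(1)], rule closedin_continuous_map_preimage[OF f E(2)])
    have compl: "topspace (gspace \<Gamma>) - {x \<in> topspace (gspace \<Gamma>). f x \<in> E1} = {x \<in> topspace (gspace \<Gamma>). f x \<in> E2}"
      using E(3,4) by blast
    have compl': "topspace (gspace \<Gamma>) - {x \<in> topspace (gspace \<Gamma>). f x \<in> E2} = {x \<in> topspace (gspace \<Gamma>). f x \<in> E1}"
      using E(3,4) by blast
    have opens: "openin (gspace \<Gamma>) {x \<in> topspace (gspace \<Gamma>). f x \<in> E1}"
      "openin (gspace \<Gamma>) {x \<in> topspace (gspace \<Gamma>). f x \<in> E2}"
      using openin_diff[OF openin_topspace closed(2)] openin_diff[OF openin_topspace closed(1)]
      unfolding compl compl' by simp_all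
    have "openin (gspace \<Gamma>) {x \<in> topspace (gspace \<Gamma>). q x \<in> U}" for U
    proof -
      have "{x \<in> topspace (gspace \<Gamma>). q x \<in> U} =
          (if 0 \<in> U then {x \<in> topspace (gspace \<Gamma>). f x \<in> E1} else {}) \<union>
          (if 1 \<in> U then topspace (gspace \<Gamma>) - {x \<in> topspace (gspace \<Gamma>). f x \<in> E1} else {})"
        by (auto simp: q_def)
      then show ?thesis using opens unfolding compl by (auto intro!: openin_Un)
    qed
    then have "continuous_map (gspace \<Gamma>) (gspace Q) q"
      by (auto simp: continuous_map_def Q_def q_def)
    moreover have "q (d0 \<Gamma> x) = d0 Q (q x)" "q (d1 \<Gamma> x) = d1 Q (q x)" if "x \<in> topspace (gspace \<Gamma>)" for x
      using fd[OF that] by (simp_all add: q_def Q_def)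
    ultimately have "graph_morphism \<Gamma> Q q" by (simp add: graph_morphism_def)
    moreover have qa: "q a = 0" using a by (simp add: q_def)
    moreover have "f b \<notin> E1" using E(4) b by auto
    then have qb: "q b = 1" by (simp add: q_def)
    moreover have "q ` topspace (gspace \<Gamma>) = topspace (gspace Q)"
    proof
      show "q ` topspace (gspace \<Gamma>) \<subseteq> topspace (gspace Q)" by (auto simp: q_def Q_def)
      show "topspace (gspace Q) \<subseteq> q ` topspace (gspace \<Gamma>)"
        using imageI[OF a(1), of q] imageI[OF b(1), of q] qa qb by (simp add: Q_def)
    qed
    ultimately have "finite_graph_connected Q"
      using conn Q unfolding pgraph_connected_def by blast
    moreover have "edges Q = {}" by (simp add: edges_def Q_def)
    moreover have "0 \<in> verts Q" "1 \<in> verts Q" by (simp_all add: Q_def)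
    ultimately have "(0, 1 :: nat) \<in> {}\<^sup>*"
      unfolding finite_graph_connected_def by (metis (no_types, lifting) UN_empty)
    then show False by simp
    qed
    then show ?case by blast
  qed
  then obtain z where "f ` topspace (gspace \<Gamma>) \<subseteq> {z}"
    using X unfolding profinite_space_def by blast
  then show ?thesis using xy by blast
qed

section \<open>Attaching edges equivariantly\<close>

lemma graph_action_group_action: "graph_action G T \<Longrightarrow> group_action G (topspace (gspace T)) (act T)"
  by (simp add: graph_action_def)

lemma act_in_topspace:
  "\<lbrakk>graph_action G T; g \<in> carrier G; x \<in> topspace (gspace T)\<rbrakk> \<Longrightarrow> act T g x \<in> topspace (gspace T)"
  using group_action.element_image[OF graph_action_group_action] by metis

lemma act_mult:
  "\<lbrakk>graph_action G T; g \<in> carrier G; h \<in> carrier G; x \<in> topspace (gspace T)\<rbrakk> \<Longrightarrow>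
     act T (g \<otimes>\<^bsub>G\<^esub> h) x = act T g (act T h x)"
  using group_action.composition_rule[OF graph_action_group_action] by metis

lemma act_inv:
  assumes "graph_action G T" "g \<in> carrier G" "x \<in> topspace (gspace T)"
  shows "act T (inv\<^bsub>G\<^esub> g) (act T g x) = x"
  using group_action.orbit_sym_aux[OF graph_action_group_action[OF assms(1)] assms(2,3)] by simp

lemma act_d:
  "\<lbrakk>graph_action G T; g \<in> carrier G; x \<in> topspace (gspace T)\<rbrakk> \<Longrightarrow> d0 T (act T g x) = act T g (d0 T x)"
  "\<lbrakk>graph_action G T; g \<in> carrier G; x \<in> topspace (gspace T)\<rbrakk> \<Longrightarrow> d1 T (act T g x) = act T g (d1 T x)"
  by (simp_all add: graph_action_def)

lemma verts_subset: "profinite_graph T \<Longrightarrow> verts T \<subseteq> topspace (gspace T)"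
  by (auto simp: profinite_graph_def dest: closedin_subset)

lemma act_verts:
  assumes T: "profinite_graph T" and a: "graph_action G T" and g: "g \<in> carrier G" and x: "x \<in> verts T"
  shows "act T g x \<in> verts T"
proof -
  have x': "x \<in> topspace (gspace T)" using x verts_subset[OF T] by blast
  have "d0 T x = x" using T x by (simp add: profinite_graph_def)
  then have "d0 T (act T g x) = act T g x" using act_d(1)[OF a g x'] by simp
  then show ?thesis using d_in_verts(1)[OF T act_in_topspace[OF a g x']] by simp
qed

lemma act_edges:
  assumes T: "profinite_graph T" and a: "graph_action G T" and G: "group G" and g: "g \<in> carrier G" and x: "x \<in> edges T"
  shows "act T g x \<in> edges T"
proof -
  have x': "x \<in> topspace (gspace T)" "x \<notin> verts T" using x by (simp_all add: edges_def)
  have "act T g x \<notin> verts T"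
  proof
    assume "act T g x \<in> verts T"
    then have "act T (inv\<^bsub>G\<^esub> g) (act T g x) \<in> verts T"
      by (intro act_verts[OF T a group.inv_closed[OF G g]])
    then show False using x'(2) act_inv[OF a g x'(1)] by simp
  qed
  then show ?thesis using act_in_topspace[OF a g x'(1)] by (simp add: edges_def)
qed

lemma continuous_orbit_map:
  assumes "graph_action G T" "topspace (gtop G) = carrier G" "x \<in> topspace (gspace T)"
  shows "continuous_map (gtop G) (gspace T) (\<lambda>g. act T g x)"
proof -
  have "continuous_map (gtop G) (prod_topology (gtop G) (gspace T)) (\<lambda>g. (g, x))"
    using assms(3) by (simp add: continuous_map_pairwise o_def)
  moreover have "continuous_map (prod_topology (gtop G) (gspace T)) (gspace T) (\<lambda>(g, x). act T g x)"
    using assms(1) by (simp add: graph_action_def)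
  ultimately show ?thesis
    using continuous_map_compose by (fastforce simp: o_def)
qed

text \<open>The graph of an equivariant map from the edges of \<open>T1\<close> to the vertices of \<open>T2\<close>. Each orbit of edges
  is represented by one edge \<open>r\<close>, for which \<open>base r\<close> is a vertex fixed by the stabilizer of \<open>r\<close>; this is what
  makes the relation single-valued. Continuity of the map is expressed by the closedness of the relation, which
  follows from compactness of \<open>G\<close> and finiteness of the set of orbits.\<close>

lemma ex_equivariant_attaching_relation:
  fixes G :: "'g top_group" and T1 :: "('g, 'a) ggraph" and T2 :: "('g, 'b) ggraph"
  assumes G: "group G" "topspace (gtop G) = carrier G" "compact_space (gtop G)"
    and T1: "profinite_graph T1" "graph_action G T1" and T2: "profinite_graph T2" "graph_action G T2"
    and fin: "finite (orbits G (topspace (gspace T1)) (act T1))"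
    and ell: "elliptic_wrt G T1 T2"
  shows "\<exists>F. closedin (prod_topology (gspace T1) (gspace T2)) F \<and> F \<subseteq> edges T1 \<times> verts T2 \<and>
     (\<forall>e\<in>edges T1. \<exists>x. (e, x) \<in> F) \<and> (\<forall>e x y. (e, x) \<in> F \<longrightarrow> (e, y) \<in> F \<longrightarrow> x = y) \<and>
     (\<forall>g\<in>carrier G. \<forall>e x. (e, x) \<in> F \<longrightarrow> (act T1 g e, act T2 g x) \<in> F)"
proof -
  let ?X1 = "gspace T1" and ?X2 = "gspace T2"
  let ?orb = "\<lambda>e. orbit G (act T1) e"
  interpret G: group G by (rule G(1))
  interpret A1: group_action G "topspace ?X1" "act T1" by (rule graph_action_group_action[OF T1(2)])
  have E1: "edges T1 \<subseteq> topspace ?X1" by (auto simp: edges_def)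
  have V2: "verts T2 \<subseteq> topspace ?X2" by (rule verts_subset[OF T2(1)])
  define rep where "rep O' = (SOME e. e \<in> O')" for O' :: "'a set"
  define R where "R = rep ` (?orb ` edges T1)"
  have "?orb ` edges T1 \<subseteq> orbits G (topspace ?X1) (act T1)"
    using E1 by (auto simp: orbits_def)
  then have finR: "finite R" unfolding R_def using fin finite_subset by blast
  have rep: "rep (?orb e) \<in> ?orb e" if "e \<in> edges T1" for e
  proof -
    have "e \<in> ?orb e" using A1.orbit_refl E1 that by blast
    then show ?thesis unfolding rep_def by (rule someI)
  qed
  have repE: "rep (?orb e) \<in> edges T1" if e: "e \<in> edges T1" for e
  proof -
    obtain g where "g \<in> carrier G" "rep (?orb e) = act T1 g e"
      using rep[OF e] by (auto simp: orbit_def)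
    then show ?thesis using act_edges[OF T1 G(1) _ e] by simp
  qed
  have orb_eq: "?orb (act T1 g e) = ?orb e" if g: "g \<in> carrier G" and e: "e \<in> topspace ?X1" for g e
  proof
    show "?orb (act T1 g e) \<subseteq> ?orb e"
      unfolding orbit_def using act_mult[OF T1(2) _ g e] g by (auto; metis G.m_closed)
    show "?orb e \<subseteq> ?orb (act T1 g e)"
    proof
      fix z assume "z \<in> ?orb e"
      then obtain h where h: "h \<in> carrier G" "z = act T1 h e" by (auto simp: orbit_def)
      have "act T1 (h \<otimes>\<^bsub>G\<^esub> inv\<^bsub>G\<^esub> g) (act T1 g e) = act T1 h (act T1 (inv\<^bsub>G\<^esub> g) (act T1 g e))"
        by (rule act_mult[OF T1(2) h(1) G.inv_closed[OF g] act_in_topspace[OF T1(2) g e]])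
      then have "z = act T1 (h \<otimes>\<^bsub>G\<^esub> inv\<^bsub>G\<^esub> g) (act T1 g e)"
        using h(2) act_inv[OF T1(2) g e] by simp
      then show "z \<in> ?orb (act T1 g e)" using h(1) g by (auto simp: orbit_def)
    qed
  qed
  have R: "r \<in> edges T1" "rep (?orb r) = r" if r: "r \<in> R" for r
  proof -
    obtain e where e: "e \<in> edges T1" "r = rep (?orb e)" using r by (auto simp: R_def)
    show "r \<in> edges T1" using repE[OF e(1)] e(2) by simp
    obtain g where g: "g \<in> carrier G" "r = act T1 g e"
      using rep[OF e(1)] e(2) by (auto simp: orbit_def)
    then have "?orb r = ?orb e" using orb_eq[OF g(1)] E1 e(1) by auto
    then show "rep (?orb r) = r" using e(2) by simp
  qed
  define base where "base e = (SOME v. v \<in> verts T2 \<and> (\<forall>h\<in>stabilizer G (act T1) e. act T2 h v = v))" for e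
  have base: "base e \<in> verts T2" "\<And>h. h \<in> stabilizer G (act T1) e \<Longrightarrow> act T2 h (base e) = base e"
    if "e \<in> edges T1" for e
  proof -
    have "\<exists>v. v \<in> verts T2 \<and> (\<forall>h\<in>stabilizer G (act T1) e. act T2 h v = v)"
      using ell that unfolding elliptic_wrt_def elliptic_def by blast
    from someI_ex[OF this]
    show "base e \<in> verts T2" "\<And>h. h \<in> stabilizer G (act T1) e \<Longrightarrow> act T2 h (base e) = base e"
      unfolding base_def by blast+
  qed
  define F where "F = (\<Union>r\<in>R. (\<lambda>g. (act T1 g r, act T2 g (base r))) ` carrier G)"
  have F_iff: "(e, x) \<in> F \<longleftrightarrow> (\<exists>r\<in>R. \<exists>g\<in>carrier G. e = act T1 g r \<and> x = act T2 g (base r))" for e x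
    by (auto simp: F_def)
  have closed: "closedin (prod_topology ?X1 ?X2) F"
    unfolding F_def
  proof (intro closedin_Union finite_imageI finR, elim imageE, hypsubst)
    fix r assume r: "r \<in> R"
    have "continuous_map (gtop G) (prod_topology ?X1 ?X2) (\<lambda>g. (act T1 g r, act T2 g (base r)))"
      using continuous_orbit_map[OF T1(2) G(2)] continuous_orbit_map[OF T2(2) G(2)] R(1)[OF r] base(1)[OF R(1)[OF r]] E1 V2
      by (auto simp: continuous_map_pairwise o_def)
    then have "compactin (prod_topology ?X1 ?X2) ((\<lambda>g. (act T1 g r, act T2 g (base r))) ` carrier G)"
      using G(2,3) by (intro image_compactin) (simp_all add: compact_space_def)
    moreover have "Hausdorff_space (prod_topology ?X1 ?X2)"
      using T1(1) T2(1) by (simp add: Hausdorff_space_prod_topology profinite_graph_def profinite_space_def)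
    ultimately show "closedin (prod_topology ?X1 ?X2) ((\<lambda>g. (act T1 g r, act T2 g (base r))) ` carrier G)"
      by (intro compactin_imp_closedin)
  qed
  have sub: "F \<subseteq> edges T1 \<times> verts T2"
    using act_edges[OF T1 G(1)] act_verts[OF T2] R(1) base(1) by (auto simp: F_def)
  have ex: "\<exists>x. (e, x) \<in> F" if e: "e \<in> edges T1" for e
  proof -
    have "rep (?orb e) \<in> R" using e by (auto simp: R_def)
    moreover have "e \<in> ?orb (rep (?orb e))"
      using A1.orbit_sym[OF _ _ rep[OF e]] e repE[OF e] E1 by blast
    then obtain g where "g \<in> carrier G" "e = act T1 g (rep (?orb e))" by (auto simp: orbit_def)
    ultimately show ?thesis using F_iff by blast
  qed
  have unique: "x = y" if F: "(e, x) \<in> F" "(e, y) \<in> F" for e x y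
  proof -
    obtain r g where r: "r \<in> R" "g \<in> carrier G" "e = act T1 g r" "x = act T2 g (base r)"
      using F(1) unfolding F_iff by (elim bexE conjE)
    obtain s h where s: "s \<in> R" "h \<in> carrier G" "e = act T1 h s" "y = act T2 h (base s)"
      using F(2) unfolding F_iff by (elim bexE conjE)
    have rE: "r \<in> topspace ?X1" "s \<in> topspace ?X1" using R(1)[OF r(1)] R(1)[OF s(1)] E1 by auto
    have "?orb e = ?orb r" unfolding r(3) by (rule orb_eq[OF r(2) rE(1)])
    moreover have "?orb e = ?orb s" unfolding s(3) by (rule orb_eq[OF s(2) rE(2)])
    ultimately have "rep (?orb r) = rep (?orb s)" by (simp only:)
    then have rs: "r = s" unfolding R(2)[OF r(1)] R(2)[OF s(1)] .
    let ?k = "inv\<^bsub>G\<^esub> g \<otimes>\<^bsub>G\<^esub> h"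
    have "act T1 ?k r = act T1 (inv\<^bsub>G\<^esub> g) (act T1 h r)"
      by (rule act_mult[OF T1(2) G.inv_closed[OF r(2)] s(2) rE(1)])
    also have "act T1 h r = act T1 g r" unfolding rs using s(3)[symmetric] r(3)[unfolded rs] by (rule trans)
    also have "act T1 (inv\<^bsub>G\<^esub> g) (act T1 g r) = r" by (rule act_inv[OF T1(2) r(2) rE(1)])
    finally have kr: "act T1 ?k r = r" .
    have kG: "?k \<in> carrier G" using r(2) s(2) by simp
    have "?k \<in> stabilizer G (act T1) r"
      unfolding stabilizer_def by (intro CollectI conjI kG kr)
    then have k: "act T2 ?k (base r) = base r" by (rule base(2)[OF R(1)[OF r(1)]])
    have b: "base r \<in> topspace ?X2" using base(1)[OF R(1)[OF r(1)]] V2 by blast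
    have "act T2 g (act T2 ?k (base r)) = act T2 (g \<otimes>\<^bsub>G\<^esub> ?k) (base r)"
      by (rule act_mult[OF T2(2) r(2) kG b, symmetric])
    also have "g \<otimes>\<^bsub>G\<^esub> ?k = h"
      using r(2) s(2) by (simp add: G.m_assoc[symmetric])
    finally have "act T2 g (base r) = act T2 h (base r)" unfolding k .
    then show "x = y" unfolding r(4) s(4) rs .
  qed
  have inv: "(act T1 g e, act T2 g x) \<in> F" if g: "g \<in> carrier G" and F: "(e, x) \<in> F" for g e x
  proof -
    obtain r h where r: "r \<in> R" "h \<in> carrier G" "e = act T1 h r" "x = act T2 h (base r)"
      using F unfolding F_iff by (elim bexE conjE)
    have "r \<in> topspace ?X1" "base r \<in> topspace ?X2"
      using R(1)[OF r(1)] base(1)[OF R(1)[OF r(1)]] E1 V2 by auto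
    then have "act T1 g e = act T1 (g \<otimes>\<^bsub>G\<^esub> h) r" "act T2 g x = act T2 (g \<otimes>\<^bsub>G\<^esub> h) (base r)"
      using r(3,4) act_mult[OF T1(2) g r(2)] act_mult[OF T2(2) g r(2)] by simp_all
    then show ?thesis using r(1) G.m_closed[OF g r(2)] unfolding F_iff by (intro bexI conjI)
  qed
  show ?thesis
  proof (intro exI[of _ F] conjI closed sub ballI allI impI)
    show "\<exists>x. (e, x) \<in> F" if "e \<in> edges T1" for e using that by (rule ex)
    show "x = y" if "(e, x) \<in> F" "(e, y) \<in> F" for e x y using that by (rule unique)
    show "(act T1 g e, act T2 g x) \<in> F" if "g \<in> carrier G" "(e, x) \<in> F" for g e x using that by (rule inv)
  qed
qed

section \<open>Blowing up the vertices of a tree\<close>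

locale vertex_blowup =
  fixes p :: nat and G :: "'g top_group" and T1 :: "('g, 'a) ggraph" and T2 :: "('g, 'b) ggraph"
    and F :: "('a \<times> 'b) set"
  assumes prime: "prime p" and group: "group G" and gtop: "topspace (gtop G) = carrier G"
    and T1: "G_tree p G T1" and T2: "G_tree p G T2"
    and F_closed: "closedin (prod_topology (gspace T1) (gspace T2)) F"
    and F_subset: "F \<subseteq> edges T1 \<times> verts T2"
    and F_ex: "e \<in> edges T1 \<Longrightarrow> \<exists>x. (e, x) \<in> F"
    and F_unique: "\<lbrakk>(e, x) \<in> F; (e, y) \<in> F\<rbrakk> \<Longrightarrow> x = y"
    and F_act: "\<lbrakk>g \<in> carrier G; (e, x) \<in> F\<rbrakk> \<Longrightarrow> (act T1 g e, act T2 g x) \<in> F"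
begin

abbreviation "X1 \<equiv> gspace T1"
abbreviation "X2 \<equiv> gspace T2"

definition blocks :: "('a \<times> 'b) set" where
  "blocks = verts T1 \<times> topspace X2"

definition points :: "('a \<times> 'b) set" where
  "points = blocks \<union> F"

text \<open>The action is restricted to the points because group actions by bijections are required to be
  extensional functions.\<close>

definition blowup :: "('g, 'a \<times> 'b) ggraph" where
  "blowup = \<lparr>gspace = subtopology (prod_topology X1 X2) points,
     verts = verts T1 \<times> verts T2,
     d0 = (\<lambda>z. (d0 T1 (fst z), d0 T2 (snd z))),
     d1 = (\<lambda>z. (d1 T1 (fst z), d1 T2 (snd z))),
     act = (\<lambda>g. \<lambda>z\<in>points. (act T1 g (fst z), act T2 g (snd z)))\<rparr>"

lemma p_gt_1: "p > 1"
  by (rule prime_gt_1_nat[OF prime])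

lemma graphs: "profinite_graph T1" "profinite_graph T2"
  using T1 T2 by (simp_all add: G_tree_def pro_p_tree_def)

lemma actions: "graph_action G T1" "graph_action G T2"
  using T1 T2 by (simp_all add: G_tree_def)

lemma duals: "dual_sequence_exact p T1" "dual_sequence_exact p T2"
  using T1 T2 dual_sequence_exact_if_pro_p_tree[OF prime] by (auto simp: G_tree_def)

lemma spaces: "compact_space X1" "compact_space X2" "Hausdorff_space X1" "Hausdorff_space X2"
  using graphs by (simp_all add: profinite_graph_def profinite_space_def)

lemma verts_in: "verts T1 \<subseteq> topspace X1" "verts T2 \<subseteq> topspace X2"
  by (rule verts_subset[OF graphs(1)], rule verts_subset[OF graphs(2)])

lemma edges_in: "edges T1 \<subseteq> topspace X1" "edges T2 \<subseteq> topspace X2"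
  by (simp_all add: edges_def)

lemma closed_verts: "closedin X1 (verts T1)" "closedin X2 (verts T2)"
  using graphs by (simp_all add: profinite_graph_def)

lemma d_vertex:
  "v \<in> verts T1 \<Longrightarrow> d0 T1 v = v" "v \<in> verts T1 \<Longrightarrow> d1 T1 v = v"
  "x \<in> verts T2 \<Longrightarrow> d0 T2 x = x" "x \<in> verts T2 \<Longrightarrow> d1 T2 x = x"
  using graphs by (simp_all add: profinite_graph_def)

lemma closed_blocks: "closedin (prod_topology X1 X2) blocks"
  unfolding blocks_def closedin_prod_Times_iff using closed_verts(1) by simp

lemma closed_points: "closedin (prod_topology X1 X2) points"
  unfolding points_def by (rule closedin_Un[OF closed_blocks F_closed])

lemma points_subset: "points \<subseteq> topspace X1 \<times> topspace X2"
  using closedin_subset[OF closed_points] by simp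

lemma point_components: "z \<in> points \<Longrightarrow> fst z \<in> topspace X1 \<and> snd z \<in> topspace X2"
  using points_subset by auto

lemma topspace_blowup: "topspace (gspace blowup) = points"
  using points_subset by (simp add: blowup_def Int_absorb1)

lemma F_edge: "(e, x) \<in> F \<Longrightarrow> e \<in> edges T1" "(e, x) \<in> F \<Longrightarrow> x \<in> verts T2"
  using F_subset by auto

lemma blowup_simps:
  "verts blowup = verts T1 \<times> verts T2"
  "d0 blowup z = (d0 T1 (fst z), d0 T2 (snd z))"
  "d1 blowup z = (d1 T1 (fst z), d1 T2 (snd z))"
  "z \<in> points \<Longrightarrow> act blowup g z = (act T1 g (fst z), act T2 g (snd z))"
  "gspace blowup = subtopology (prod_topology X1 X2) points"
  by (simp_all add: blowup_def)

lemma verts_blowup_subset: "verts T1 \<times> verts T2 \<subseteq> points"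
  using verts_in by (auto simp: points_def blocks_def)

lemma edges_blowup: "edges blowup = verts T1 \<times> edges T2 \<union> F"
proof (rule Set.set_eqI)
  fix z :: "'a \<times> 'b"
  obtain a b where z: "z = (a, b)" by (cases z)
  have "(a, b) \<in> F \<Longrightarrow> a \<notin> verts T1" using F_edge(1) by (auto simp: edges_def)
  then show "z \<in> edges blowup \<longleftrightarrow> z \<in> verts T1 \<times> edges T2 \<union> F"
    unfolding edges_def[of blowup] topspace_blowup z points_def blocks_def
    by (auto simp: edges_def blowup_simps)
qed

lemma profinite_graph_blowup: "profinite_graph blowup"
proof -
  have compact: "compact_space (gspace blowup)"
    unfolding blowup_simps
    by (intro compact_space_subtopology closedin_compact_space closed_points)
      (simp add: compact_space_prod_topology spaces)
  have hausdorff: "Hausdorff_space (gspace blowup)"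
    unfolding blowup_simps
    by (intro Hausdorff_space_subtopology) (simp add: Hausdorff_space_prod_topology spaces)
  have tot: "\<exists>z. S \<subseteq> {z}" if S: "connectedin (gspace blowup) S" for S
  proof -
    have S': "connectedin (prod_topology X1 X2) S"
      using S by (simp add: blowup_simps connectedin_subtopology)
    have "connectedin X1 (fst ` S)" "connectedin X2 (snd ` S)"
      by (rule connectedin_continuous_map_image[OF continuous_map_fst S'],
          rule connectedin_continuous_map_image[OF continuous_map_snd S'])
    then obtain a b where "fst ` S \<subseteq> {a}" "snd ` S \<subseteq> {b}"
      using graphs unfolding profinite_graph_def profinite_space_def by meson
    then have "S \<subseteq> {(a, b)}" by force
    then show ?thesis by blast
  qed
  have cont: "continuous_map (gspace blowup) (subtopology (gspace blowup) (verts blowup))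
      (\<lambda>z. (f (fst z), g (snd z)))"
    if f: "continuous_map X1 (subtopology X1 (verts T1)) f" and g: "continuous_map X2 (subtopology X2 (verts T2)) g"
    for f g
  proof -
    have f': "continuous_map X1 X1 f" "f \<in> topspace X1 \<rightarrow> verts T1"
      and g': "continuous_map X2 X2 g" "g \<in> topspace X2 \<rightarrow> verts T2"
      using f g by (simp_all add: continuous_map_in_subtopology image_subset_iff_funcset)
    have "continuous_map (prod_topology X1 X2) (prod_topology X1 X2) (\<lambda>z. (f (fst z), g (snd z)))"
      using continuous_map_compose[OF continuous_map_fst[of X1 X2] f'(1)]
        continuous_map_compose[OF continuous_map_snd[of X1 X2] g'(1)]
      by (simp add: continuous_map_pairwise o_def)
    then have "continuous_map (gspace blowup) (prod_topology X1 X2) (\<lambda>z. (f (fst z), g (snd z)))"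
      unfolding blowup_simps by (rule continuous_map_from_subtopology)
    moreover have "(f (fst z), g (snd z)) \<in> verts T1 \<times> verts T2" if "z \<in> points" for z
      using point_components[OF that] f'(2) g'(2) by (auto simp: Pi_iff)
    ultimately show ?thesis
      using verts_blowup_subset points_subset
      by (auto simp: blowup_simps continuous_map_in_subtopology subtopology_subtopology)
  qed
  have "closedin (gspace blowup) (verts blowup)"
    unfolding blowup_simps
  proof (rule closedin_subset_topspace)
    show "closedin (prod_topology X1 X2) (verts T1 \<times> verts T2)"
      unfolding closedin_prod_Times_iff using closed_verts by simp
  qed (rule verts_blowup_subset)
  moreover have "continuous_map (gspace blowup) (subtopology (gspace blowup) (verts blowup)) (d0 blowup)"
    "continuous_map (gspace blowup) (subtopology (gspace blowup) (verts blowup)) (d1 blowup)"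
    using cont[of "d0 T1" "d0 T2"] cont[of "d1 T1" "d1 T2"] graphs
    by (simp_all add: blowup_def profinite_graph_def)
  ultimately show ?thesis
    using compact hausdorff tot
    by (auto simp: profinite_graph_def profinite_space_def blowup_simps d_vertex)
qed

lemma vertex_space_blowup:
  "vertex_space blowup = prod_topology (vertex_space T1) (vertex_space T2)"
  using verts_blowup_subset
  by (simp add: vertex_space_def blowup_simps subtopology_subtopology Int_absorb1 flip: subtopology_Times)

lemma topspace_vertex_spaces:
  "topspace (vertex_space T1) = verts T1" "topspace (vertex_space T2) = verts T2"
  by (rule topspace_vertex_space[OF graphs(1)], rule topspace_vertex_space[OF graphs(2)])

lemma continuous_vertex_slice:
  assumes "v \<in> verts T1"
  shows "continuous_map (vertex_space T2) (vertex_space blowup) (\<lambda>x. (v, x))"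
  unfolding vertex_space_blowup using assms
  by (simp add: continuous_map_pairwise o_def topspace_vertex_spaces)

text \<open>The function is constant on each copy of \<open>T2\<close>, and the edges in \<open>F\<close> relate the values on the copies at
  the two ends of an edge of \<open>T1\<close>.\<close>

lemma blowup_cocycle_constant:
  assumes f: "locally_constant (vertex_space blowup) f"
    and eq: "\<And>z. z \<in> edges blowup \<Longrightarrow> [f (d1 blowup z) = f (d0 blowup z)] (mod int p)"
    and v: "v \<in> verts T1" "x \<in> verts T2" and w: "w \<in> verts T1" "y \<in> verts T2"
  shows "[f (v, x) = f (w, y)] (mod int p)"
proof -
  have slice: "[f (u, a) = f (u, b)] (mod int p)" if u: "u \<in> verts T1" and ab: "a \<in> verts T2" "b \<in> verts T2" for u a b
  proof -
    have "locally_constant (vertex_space T2) (\<lambda>x. f (u, x))"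
      by (rule locally_constant_comp[OF continuous_vertex_slice[OF u] f])
    moreover have "\<forall>e\<in>edges T2. [f (u, d1 T2 e) = f (u, d0 T2 e)] (mod int p)"
    proof
      fix e assume "e \<in> edges T2"
      then have "(u, e) \<in> edges blowup" using u by (simp add: edges_blowup)
      from eq[OF this] show "[f (u, d1 T2 e) = f (u, d0 T2 e)] (mod int p)"
        using u by (simp add: blowup_simps d_vertex)
    qed
    ultimately have "\<forall>a\<in>verts T2. \<forall>b\<in>verts T2. [f (u, a) = f (u, b)] (mod int p)"
      using duals(2) unfolding dual_sequence_exact_def by blast
    then show ?thesis using ab by blast
  qed
  have "continuous_map (vertex_space T1) (vertex_space blowup) (\<lambda>u. (u, y))"
    unfolding vertex_space_blowup using w(2)
    by (simp add: continuous_map_pairwise o_def topspace_vertex_spaces)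
  then have g: "locally_constant (vertex_space T1) (\<lambda>u. f (u, y))"
    by (rule locally_constant_comp[OF _ f])
  moreover have "\<forall>e\<in>edges T1. [f (d1 T1 e, y) = f (d0 T1 e, y)] (mod int p)"
  proof
    fix e assume e: "e \<in> edges T1"
    obtain a where a: "(e, a) \<in> F" using F_ex[OF e] by (rule exE)
    have a2: "a \<in> verts T2" by (rule F_edge(2)[OF a])
    have d: "d0 T1 e \<in> verts T1" "d1 T1 e \<in> verts T1"
      using d_in_verts[OF graphs(1)] e edges_in(1) by auto
    have "[f (d1 T1 e, y) = f (d1 T1 e, a)] (mod int p)" by (rule slice[OF d(2) w(2) a2])
    also have "[f (d1 T1 e, a) = f (d0 T1 e, a)] (mod int p)"
      using eq[of "(e, a)"] a by (simp add: edges_blowup blowup_simps d_vertex a2)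
    also have "[f (d0 T1 e, a) = f (d0 T1 e, y)] (mod int p)" by (rule slice[OF d(1) a2 w(2)])
    finally show "[f (d1 T1 e, y) = f (d0 T1 e, y)] (mod int p)" .
  qed
  ultimately have "\<forall>v\<in>verts T1. \<forall>w\<in>verts T1. [f (v, y) = f (w, y)] (mod int p)"
    using duals(1) unfolding dual_sequence_exact_def by blast
  then have "[f (v, y) = f (w, y)] (mod int p)" using v(1) w(1) by blast
  then show ?thesis using slice[OF v(1) v(2) w(2)] by (rule cong_trans[rotated])
qed

text \<open>The copies of \<open>T2\<close> are treated first. Choosing the primitive as a function of the section
  \<open>sec v\<close> alone makes it locally constant in \<open>v\<close>, without any uniformity in the
  surjectivity of the coboundary of \<open>T2\<close>.\<close>

lemma blowup_primitive:
  assumes h: "test_function p (gspace blowup) (verts blowup) h"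
  shows "\<exists>f. locally_constant (vertex_space blowup) f \<and>
    (\<forall>z\<in>edges blowup. [h z = f (d1 blowup z) - f (d0 blowup z)] (mod int p))"
proof -
  have lh: "locally_constant (subtopology (prod_topology X1 X2) points) h"
    using h by (simp add: test_function_def blowup_simps)
  have h0: "int p dvd h (v, x)" if "v \<in> verts T1" "x \<in> verts T2" for v x
    using h that by (simp add: test_function_def blowup_simps)
  have prim2: "\<exists>f. locally_constant (vertex_space T2) f \<and>
      (\<forall>e\<in>edges T2. [k e = f (d1 T2 e) - f (d0 T2 e)] (mod int p))"
    if "test_function p X2 (verts T2) k" for k
    using duals(2) that unfolding dual_sequence_exact_def by blast
  \<comment> \<open>solve the problem on the copy of \<open>T2\<close> at each vertex of \<open>T1\<close>\<close>
  have blocks_top: "prod_topology (vertex_space T1) X2 = subtopology (prod_topology X1 X2) blocks"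
    by (simp add: vertex_space_def blocks_def prod_topology_subtopology)
  have blocks_h: "locally_constant (prod_topology (vertex_space T1) X2) h"
    using lh continuous_map_from_subtopology_mono[of "prod_topology X1 X2" points "discrete_topology UNIV" h blocks]
    unfolding blocks_top locally_constant_def by (simp add: points_def)
  define sec where "sec v = (\<lambda>y. if y \<in> topspace X2 then h (v, y) else 0)" for v
  have sec_test: "test_function p X2 (verts T2) (sec v)" if v: "v \<in> verts T1" for v
  proof -
    have "continuous_map X2 (prod_topology (vertex_space T1) X2) (\<lambda>y. (v, y))"
      using v by (simp add: continuous_map_pairwise o_def topspace_vertex_spaces)
    then have "locally_constant X2 (\<lambda>y. h (v, y))" by (rule locally_constant_comp[OF _ blocks_h])
    then have "locally_constant X2 (sec v)"
      unfolding locally_constant_def by (rule continuous_map_eq) (simp add: sec_def)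
    then show ?thesis using h0[OF v] verts_in(2) by (auto simp: test_function_def sec_def)
  qed
  define choice where "choice k = (SOME f. locally_constant (vertex_space T2) f \<and>
      (\<forall>e\<in>edges T2. [k e = f (d1 T2 e) - f (d0 T2 e)] (mod int p)))" for k
  have choice: "locally_constant (vertex_space T2) (choice (sec v))"
    "\<And>e. e \<in> edges T2 \<Longrightarrow> [sec v e = choice (sec v) (d1 T2 e) - choice (sec v) (d0 T2 e)] (mod int p)"
    if v: "v \<in> verts T1" for v
    using someI_ex[OF prim2[OF sec_test[OF v]]] unfolding choice_def by simp_all
  define f1 where "f1 z = choice (sec (fst z)) (snd z)" for z
  have f1: "locally_constant (vertex_space blowup) f1"
    unfolding vertex_space_blowup
  proof (rule locally_constant_prod)
    fix v assume "v \<in> topspace (vertex_space T1)"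
    then have v: "v \<in> verts T1" by (simp add: topspace_vertex_spaces)
    let ?U = "{v' \<in> topspace (vertex_space T1). \<forall>y\<in>topspace X2. h (v', y) = h (v, y)}"
    have "openin (vertex_space T1) ?U"
      using v by (intro openin_same_section[OF spaces(2) blocks_h]) (simp add: topspace_vertex_spaces)
    moreover have "v \<in> ?U" using v by (simp add: topspace_vertex_spaces)
    moreover have "\<forall>v'\<in>?U. \<forall>y\<in>topspace (vertex_space T2). f1 (v', y) = choice (sec v) y"
    proof (intro ballI)
      fix v' y assume "v' \<in> ?U"
      then have "sec v' = sec v" by (auto simp: sec_def fun_eq_iff)
      then show "f1 (v', y) = choice (sec v) y" by (simp add: f1_def)
    qed
    ultimately show "\<exists>U g. openin (vertex_space T1) U \<and> v \<in> U \<and> locally_constant (vertex_space T2) g \<and>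
        (\<forall>x'\<in>U. \<forall>y\<in>topspace (vertex_space T2). f1 (x', y) = g y)"
      using choice(1)[OF v] by (intro exI conjI)
  qed
  \<comment> \<open>the error \<open>H\<close> vanishes modulo \<open>p\<close> on the copies of \<open>T2\<close>, so it is a function on the edges of \<open>T1\<close>\<close>
  define H where "H z = h z - (f1 (d1 blowup z) - f1 (d0 blowup z))" for z
  have "continuous_map (gspace blowup) (vertex_space blowup) (d0 blowup)"
    "continuous_map (gspace blowup) (vertex_space blowup) (d1 blowup)"
    using profinite_graph_blowup by (simp_all add: profinite_graph_def vertex_space_def)
  then have diff: "locally_constant (gspace blowup) (\<lambda>z. f1 (d1 blowup z) - f1 (d0 blowup z))"
    by (intro locally_constant_comp2[where F = "(-)"]) (rule locally_constant_comp[OF _ f1], assumption)+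
  then have lH: "locally_constant (subtopology (prod_topology X1 X2) points) H"
    using locally_constant_comp2[OF lh diff[unfolded blowup_simps(5)], where F = "(-)"]
    by (simp add: H_def[abs_def])
  define \<phi> where "\<phi> e = (THE x. (e, x) \<in> F)" for e
  have \<phi>: "\<phi> e = x" if "(e, x) \<in> F" for e x
    unfolding \<phi>_def using that F_unique by (intro the_equality)
  define k where "k a = (if a \<in> edges T1 then H (a, \<phi> a) else 0)" for a
  \<comment> \<open>\<open>k\<close> is continuous because the projection of closed sets from \<open>F\<close> to \<open>T1\<close> is closed\<close>
  have "closedin X1 {a \<in> topspace X1. k a \<in> K}" for K
  proof -
    have "topspace (subtopology (prod_topology X1 X2) points) = points"
      using points_subset by (simp add: Int_absorb1)
    then have "closedin (subtopology (prod_topology X1 X2) points) {z \<in> points. H z \<in> K}"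
      using closedin_locally_constant_fiber[OF lH, of K] by (simp only:)
    then have "closedin (prod_topology X1 X2) {z \<in> points. H z \<in> K}"
      by (rule closedin_trans_full[OF _ closed_points])
    then have "closedin (prod_topology X1 X2) ({z \<in> points. H z \<in> K} \<inter> F)"
      using F_closed by (rule closedin_Int)
    then have 1: "closedin X1 (fst ` ({z \<in> points. H z \<in> K} \<inter> F))"
      using Abstract_Topological_Spaces.closed_map_fst[OF spaces(2), of X1] unfolding closed_map_def by blast
    have "{a \<in> topspace X1. k a \<in> K} = fst ` ({z \<in> points. H z \<in> K} \<inter> F) \<union> (if 0 \<in> K then verts T1 else {})"
    proof (rule Set.set_eqI)
      fix a
      have edge: "a \<in> edges T1 \<longleftrightarrow> a \<in> topspace X1 \<and> a \<notin> verts T1" by (simp add: edges_def)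
      show "a \<in> {a \<in> topspace X1. k a \<in> K} \<longleftrightarrow> a \<in> fst ` ({z \<in> points. H z \<in> K} \<inter> F) \<union> (if 0 \<in> K then verts T1 else {})"
      proof (cases "a \<in> edges T1")
        case True
        obtain x where x: "(a, x) \<in> F" using F_ex[OF True] by (rule exE)
        have "a \<in> fst ` ({z \<in> points. H z \<in> K} \<inter> F) \<longleftrightarrow> H (a, x) \<in> K"
        proof
          assume "a \<in> fst ` ({z \<in> points. H z \<in> K} \<inter> F)"
          then obtain y where "(a, y) \<in> F" "H (a, y) \<in> K" by auto
          then show "H (a, x) \<in> K" using F_unique[OF x] by blast
        next
          assume "H (a, x) \<in> K"
          then show "a \<in> fst ` ({z \<in> points. H z \<in> K} \<inter> F)"
            using x by (intro image_eqI[of _ _ "(a, x)"]) (simp_all add: points_def)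
        qed
        then show ?thesis using True edge by (simp add: k_def \<phi>[OF x])
      next
        case False
        then have "a \<notin> fst ` ({z \<in> points. H z \<in> K} \<inter> F)" using F_edge(1) by auto
        then show ?thesis using False edge verts_in(1) by (auto simp: k_def)
      qed
    qed
    then show ?thesis using 1 closed_verts(1) by (auto intro: closedin_Un)
  qed
  then have "locally_constant X1 k" by (rule locally_constant_if_fibers_closed)
  moreover have "k v = 0" if "v \<in> verts T1" for v using that by (simp add: k_def edges_def)
  ultimately have "test_function p X1 (verts T1) k" by (simp add: test_function_def)
  then obtain f2 where f2: "locally_constant (vertex_space T1) f2"
    "\<forall>e\<in>edges T1. [k e = f2 (d1 T1 e) - f2 (d0 T1 e)] (mod int p)"
    using duals(1) unfolding dual_sequence_exact_def by blast
  define f where "f z = f1 z + f2 (fst z)" for z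
  have "continuous_map (vertex_space blowup) (vertex_space T1) fst"
    unfolding vertex_space_blowup by (rule continuous_map_fst)
  then have "locally_constant (vertex_space blowup) (\<lambda>z. f2 (fst z))"
    by (rule locally_constant_comp[OF _ f2(1)])
  then have f: "locally_constant (vertex_space blowup) f"
    unfolding f_def[abs_def] by (rule locally_constant_comp2[where F = "(+)", OF f1])
  have "[h z = f (d1 blowup z) - f (d0 blowup z)] (mod int p)" if z: "z \<in> edges blowup" for z
  proof -
    obtain a b where ab: "z = (a, b)" by (cases z)
    consider "a \<in> verts T1" "b \<in> edges T2" | "(a, b) \<in> F"
      using z unfolding edges_blowup ab by auto
    then show ?thesis
    proof cases
      case 1
      have "h (a, b) = sec a b" using 1(2) edges_in(2) by (auto simp: sec_def)
      then show ?thesis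
        using choice(2)[OF 1] 1(1) by (simp add: ab f_def f1_def blowup_simps d_vertex)
    next
      case 2
      have "[H (a, b) = f2 (d1 T1 a) - f2 (d0 T1 a)] (mod int p)"
        using bspec[OF f2(2) F_edge(1)[OF 2]] F_edge(1)[OF 2] by (simp add: k_def \<phi>[OF 2])
      then have "[H z + (f1 (d1 blowup z) - f1 (d0 blowup z)) =
          f2 (d1 T1 a) - f2 (d0 T1 a) + (f1 (d1 blowup z) - f1 (d0 blowup z))] (mod int p)"
        unfolding ab by (rule cong_add[OF _ cong_refl])
      then show ?thesis by (simp add: H_def f_def ab blowup_simps algebra_simps)
    qed
  qed
  then show ?thesis using f by (intro exI[of _ f] conjI ballI)
qed

lemma pro_p_tree_blowup: "pro_p_tree p blowup"
proof (rule pro_p_tree_if_dual_sequence_exact[OF prime profinite_graph_blowup])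
  show "dual_sequence_exact p blowup"
    unfolding dual_sequence_exact_def
  proof (intro conjI allI impI ballI)
    show "verts blowup \<noteq> {}" using duals by (simp add: dual_sequence_exact_def blowup_simps)
  next
    fix f v w
    assume f: "locally_constant (vertex_space blowup) f"
      "\<forall>e\<in>edges blowup. [f (d1 blowup e) = f (d0 blowup e)] (mod int p)"
      and vw: "v \<in> verts blowup" "w \<in> verts blowup"
    obtain v1 v2 w1 w2 where "v = (v1, v2)" "w = (w1, w2)" by (cases v, cases w)
    then show "[f v = f w] (mod int p)"
      using blowup_cocycle_constant[OF f(1) bspec[OF f(2)]] vw by (simp add: blowup_simps)
  next
    fix h assume "test_function p (gspace blowup) (verts blowup) h"
    then show "\<exists>f. locally_constant (vertex_space blowup) f \<and>
        (\<forall>z\<in>edges blowup. [h z = f (d1 blowup z) - f (d0 blowup z)] (mod int p))"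
      by (rule blowup_primitive)
  qed
qed

lemma act_points:
  assumes g: "g \<in> carrier G" and z: "z \<in> points"
  shows "(act T1 g (fst z), act T2 g (snd z)) \<in> points"
proof -
  obtain a b where ab: "z = (a, b)" by (cases z)
  consider "a \<in> verts T1" "b \<in> topspace X2" | "(a, b) \<in> F"
    using z unfolding ab points_def blocks_def by auto
  then show ?thesis
  proof cases
    case 1
    then show ?thesis
      using act_verts[OF graphs(1) actions(1) g] act_in_topspace[OF actions(2) g]
      by (simp add: ab points_def blocks_def)
  next
    case 2
    then show ?thesis using F_act[OF g] by (simp add: ab points_def)
  qed
qed

lemma group_action_blowup: "group_action G points (act blowup)"
proof -
  interpret G: group G by (rule group)
  have act: "act blowup g z = (act T1 g (fst z), act T2 g (snd z))" if "z \<in> points" for g z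
    using that by (rule blowup_simps(4))
  have pt: "act blowup g z \<in> points" if "g \<in> carrier G" "z \<in> points" for g z
    using act_points[OF that] act[OF that(2)] by simp
  have mult: "act blowup (g \<otimes>\<^bsub>G\<^esub> h) z = act blowup g (act blowup h z)"
    if gh: "g \<in> carrier G" "h \<in> carrier G" and z: "z \<in> points" for g h z
    using act_mult[OF actions(1) gh] act_mult[OF actions(2) gh] point_components[OF z] act_points[OF gh(2) z]
    by (simp add: act z)
  have inv: "act blowup (inv\<^bsub>G\<^esub> g) (act blowup g z) = z" if g: "g \<in> carrier G" and z: "z \<in> points" for g z
    using act_inv[OF actions(1) g] act_inv[OF actions(2) g] point_components[OF z] act_points[OF g z]
    by (simp add: act z)
  have Bij: "act blowup g \<in> Bij points" if g: "g \<in> carrier G" for g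
    unfolding Bij_def
  proof (intro IntI CollectI)
    show "act blowup g \<in> extensional points" by (simp add: blowup_def)
    show "bij_betw (act blowup g) points points"
    proof (rule bij_betwI[where g = "act blowup (inv\<^bsub>G\<^esub> g)"])
      show "act blowup g (act blowup (inv\<^bsub>G\<^esub> g) z) = z" if "z \<in> points" for z
        using inv[OF G.inv_closed[OF g] that] g by simp
    qed (use pt inv g in auto)
  qed
  have "act blowup (g \<otimes>\<^bsub>G\<^esub> h) = compose points (act blowup g) (act blowup h)"
    if gh: "g \<in> carrier G" "h \<in> carrier G" for g h
  proof (rule extensionalityI[of _ points])
    show "act blowup (g \<otimes>\<^bsub>G\<^esub> h) \<in> extensional points" by (simp add: blowup_def)
    show "compose points (act blowup g) (act blowup h) \<in> extensional points" by (rule compose_extensional)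
    show "act blowup (g \<otimes>\<^bsub>G\<^esub> h) z = compose points (act blowup g) (act blowup h) z" if "z \<in> points" for z
      using mult[OF gh that] that by (simp add: compose_def)
  qed
  then have "act blowup \<in> hom G (BijGroup points)"
    using Bij by (auto simp: hom_def BijGroup_def)
  then show ?thesis
    by (simp add: group_action_def group_hom_def group_hom_axioms_def group group_BijGroup)
qed

lemma graph_action_blowup: "graph_action G blowup"
proof -
  let ?Y = "prod_topology (gtop G) (gspace blowup)"
  have fstc: "continuous_map ?Y (gtop G) fst" by (rule continuous_map_fst)
  have sndc: "continuous_map ?Y (prod_topology X1 X2) snd"
    using continuous_map_snd[of "gtop G" "gspace blowup"] unfolding blowup_simps
    by (rule continuous_map_into_fulltopology)
  have c1: "continuous_map ?Y X1 (\<lambda>y. fst (snd y))" and c2: "continuous_map ?Y X2 (\<lambda>y. snd (snd y))"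
    using continuous_map_compose[OF sndc continuous_map_fst] continuous_map_compose[OF sndc continuous_map_snd]
    by (simp_all add: o_def)
  have "continuous_map ?Y (prod_topology (gtop G) X1) (\<lambda>y. (fst y, fst (snd y)))"
    "continuous_map ?Y (prod_topology (gtop G) X2) (\<lambda>y. (fst y, snd (snd y)))"
    using fstc c1 c2 by (simp_all add: continuous_map_pairwise o_def)
  moreover have "continuous_map (prod_topology (gtop G) X1) X1 (\<lambda>(g, x). act T1 g x)"
    "continuous_map (prod_topology (gtop G) X2) X2 (\<lambda>(g, x). act T2 g x)"
    using actions by (simp_all add: graph_action_def)
  ultimately have a: "continuous_map ?Y X1 (\<lambda>y. act T1 (fst y) (fst (snd y)))"
    "continuous_map ?Y X2 (\<lambda>y. act T2 (fst y) (snd (snd y)))"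
    using continuous_map_compose[of ?Y "prod_topology (gtop G) X1" "\<lambda>y. (fst y, fst (snd y))" X1 "\<lambda>(g, x). act T1 g x"]
      continuous_map_compose[of ?Y "prod_topology (gtop G) X2" "\<lambda>y. (fst y, snd (snd y))" X2 "\<lambda>(g, x). act T2 g x"]
    by (simp_all add: o_def)
  have "continuous_map ?Y (prod_topology X1 X2) (\<lambda>y. (act T1 (fst y) (fst (snd y)), act T2 (fst y) (snd (snd y))))"
    using a by (simp add: continuous_map_pairwise o_def)
  then have full: "continuous_map ?Y (prod_topology X1 X2) (\<lambda>(g, z). act blowup g z)"
    by (rule continuous_map_eq) (auto simp: topspace_blowup blowup_simps(4))
  have act: "act blowup g z = (act T1 g (fst z), act T2 g (snd z))" if "z \<in> points" for g z
    using that by (rule blowup_simps(4))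
  have img: "(\<lambda>(g, z). act blowup g z) \<in> topspace ?Y \<rightarrow> points"
    using act_points by (auto simp: topspace_blowup gtop act)
  have cont: "continuous_map ?Y (gspace blowup) (\<lambda>(g, z). act blowup g z)"
    by (subst (2) blowup_simps(5)) (rule continuous_map_into_subtopology[OF full img])
  have d: "d0 blowup (act blowup g z) = act blowup g (d0 blowup z) \<and> d1 blowup (act blowup g z) = act blowup g (d1 blowup z)"
    if g: "g \<in> carrier G" and z: "z \<in> points" for g z
  proof -
    have "d0 blowup z \<in> points" "d1 blowup z \<in> points"
      using d_in_verts[OF profinite_graph_blowup, of z] z verts_blowup_subset
      by (auto simp: topspace_blowup blowup_simps(1))
    then show ?thesis
      using act_d[OF actions(1) g] act_d[OF actions(2) g] point_components[OF z]
      by (simp add: act z blowup_simps(2,3))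
  qed
  show ?thesis
    unfolding graph_action_def topspace_blowup using group_action_blowup cont d by simp
qed

lemma G_tree_blowup: "G_tree p G blowup"
  using pro_p_tree_blowup graph_action_blowup by (simp add: G_tree_def)

lemma fst_surjective: "fst ` points = topspace X1"
proof
  show "fst ` points \<subseteq> topspace X1" using point_components by auto
  show "topspace X1 \<subseteq> fst ` points"
  proof
    fix a assume a: "a \<in> topspace X1"
    obtain b where b: "b \<in> verts T2" using duals(2) by (auto simp: dual_sequence_exact_def)
    show "a \<in> fst ` points"
    proof (cases "a \<in> verts T1")
      case True
      then have "(a, b) \<in> points" using b verts_in(2) by (auto simp: points_def blocks_def)
      then show ?thesis by (rule image_eqI[rotated]) simp
    next
      case False
      then obtain x where "(a, x) \<in> F" using a F_ex by (auto simp: edges_def)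
      then have "(a, x) \<in> points" by (simp add: points_def)
      then show ?thesis by (rule image_eqI[rotated]) simp
    qed
  qed
qed

lemma continuous_fst_blowup: "continuous_map (gspace blowup) X1 fst"
  unfolding blowup_simps by (rule continuous_map_from_subtopology[OF continuous_map_fst])

lemma G_morphism_fst: "G_morphism G blowup T1 fst"
  using continuous_fst_blowup
  by (simp add: G_morphism_def graph_morphism_def topspace_blowup blowup_simps(2-4))

lemma quotient_map_fst: "quotient_map (gspace blowup) X1 fst"
proof (rule continuous_imp_quotient_map[OF continuous_fst_blowup])
  show "compact_space (gspace blowup)"
    using profinite_graph_blowup by (simp add: profinite_graph_def profinite_space_def)
qed (simp_all add: spaces topspace_blowup fst_surjective)

definition block :: "'a \<Rightarrow> ('a \<times> 'b) set" where
  "block v = {v} \<times> topspace X2"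

lemma block_subset_blocks: "v \<in> verts T1 \<Longrightarrow> block v \<subseteq> blocks"
  by (auto simp: block_def blocks_def)

lemma blocks_subset_points: "blocks \<subseteq> points"
  by (simp add: points_def)

lemma subgraph_blocks: "subgraph blocks blowup"
  unfolding subgraph_def
proof (intro conjI)
  show "closedin (gspace blowup) blocks"
    unfolding blowup_simps by (rule closedin_subset_topspace[OF closed_blocks blocks_subset_points])
  show "d0 blowup ` blocks \<subseteq> blocks" "d1 blowup ` blocks \<subseteq> blocks"
    using d_in_verts[OF graphs(2)] verts_in(2) by (auto simp: blocks_def blowup_simps(2,3) d_vertex)
qed

lemma subgraph_block:
  assumes v: "v \<in> verts T1"
  shows "subgraph (block v) blowup"
  unfolding subgraph_def
proof (intro conjI)
  have "closedin X1 {v}" using v verts_in(1) spaces(3) by (auto simp: closedin_Hausdorff_singleton)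
  then have "closedin (prod_topology X1 X2) (block v)"
    unfolding block_def closedin_prod_Times_iff by simp
  moreover have "block v \<subseteq> points" using block_subset_blocks[OF v] blocks_subset_points by (rule subset_trans)
  ultimately show "closedin (gspace blowup) (block v)"
    unfolding blowup_simps by (rule closedin_subset_topspace)
  show "d0 blowup ` block v \<subseteq> block v" "d1 blowup ` block v \<subseteq> block v"
    using d_in_verts[OF graphs(2)] verts_in(2) v by (auto simp: block_def blowup_simps(2,3) d_vertex)
qed

lemma connected_block:
  assumes v: "v \<in> verts T1"
  shows "pgraph_connected (restrict_graph blowup (block v))"
  unfolding pgraph_connected_def
proof (intro allI impI, elim conjE)
  fix Q :: "nat pgraph" and q
  let ?B = "restrict_graph blowup (block v)" and ?i = "\<lambda>y. (v, y)"
  assume Q: "finite_graph Q" and q: "graph_morphism ?B Q q" and surj: "q ` topspace (gspace ?B) = topspace (gspace Q)"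
  have block: "block v \<subseteq> points" using block_subset_blocks[OF v] blocks_subset_points by (rule subset_trans)
  have top: "topspace (gspace ?B) = block v"
    using block by (simp add: restrict_graph_def topspace_blowup Int_absorb1)
  have gs: "gspace ?B = subtopology (prod_topology X1 X2) (block v)"
    using block by (simp add: restrict_graph_def blowup_simps(5) subtopology_subtopology Int_absorb1)
  have v1: "v \<in> topspace X1" using v verts_in(1) by blast
  have "continuous_map X2 (prod_topology X1 X2) ?i"
    using v1 by (simp add: continuous_map_pairwise o_def)
  then have i: "continuous_map X2 (gspace ?B) ?i"
    unfolding gs by (rule continuous_map_into_subtopology) (simp add: block_def)
  have ib: "?i ` topspace X2 = block v" by (auto simp: block_def)
  have "graph_morphism T2 Q (\<lambda>y. q (v, y))"
    unfolding graph_morphism_def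
  proof (intro conjI ballI)
    show "continuous_map X2 (gspace Q) (\<lambda>y. q (v, y))"
      using continuous_map_compose[OF i, of "gspace Q" q] q by (simp add: graph_morphism_def o_def)
    fix y assume y: "y \<in> topspace X2"
    then have "(v, y) \<in> topspace (gspace ?B)" unfolding top by (simp add: block_def)
    then have "q (d0 ?B (v, y)) = d0 Q (q (v, y))" "q (d1 ?B (v, y)) = d1 Q (q (v, y))"
      using q by (simp_all add: graph_morphism_def)
    then show "q (v, d0 T2 y) = d0 Q (q (v, y))" "q (v, d1 T2 y) = d1 Q (q (v, y))"
      by (simp_all add: restrict_graph_def blowup_simps(2,3) d_vertex v)
  qed
  moreover have "(\<lambda>y. q (v, y)) ` topspace X2 = topspace (gspace Q)"
  proof -
    have "(\<lambda>y. q (v, y)) ` topspace X2 = q ` ?i ` topspace X2" by (simp add: image_image)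
    also have "\<dots> = q ` topspace (gspace ?B)" unfolding ib top ..
    finally show ?thesis using surj by (rule trans)
  qed
  ultimately show "finite_graph_connected Q"
    using connected_if_dual_sequence_exact[OF p_gt_1 graphs(2) duals(2)] Q unfolding pgraph_connected_def by blast
qed

text \<open>The first projection identifies the ends of every edge of the subgraph \<open>blocks\<close>.\<close>

lemma connected_subgraph_in_block:
  assumes C: "connected_subgraph C blowup" "C \<subseteq> blocks" and z: "z \<in> C" and w: "w \<in> C"
  shows "fst z = fst w"
proof (rule edgeless_image_of_connected_graph[where \<Gamma> = "restrict_graph blowup C" and X = X1])
  have C': "C \<subseteq> points" using C(2) blocks_subset_points by (rule subset_trans)
  have top: "topspace (gspace (restrict_graph blowup C)) = C"
    using C' by (simp add: restrict_graph_def topspace_blowup Int_absorb1)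
  show "profinite_space X1" using graphs(1) by (simp add: profinite_graph_def)
  show "pgraph_connected (restrict_graph blowup C)" using C(1) by (simp add: connected_subgraph_def)
  show "continuous_map (gspace (restrict_graph blowup C)) X1 fst"
    using continuous_map_from_subtopology[OF continuous_fst_blowup] by (simp add: restrict_graph_def)
  show "z \<in> topspace (gspace (restrict_graph blowup C))" "w \<in> topspace (gspace (restrict_graph blowup C))"
    using z w by (simp_all add: top)
  fix u assume "u \<in> topspace (gspace (restrict_graph blowup C))"
  then have "fst u \<in> verts T1" using C(2) by (auto simp: top blocks_def)
  then show "fst (d0 (restrict_graph blowup C) u) = fst u \<and> fst (d1 (restrict_graph blowup C) u) = fst u"
    by (simp add: restrict_graph_def blowup_simps(2,3) d_vertex)
qed

lemma block_component:
  assumes v: "v \<in> verts T1"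
  shows "block v \<in> graph_components blowup blocks"
  unfolding graph_components_def
proof (intro CollectI conjI allI impI)
  obtain b where "b \<in> verts T2" using duals(2) by (auto simp: dual_sequence_exact_def)
  then have b: "(v, b) \<in> block v" using verts_in(2) by (auto simp: block_def)
  then show "connected_subgraph (block v) blowup"
    using subgraph_block[OF v] connected_block[OF v] by (auto simp: connected_subgraph_def)
  show "block v \<subseteq> blocks" by (rule block_subset_blocks[OF v])
  fix D assume D: "connected_subgraph D blowup \<and> D \<subseteq> blocks \<and> block v \<subseteq> D"
  then have vb: "(v, b) \<in> D" using b by blast
  have "z \<in> block v" if z: "z \<in> D" for z
  proof -
    have "fst z = v" using connected_subgraph_in_block[OF _ _ z vb] D by simp
    moreover have "snd z \<in> topspace X2" using D z by (auto simp: blocks_def)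
    ultimately show ?thesis by (simp add: block_def mem_Times_iff)
  qed
  then show "D = block v" using D by blast
qed

lemma collapse_map_fst: "collapse_map G blowup T1 fst"
  unfolding collapse_map_def
proof (intro conjI exI[of _ blocks] G_morphism_fst quotient_map_fst subgraph_blocks ballI)
  fix g assume g: "g \<in> carrier G"
  show "act blowup g ` blocks \<subseteq> blocks"
  proof (intro image_subsetI)
    fix z assume z: "z \<in> blocks"
    then have "z \<in> points" using blocks_subset_points by blast
    then show "act blowup g z \<in> blocks"
      using z act_verts[OF graphs(1) actions(1) g] act_in_topspace[OF actions(2) g]
      by (auto simp: blowup_simps(4) blocks_def)
  qed
next
  fix z w assume "z \<in> topspace (gspace blowup)" "w \<in> topspace (gspace blowup)"
  then have zw: "z \<in> points" "w \<in> points" by (simp_all add: topspace_blowup)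
  show "fst z = fst w \<longleftrightarrow> z = w \<or> (\<exists>C\<in>graph_components blowup blocks. z \<in> C \<and> w \<in> C)"
  proof
    assume eq: "fst z = fst w"
    show "z = w \<or> (\<exists>C\<in>graph_components blowup blocks. z \<in> C \<and> w \<in> C)"
    proof (cases "fst z \<in> verts T1")
      case True
      have "z \<in> block (fst z)" "w \<in> block (fst z)"
        using point_components[OF zw(1)] point_components[OF zw(2)] eq by (simp_all add: block_def mem_Times_iff)
      then show ?thesis using block_component[OF True] by blast
    next
      case False
      then have zF: "z \<in> F" "w \<in> F"
        using zw eq by (auto simp: points_def blocks_def)
      have "(fst z, snd z) \<in> F" "(fst z, snd w) \<in> F"
        using zF(1) by (simp, use zF(2) in \<open>simp add: eq\<close>)
      then have "snd z = snd w" by (rule F_unique)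
      then show ?thesis using eq by (simp add: prod_eq_iff)
    qed
  next
    assume "z = w \<or> (\<exists>C\<in>graph_components blowup blocks. z \<in> C \<and> w \<in> C)"
    then show "fst z = fst w"
    proof
      assume "\<exists>C\<in>graph_components blowup blocks. z \<in> C \<and> w \<in> C"
      then obtain C where C: "C \<in> graph_components blowup blocks" "z \<in> C" "w \<in> C" by (elim bexE conjE)
      then have "connected_subgraph C blowup" "C \<subseteq> blocks" by (simp_all add: graph_components_def)
      then show "fst z = fst w" using C(2,3) by (rule connected_subgraph_in_block)
    qed simp
  qed
qed

lemma act_blowup_vertex:
  "\<lbrakk>v \<in> verts T1; x \<in> verts T2\<rbrakk> \<Longrightarrow> act blowup g (v, x) = (act T1 g v, act T2 g x)"
  using verts_blowup_subset by (auto simp: blowup_simps(4))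

lemma elliptic_blowup_iff: "elliptic H blowup \<longleftrightarrow> elliptic H T1 \<and> elliptic H T2"
proof
  assume "elliptic H blowup"
  then obtain v x where vx: "v \<in> verts T1" "x \<in> verts T2" "\<forall>h\<in>H. act blowup h (v, x) = (v, x)"
    by (auto simp: elliptic_def blowup_simps(1))
  then show "elliptic H T1 \<and> elliptic H T2"
    unfolding elliptic_def by (simp add: act_blowup_vertex) blast
next
  assume "elliptic H T1 \<and> elliptic H T2"
  then obtain v x where vx: "v \<in> verts T1" "\<forall>h\<in>H. act T1 h v = v" "x \<in> verts T2" "\<forall>h\<in>H. act T2 h x = x"
    unfolding elliptic_def by (elim conjE bexE)
  then show "elliptic H blowup"
    unfolding elliptic_def by (intro bexI[of _ "(v, x)"] ballI) (simp_all add: act_blowup_vertex blowup_simps(1))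
qed

lemma dominates_blowup: "dominates G blowup T2"
  unfolding dominates_def
proof
  fix z assume "z \<in> verts blowup"
  then obtain v x where z: "z = (v, x)" "v \<in> verts T1" "x \<in> verts T2" by (auto simp: blowup_simps(1))
  then have "\<forall>h\<in>stabilizer G (act blowup) z. act T2 h x = x"
    by (simp add: stabilizer_def act_blowup_vertex)
  then show "elliptic (stabilizer G (act blowup) z) T2"
    unfolding elliptic_def using z(3) by (rule bexI)
qed

lemma edge_stabilizer_blowup:
  assumes e: "e \<in> edges blowup"
  shows "fixes_edge (stabilizer G (act blowup) e) T1 \<or> fixes_edge (stabilizer G (act blowup) e) T2"
proof -
  have "e \<in> points" using e by (simp add: edges_def topspace_blowup)
  then have st: "\<forall>h\<in>stabilizer G (act blowup) e. act T1 h (fst e) = fst e"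
    "\<forall>h\<in>stabilizer G (act blowup) e. act T2 h (snd e) = snd e"
    by (auto simp: stabilizer_def blowup_simps(4) prod_eq_iff)
  have "fst e \<in> edges T1 \<or> snd e \<in> edges T2"
    using e F_edge(1)[of "fst e" "snd e"] by (auto simp: edges_blowup)
  then show ?thesis
    unfolding fixes_edge_def using st by blast
qed

end

theorem proposition4p9:
  fixes p :: nat
    and G :: "'g top_group"
    and T1 :: "('g, 'a) ggraph"
    and T2 :: "('g, 'b) ggraph"
  assumes "prime p"
    and "pro_p_group p G"
    and "G_tree p G T1"
    and "G_tree p G T2"
    and "finite (orbits G (topspace (gspace T1)) (act T1))"
    and "elliptic_wrt G T1 T2"
  shows "\<exists>(T :: ('g, 'a \<times> 'b) ggraph) \<pi>.
     G_tree p G T \<and> G_morphism G T T1 \<pi> \<and>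
     collapse_map G T T1 \<pi> \<and>
     (refinement G T T1 \<and> dominates G T T2) \<and>
     (\<forall>e\<in>edges T. fixes_edge (stabilizer G (act T) e) T1 \<or>
                   fixes_edge (stabilizer G (act T) e) T2) \<and>
     (\<forall>H. closed_subgroup H G \<longrightarrow> (elliptic H T \<longleftrightarrow> elliptic H T1 \<and> elliptic H T2))"
proof -
  have G: "group G" "topspace (gtop G) = carrier G" "compact_space (gtop G)"
    using assms(2) by (simp_all add: pro_p_group_def topological_group_def profinite_space_def)
  have graphs: "profinite_graph T1" "graph_action G T1" "profinite_graph T2" "graph_action G T2"
    using assms(3,4) by (simp_all add: G_tree_def pro_p_tree_def)
  obtain F where F: "closedin (prod_topology (gspace T1) (gspace T2)) F" "F \<subseteq> edges T1 \<times> verts T2"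
    "\<forall>e\<in>edges T1. \<exists>x. (e, x) \<in> F" "\<forall>e x y. (e, x) \<in> F \<longrightarrow> (e, y) \<in> F \<longrightarrow> x = y"
    "\<forall>g\<in>carrier G. \<forall>e x. (e, x) \<in> F \<longrightarrow> (act T1 g e, act T2 g x) \<in> F"
    using ex_equivariant_attaching_relation[OF G graphs assms(5,6)] by (elim exE conjE)
  interpret vertex_blowup p G T1 T2 F
  proof (rule vertex_blowup.intro)
    show "\<exists>x. (e, x) \<in> F" if "e \<in> edges T1" for e using bspec[OF F(3) that] .
    show "x = y" if "(e, x) \<in> F" "(e, y) \<in> F" for e x y using F(4) that by blast
    show "(act T1 g e, act T2 g x) \<in> F" if "g \<in> carrier G" "(e, x) \<in> F" for g e x
      using F(5) that by blast
  qed (use assms G F in simp_all)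
  have "refinement G blowup T1"
    unfolding refinement_def by (intro exI[of _ fst] collapse_map_fst)
  then show ?thesis
    by (intro exI[of _ blowup] exI[of _ fst] conjI ballI allI impI G_tree_blowup G_morphism_fst
        collapse_map_fst dominates_blowup edge_stabilizer_blowup elliptic_blowup_iff)
qed

end
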